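(* Let $\mathbb{K}$ be a field of characteristic zero, $B$ a unital associative $\mathbb{K}$-algebra, $M$ a dualisable (finitely generated projective) $B$-module, $(\mathfrak d,\varphi,\rho)$ a derivation action on $M$, $\nabla$ a connection on $M$, and $k\ge1$. If $\nabla$ is flat, then the map $\mathrm{Div}^\nabla_k\circ\mathrm{alt}\in C^k_{\mathrm{CE}}(\mathfrak d,|B|)$ is a Lie algebra $k$-cocycle. If $k$ is even, this cocycle vanishes.
   Context: Modules are left modules. $|B|=B/[B,B]$ is the quotient by the $\mathbb{K}$-span of commutators, $|b|$ the class of $b$. $\Omega^1B$ is the $B$-bimodule generated by symbols $db$ ($b\in B$) subject to $d$ being $\mathbb{K}$-linear and $d(bb')=(db)b'+b(db')$; $\Omega^pB$ is its $p$-fold tensor power over $B$, with exterior derivative $d$. For $f\in\mathrm{Der}_{\mathbb K}(B)$, $i_f\colon\Omega^1B\to B$ is the $B$-bimodule map with $i_f(db)=f(b)$. A derivation action on $M$ is a triple $(\mathfrak d,\varphi,\rho)$ with $\mathfrak d$ a Lie algebra over $\mathbb{K}$ and Lie algebra homomorphisms $\varphi\colon\mathfrak d\to\mathrm{Der}_{\mathbb K}(B)$, $\rho\colon\mathfrak d\to\mathrm{End}_{\mathbb K}(M)$ satisfying $\rho(f)(bm)=\varphi(f)(b)m+b\rho(f)(m)$. A connection on $M$ is a $\mathbb{K}$-linear map $\nabla\colon M\to\Omega^1B\otimes_BM$ with $\nabla(bm)=db\otimes m+b\nabla(m)$; it extends to $\Omega^pB\otimes_BM\to\Omega^{p+1}B\otimes_BM$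 by $\omega\otimes m\mapsto d\omega\otimes m+(-1)^p\omega\nabla(m)$, and is flat if $\nabla^2\colon M\to\Omega^2B\otimes_BM$ is zero. For $M$ dualisable, $\mathrm{Tr}\colon\mathrm{End}_B(M)\cong M^*\otimes_BM\to|B|$, $\mu\otimes m\mapsto|\mu(m)|$, with $M^*=\mathrm{Hom}_B(M,B)$. Define $c_\nabla\colon\mathfrak d\to\mathrm{End}_B(M)$ by $c_\nabla(f)=(i_{\varphi(f)}\otimes\mathrm{id}_M)\circ\nabla-\rho(f)$, and $\mathrm{Div}^\nabla_k\colon\mathfrak d^{\otimes k}\to|B|$ by $\mathrm{Div}^\nabla_k(f_1,\dots,f_k)=\mathrm{Tr}(c_\nabla(f_1)\circ\cdots\circ c_\nabla(f_k))$. The map $\mathrm{alt}\colon\wedge^k\mathfrak d\to\mathfrak d^{\otimes k}$ is $\mathrm{alt}(f_1\wedge\cdots\wedge f_k)=\sum_{s\in S_k}\mathrm{sgn}(s)f_{s(1)}\otimes\cdots\otimes f_{s(k)}$. $C^n_{\mathrm{CE}}(\mathfrak d,|B|)=\mathrm{Hom}_{\mathbb K}(\wedge^n\mathfrak d,|B|)$ is the Chevalley–Eilenberg complex, where $f\in\mathfrak d$ acts on $|B|$ by $f\cdot|b|=|\varphi(f)(b)|$, with differential $(d_{\mathrm{CE}}\psi)(x_0,\dots,x_n)=\sum_i(-1)^ix_i\cdot\psi(\dots,\check x_i,\dots)+\sum_{i<j}(-1)^{i+j}\psi([x_i,x_j],\dots,\check x_i,\dots,\check x_j,\dots)$. *)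

theory Defs
  imports
    "HOL-Algebra.Module"
    "HOL-Algebra.AbelCoset"
    "HOL-Algebra.Free_Abelian_Groups"
    "HOL-Algebra.Generated_Groups"
    "HOL-Combinatorics.Permutations"
begin

section \<open>Associative algebras, left modules, Lie algebras\<close>

text \<open>
  The locale \<^locale>\<open>algebra\<close> of HOL-Algebra is commutative, and the scalars of its locale
  \<^locale>\<open>module\<close> form a commutative ring; the two locales below drop commutativity.
  A \<open>\<K>\<close>-algebra is a record whose \<^const>\<open>smult\<close> is the action of \<open>\<K>\<close>; the records of
  left modules over it have its elements as scalars. Where an object is only a module, the
  multiplicative fields \<^const>\<open>monoid.mult\<close>, \<^const>\<open>one\<close> of its record are meaningless.
\<close>

locale assoc_algebra = module K B + B: ring B
  for K (structure) and B (structure) +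
  assumes smult_mult_left:
      "\<lbrakk>k \<in> carrier K; x \<in> carrier B; y \<in> carrier B\<rbrakk>
        \<Longrightarrow> (k \<odot>\<^bsub>B\<^esub> x) \<otimes>\<^bsub>B\<^esub> y = k \<odot>\<^bsub>B\<^esub> (x \<otimes>\<^bsub>B\<^esub> y)"
    and smult_mult_right:
      "\<lbrakk>k \<in> carrier K; x \<in> carrier B; y \<in> carrier B\<rbrakk>
        \<Longrightarrow> x \<otimes>\<^bsub>B\<^esub> (k \<odot>\<^bsub>B\<^esub> y) = k \<odot>\<^bsub>B\<^esub> (x \<otimes>\<^bsub>B\<^esub> y)"

locale left_module = R?: ring R + M?: abelian_group M
  for R (structure) and M (structure) +
  assumes smult_closed:
      "\<lbrakk>a \<in> carrier R; x \<in> carrier M\<rbrakk> \<Longrightarrow> a \<odot>\<^bsub>M\<^esub> x \<in> carrier M"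
    and smult_l_distr:
      "\<lbrakk>a \<in> carrier R; b \<in> carrier R; x \<in> carrier M\<rbrakk>
        \<Longrightarrow> (a \<oplus>\<^bsub>R\<^esub> b) \<odot>\<^bsub>M\<^esub> x = a \<odot>\<^bsub>M\<^esub> x \<oplus>\<^bsub>M\<^esub> b \<odot>\<^bsub>M\<^esub> x"
    and smult_r_distr:
      "\<lbrakk>a \<in> carrier R; x \<in> carrier M; y \<in> carrier M\<rbrakk>
        \<Longrightarrow> a \<odot>\<^bsub>M\<^esub> (x \<oplus>\<^bsub>M\<^esub> y) = a \<odot>\<^bsub>M\<^esub> x \<oplus>\<^bsub>M\<^esub> a \<odot>\<^bsub>M\<^esub> y"
    and smult_assoc:
      "\<lbrakk>a \<in> carrier R; b \<in> carrier R; x \<in> carrier M\<rbrakk>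
        \<Longrightarrow> (a \<otimes>\<^bsub>R\<^esub> b) \<odot>\<^bsub>M\<^esub> x = a \<odot>\<^bsub>M\<^esub> (b \<odot>\<^bsub>M\<^esub> x)"
    and smult_one: "x \<in> carrier M \<Longrightarrow> \<one>\<^bsub>R\<^esub> \<odot>\<^bsub>M\<^esub> x = x"

record ('k, 'd) lie = "('k, 'd) module" +
  bracket :: "'d \<Rightarrow> 'd \<Rightarrow> 'd"

locale lie_algebra = module K L for K (structure) and L (structure) +
  assumes bracket_closed:
      "\<lbrakk>x \<in> carrier L; y \<in> carrier L\<rbrakk> \<Longrightarrow> bracket L x y \<in> carrier L"
    and bracket_add_left:
      "\<lbrakk>x \<in> carrier L; y \<in> carrier L; z \<in> carrier L\<rbrakk>
        \<Longrightarrow> bracket L (x \<oplus>\<^bsub>L\<^esub> y) z = bracket L x z \<oplus>\<^bsub>L\<^esub> bracket L y z"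
    and bracket_add_right:
      "\<lbrakk>x \<in> carrier L; y \<in> carrier L; z \<in> carrier L\<rbrakk>
        \<Longrightarrow> bracket L x (y \<oplus>\<^bsub>L\<^esub> z) = bracket L x y \<oplus>\<^bsub>L\<^esub> bracket L x z"
    and bracket_smult_left:
      "\<lbrakk>k \<in> carrier K; x \<in> carrier L; y \<in> carrier L\<rbrakk>
        \<Longrightarrow> bracket L (k \<odot>\<^bsub>L\<^esub> x) y = k \<odot>\<^bsub>L\<^esub> bracket L x y"
    and bracket_smult_right:
      "\<lbrakk>k \<in> carrier K; x \<in> carrier L; y \<in> carrier L\<rbrakk>
        \<Longrightarrow> bracket L x (k \<odot>\<^bsub>L\<^esub> y) = k \<odot>\<^bsub>L\<^esub> bracket L x y"
    and bracket_self: "x \<in> carrier L \<Longrightarrow> bracket L x x = \<zero>\<^bsub>L\<^esub>"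
    and jacobi:
      "\<lbrakk>x \<in> carrier L; y \<in> carrier L; z \<in> carrier L\<rbrakk>
        \<Longrightarrow> bracket L x (bracket L y z) \<oplus>\<^bsub>L\<^esub> bracket L y (bracket L z x)
              \<oplus>\<^bsub>L\<^esub> bracket L z (bracket L x y) = \<zero>\<^bsub>L\<^esub>"

section \<open>Linear maps\<close>

definition linear_map ::
  "('r, 'x) ring_scheme \<Rightarrow> ('r, 'v, 'y) module_scheme \<Rightarrow> ('r, 'w, 'z) module_scheme
    \<Rightarrow> ('v \<Rightarrow> 'w) \<Rightarrow> bool" where
  "linear_map R V W h \<longleftrightarrow>
     h \<in> carrier V \<rightarrow> carrier W \<and>
     (\<forall>x\<in>carrier V. \<forall>y\<in>carrier V. h (x \<oplus>\<^bsub>V\<^esub> y) = h x \<oplus>\<^bsub>W\<^esub> h y) \<and>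
     (\<forall>r\<in>carrier R. \<forall>x\<in>carrier V. h (r \<odot>\<^bsub>V\<^esub> x) = r \<odot>\<^bsub>W\<^esub> h x)"

definition linear_maps ::
  "('r, 'x) ring_scheme \<Rightarrow> ('r, 'v, 'y) module_scheme \<Rightarrow> ('r, 'w, 'z) module_scheme
    \<Rightarrow> ('v \<Rightarrow> 'w) set" where
  "linear_maps R V W = {h \<in> extensional (carrier V). linear_map R V W h}"

text \<open>
  A set \<open>C\<close> of extensional functions \<open>X \<rightarrow> V\<close> with the pointwise operations.
  For noncommutative scalars, \<open>C\<close> need not be closed under \<^const>\<open>smult\<close>; in that case
  only the additive structure is used.
\<close>

definition pointwise ::
  "'x set \<Rightarrow> ('r, 'v, 'z) module_scheme \<Rightarrow> ('x \<Rightarrow> 'v) set \<Rightarrow> ('r, 'x \<Rightarrow> 'v) module" where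
  "pointwise X V C =
     \<lparr>carrier = C, monoid.mult = undefined, one = undefined,
      ring.zero = (\<lambda>x\<in>X. \<zero>\<^bsub>V\<^esub>), ring.add = (\<lambda>g h. \<lambda>x\<in>X. g x \<oplus>\<^bsub>V\<^esub> h x),
      smult = (\<lambda>r h. \<lambda>x\<in>X. r \<odot>\<^bsub>V\<^esub> h x)\<rparr>"

definition regular :: "('b, 'z) ring_scheme \<Rightarrow> ('b, 'b) module" where
  "regular B =
     \<lparr>carrier = carrier B, monoid.mult = monoid.mult B, one = \<one>\<^bsub>B\<^esub>, ring.zero = \<zero>\<^bsub>B\<^esub>, ring.add = ring.add B,
      smult = monoid.mult B\<rparr>"

definition restrict_scalars ::
  "('k, 'b, 'y) module_scheme \<Rightarrow> ('b, 'm, 'z) module_scheme \<Rightarrow> ('k, 'm) module" where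
  "restrict_scalars B M =
     \<lparr>carrier = carrier M, monoid.mult = undefined, one = undefined, ring.zero = \<zero>\<^bsub>M\<^esub>, ring.add = ring.add M,
      smult = (\<lambda>k m. (k \<odot>\<^bsub>B\<^esub> \<one>\<^bsub>B\<^esub>) \<odot>\<^bsub>M\<^esub> m)\<rparr>"

definition free_module :: "('b, 'z) ring_scheme \<Rightarrow> nat \<Rightarrow> ('b, nat \<Rightarrow> 'b) module" where
  "free_module B n = pointwise {..<n} (regular B) ({..<n} \<rightarrow>\<^sub>E carrier B)"

text \<open>
  Finitely generated projective: a direct summand of \<open>B\<^sup>n\<close> for some \<open>n\<close>.
\<close>

definition fin_gen_projective ::
  "('b, 'y) ring_scheme \<Rightarrow> ('b, 'm, 'z) module_scheme \<Rightarrow> bool" where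
  "fin_gen_projective B M \<longleftrightarrow>
     (\<exists>n i p. linear_map B M (free_module B n) i \<and> linear_map B (free_module B n) M p \<and>
        (\<forall>m\<in>carrier M. p (i m) = m))"

section \<open>Derivation actions\<close>

definition commutator_lie ::
  "('k, 'v, 'z) module_scheme \<Rightarrow> ('v \<Rightarrow> 'v) set \<Rightarrow> ('k, 'v \<Rightarrow> 'v) lie" where
  "commutator_lie V C =
     (let P = pointwise (carrier V) V C in
      \<lparr>carrier = C, monoid.mult = undefined, one = undefined, ring.zero = \<zero>\<^bsub>P\<^esub>, ring.add = ring.add P, smult = smult P,
       bracket = (\<lambda>g h. \<lambda>x\<in>carrier V. g (h x) \<ominus>\<^bsub>V\<^esub> h (g x))\<rparr>)"

definition End_lie ::
  "('k, 'x) ring_scheme \<Rightarrow> ('k, 'v, 'z) module_scheme \<Rightarrow> ('k, 'v \<Rightarrow> 'v) lie" where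
  "End_lie K V = commutator_lie V (linear_maps K V V)"

definition Der_lie ::
  "('k, 'x) ring_scheme \<Rightarrow> ('k, 'b, 'z) module_scheme \<Rightarrow> ('k, 'b \<Rightarrow> 'b) lie" where
  "Der_lie K B = commutator_lie B
     {h \<in> linear_maps K B B. \<forall>a\<in>carrier B. \<forall>b\<in>carrier B.
        h (a \<otimes>\<^bsub>B\<^esub> b) = h a \<otimes>\<^bsub>B\<^esub> b \<oplus>\<^bsub>B\<^esub> a \<otimes>\<^bsub>B\<^esub> h b}"

definition lie_hom ::
  "('k, 'x) ring_scheme \<Rightarrow> ('k, 'd, 'y) lie_scheme \<Rightarrow> ('k, 'e, 'z) lie_scheme
    \<Rightarrow> ('d \<Rightarrow> 'e) \<Rightarrow> bool" where
  "lie_hom K L L' h \<longleftrightarrow>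
     linear_map K L L' h \<and>
     (\<forall>x\<in>carrier L. \<forall>y\<in>carrier L. h (bracket L x y) = bracket L' (h x) (h y))"

definition derivation_action ::
  "('k, 'x) ring_scheme \<Rightarrow> ('k, 'b, 'y) module_scheme \<Rightarrow> ('b, 'm, 'z) module_scheme
    \<Rightarrow> ('k, 'd, 'w) lie_scheme \<Rightarrow> ('d \<Rightarrow> 'b \<Rightarrow> 'b) \<Rightarrow> ('d \<Rightarrow> 'm \<Rightarrow> 'm) \<Rightarrow> bool" where
  "derivation_action K B M D \<phi> \<rho> \<longleftrightarrow>
     lie_algebra K D \<and>
     lie_hom K D (Der_lie K B) \<phi> \<and>
     lie_hom K D (End_lie K (restrict_scalars B M)) \<rho> \<and>
     (\<forall>f\<in>carrier D. \<forall>b\<in>carrier B. \<forall>m\<in>carrier M.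
        \<rho> f (b \<odot>\<^bsub>M\<^esub> m) = \<phi> f b \<odot>\<^bsub>M\<^esub> m \<oplus>\<^bsub>M\<^esub> b \<odot>\<^bsub>M\<^esub> \<rho> f m)"

section \<open>Abelian groups by generators and relations; tensor products\<close>

text \<open>
  The abelian group with generating set \<open>X\<close> and relators \<open>R\<close>, written additively. Its elements
  are cosets in \<^term>\<open>free_Abelian_group X\<close>.
\<close>

definition relator_group :: "'x set \<Rightarrow> ('x \<Rightarrow>\<^sub>0 int) set \<Rightarrow> ('x \<Rightarrow>\<^sub>0 int) set" where
  "relator_group X R = generate (free_Abelian_group X) R"

definition presented :: "'x set \<Rightarrow> ('x \<Rightarrow>\<^sub>0 int) set \<Rightarrow> ('x \<Rightarrow>\<^sub>0 int) set ring" where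
  "presented X R =
     (let Q = free_Abelian_group X Mod relator_group X R in
      \<lparr>carrier = carrier Q, monoid.mult = undefined, one = undefined,
       ring.zero = \<one>\<^bsub>Q\<^esub>, ring.add = monoid.mult Q\<rparr>)"

definition generator :: "'x set \<Rightarrow> ('x \<Rightarrow>\<^sub>0 int) set \<Rightarrow> 'x \<Rightarrow> ('x \<Rightarrow>\<^sub>0 int) set" where
  "generator X R x = relator_group X R #>\<^bsub>free_Abelian_group X\<^esub> frag_of x"

text \<open>
  The additive map out of \<^const>\<open>presented\<close> that is prescribed by \<open>g\<close> on generators: the
  \<open>\<int>\<close>-linear extension of \<open>g\<close>, evaluated on the representatives of a coset. It makes sense
  when \<open>g\<close> respects the relators, so that all representatives give one value.
\<close>

definition lift :: "('g, 'z) ring_scheme \<Rightarrow> ('x \<Rightarrow> 'g) \<Rightarrow> ('x \<Rightarrow>\<^sub>0 int) set \<Rightarrow> 'g" where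
  "lift G g C =
     the_elem ((\<lambda>p. \<Oplus>\<^bsub>G\<^esub>x\<in>Poly_Mapping.keys p. [Poly_Mapping.lookup p x] \<cdot>\<^bsub>G\<^esub> g x) ` C)"

record ('b, 'w) bimodule = "('b, 'w) module" +
  rsmult :: "'w \<Rightarrow> 'b \<Rightarrow> 'w"

definition tensor_relators ::
  "('b, 'x) ring_scheme \<Rightarrow> ('b, 'w, 'y) bimodule_scheme \<Rightarrow> ('b, 'm, 'z) module_scheme
    \<Rightarrow> ('w \<times> 'm \<Rightarrow>\<^sub>0 int) set" where
  "tensor_relators B W M =
     {frag_of (w \<oplus>\<^bsub>W\<^esub> w', m) - frag_of (w, m) - frag_of (w', m) | w w' m.
        w \<in> carrier W \<and> w' \<in> carrier W \<and> m \<in> carrier M} \<union>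
     {frag_of (w, m \<oplus>\<^bsub>M\<^esub> m') - frag_of (w, m) - frag_of (w, m') | w m m'.
        w \<in> carrier W \<and> m \<in> carrier M \<and> m' \<in> carrier M} \<union>
     {frag_of (rsmult W w b, m) - frag_of (w, b \<odot>\<^bsub>M\<^esub> m) | w b m.
        w \<in> carrier W \<and> b \<in> carrier B \<and> m \<in> carrier M}"

definition pure ::
  "('b, 'x) ring_scheme \<Rightarrow> ('b, 'w, 'y) bimodule_scheme \<Rightarrow> ('b, 'm, 'z) module_scheme
    \<Rightarrow> 'w \<Rightarrow> 'm \<Rightarrow> ('w \<times> 'm \<Rightarrow>\<^sub>0 int) set" where
  "pure B W M w m = generator (carrier W \<times> carrier M) (tensor_relators B W M) (w, m)"

definition tensor_group ::
  "('b, 'x) ring_scheme \<Rightarrow> ('b, 'w, 'y) bimodule_scheme \<Rightarrow> ('b, 'm, 'z) module_scheme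
    \<Rightarrow> ('w \<times> 'm \<Rightarrow>\<^sub>0 int) set ring" where
  "tensor_group B W M = presented (carrier W \<times> carrier M) (tensor_relators B W M)"

text \<open>
  The left action on \<open>W \<otimes>\<^sub>B M\<close> comes from \<open>W\<close>, the right action on \<open>W \<otimes>\<^sub>B V\<close> from \<open>V\<close>.
\<close>

definition tensor ::
  "('b, 'x) ring_scheme \<Rightarrow> ('b, 'w, 'y) bimodule_scheme \<Rightarrow> ('b, 'm, 'z) module_scheme
    \<Rightarrow> ('b, ('w \<times> 'm \<Rightarrow>\<^sub>0 int) set) module" where
  "tensor B W M =
     (let G = tensor_group B W M in
      \<lparr>carrier = carrier G, monoid.mult = undefined, one = undefined, ring.zero = \<zero>\<^bsub>G\<^esub>, ring.add = ring.add G,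
       smult = (\<lambda>b. lift G (\<lambda>(w, m). pure B W M (b \<odot>\<^bsub>W\<^esub> w) m))\<rparr>)"

definition bitensor ::
  "('b, 'x) ring_scheme \<Rightarrow> ('b, 'w, 'y) bimodule_scheme \<Rightarrow> ('b, 'v, 'z) bimodule_scheme
    \<Rightarrow> ('b, ('w \<times> 'v \<Rightarrow>\<^sub>0 int) set) bimodule" where
  "bitensor B W V =
     (let T = tensor B W V in
      \<lparr>carrier = carrier T, monoid.mult = undefined, one = undefined, ring.zero = \<zero>\<^bsub>T\<^esub>, ring.add = ring.add T,
       smult = smult T,
       rsmult = (\<lambda>t b. lift T (\<lambda>(w, v). pure B W V w (rsmult V v b)) t)\<rparr>)"

section \<open>Noncommutative differential forms\<close>

text \<open>
  As an abelian group, \<open>\<Omega>\<^sup>1B\<close> is generated by the elements \<open>a db c\<close>, encoded as triples \<open>(a, b, c)\<close>.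
  The relators express biadditivity in \<open>a\<close> and \<open>c\<close> (the bimodule freely generated by the
  symbols \<open>db\<close>), additivity and \<open>\<K>\<close>-homogeneity of \<open>d\<close>, and the Leibniz rule.
\<close>

type_synonym 'b form1 = "('b \<times> 'b \<times> 'b \<Rightarrow>\<^sub>0 int) set"
type_synonym 'b form2 = "('b form1 \<times> 'b form1 \<Rightarrow>\<^sub>0 int) set"

definition form_gens :: "('b, 'z) ring_scheme \<Rightarrow> ('b \<times> 'b \<times> 'b) set" where
  "form_gens B = carrier B \<times> carrier B \<times> carrier B"

definition form_relators ::
  "('k, 'x) ring_scheme \<Rightarrow> ('k, 'b, 'y) module_scheme \<Rightarrow> ('b \<times> 'b \<times> 'b \<Rightarrow>\<^sub>0 int) set" where
  "form_relators K B =
     {frag_of (a \<oplus>\<^bsub>B\<^esub> a', b, c) - frag_of (a, b, c) - frag_of (a', b, c) | a a' b c.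
        a \<in> carrier B \<and> a' \<in> carrier B \<and> b \<in> carrier B \<and> c \<in> carrier B} \<union>
     {frag_of (a, b, c \<oplus>\<^bsub>B\<^esub> c') - frag_of (a, b, c) - frag_of (a, b, c') | a b c c'.
        a \<in> carrier B \<and> b \<in> carrier B \<and> c \<in> carrier B \<and> c' \<in> carrier B} \<union>
     {frag_of (a, b \<oplus>\<^bsub>B\<^esub> b', c) - frag_of (a, b, c) - frag_of (a, b', c) | a b b' c.
        a \<in> carrier B \<and> b \<in> carrier B \<and> b' \<in> carrier B \<and> c \<in> carrier B} \<union>
     {frag_of (a, k \<odot>\<^bsub>B\<^esub> b, c) - frag_of (k \<odot>\<^bsub>B\<^esub> a, b, c) | k a b c.
        k \<in> carrier K \<and> a \<in> carrier B \<and> b \<in> carrier B \<and> c \<in> carrier B} \<union>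
     {frag_of (a, b \<otimes>\<^bsub>B\<^esub> b', c) - frag_of (a, b, b' \<otimes>\<^bsub>B\<^esub> c) - frag_of (a \<otimes>\<^bsub>B\<^esub> b, b', c) | a b b' c.
        a \<in> carrier B \<and> b \<in> carrier B \<and> b' \<in> carrier B \<and> c \<in> carrier B}"

definition form_gen ::
  "('k, 'x) ring_scheme \<Rightarrow> ('k, 'b, 'y) module_scheme \<Rightarrow> 'b \<Rightarrow> 'b \<Rightarrow> 'b \<Rightarrow> 'b form1" where
  "form_gen K B a b c = generator (form_gens B) (form_relators K B) (a, b, c)"

definition Omega1 ::
  "('k, 'x) ring_scheme \<Rightarrow> ('k, 'b, 'y) module_scheme \<Rightarrow> ('b, 'b form1) bimodule" where
  "Omega1 K B =
     (let G = presented (form_gens B) (form_relators K B) in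
      \<lparr>carrier = carrier G, monoid.mult = undefined, one = undefined, ring.zero = \<zero>\<^bsub>G\<^esub>, ring.add = ring.add G,
       smult = (\<lambda>e. lift G (\<lambda>(a, b, c). form_gen K B (e \<otimes>\<^bsub>B\<^esub> a) b c)),
       rsmult = (\<lambda>\<omega> e. lift G (\<lambda>(a, b, c). form_gen K B a b (c \<otimes>\<^bsub>B\<^esub> e)) \<omega>)\<rparr>)"

definition Omega2 ::
  "('k, 'x) ring_scheme \<Rightarrow> ('k, 'b, 'y) module_scheme \<Rightarrow> ('b, 'b form2) bimodule" where
  "Omega2 K B = bitensor B (Omega1 K B) (Omega1 K B)"

definition d0 ::
  "('k, 'x) ring_scheme \<Rightarrow> ('k, 'b, 'y) module_scheme \<Rightarrow> 'b \<Rightarrow> 'b form1" where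
  "d0 K B b = form_gen K B \<one>\<^bsub>B\<^esub> b \<one>\<^bsub>B\<^esub>"

text \<open>
  By \<open>d\<^sup>2 = 0\<close> and the graded Leibniz rule, \<open>d(a db c) = da \<otimes> db c - a db \<otimes> dc\<close>.
\<close>

definition d1 ::
  "('k, 'x) ring_scheme \<Rightarrow> ('k, 'b, 'y) module_scheme \<Rightarrow> 'b form1 \<Rightarrow> 'b form2" where
  "d1 K B = lift (Omega2 K B) (\<lambda>(a, b, c).
     pure B (Omega1 K B) (Omega1 K B) (d0 K B a) (form_gen K B \<one>\<^bsub>B\<^esub> b c) \<ominus>\<^bsub>Omega2 K B\<^esub>
     pure B (Omega1 K B) (Omega1 K B) (form_gen K B a b \<one>\<^bsub>B\<^esub>) (d0 K B c))"

definition contraction ::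
  "('b, 'z) ring_scheme \<Rightarrow> ('b \<Rightarrow> 'b) \<Rightarrow> 'b form1 \<Rightarrow> 'b" where
  "contraction B f = lift B (\<lambda>(a, b, c). a \<otimes>\<^bsub>B\<^esub> f b \<otimes>\<^bsub>B\<^esub> c)"

section \<open>Connections\<close>

definition connection ::
  "('k, 'x) ring_scheme \<Rightarrow> ('k, 'b, 'y) module_scheme \<Rightarrow> ('b, 'm, 'z) module_scheme
    \<Rightarrow> ('m \<Rightarrow> ('b form1 \<times> 'm \<Rightarrow>\<^sub>0 int) set) \<Rightarrow> bool" where
  "connection K B M nabla \<longleftrightarrow>
     (let T = tensor B (Omega1 K B) M in
      linear_map K (restrict_scalars B M) (restrict_scalars B T) nabla \<and>
      (\<forall>b\<in>carrier B. \<forall>m\<in>carrier M.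
         nabla (b \<odot>\<^bsub>M\<^esub> m) = pure B (Omega1 K B) M (d0 K B b) m \<oplus>\<^bsub>T\<^esub> b \<odot>\<^bsub>T\<^esub> nabla m))"

text \<open>
  The product \<open>\<omega> t\<close> of \<open>\<omega> \<in> \<Omega>\<^sup>1B\<close> with \<open>t \<in> \<Omega>\<^sup>1B \<otimes>\<^sub>B M\<close>, an element of \<open>\<Omega>\<^sup>2B \<otimes>\<^sub>B M\<close>.
\<close>

definition form_times ::
  "('k, 'x) ring_scheme \<Rightarrow> ('k, 'b, 'y) module_scheme \<Rightarrow> ('b, 'm, 'z) module_scheme
    \<Rightarrow> 'b form1 \<Rightarrow> ('b form1 \<times> 'm \<Rightarrow>\<^sub>0 int) set \<Rightarrow> ('b form2 \<times> 'm \<Rightarrow>\<^sub>0 int) set" where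
  "form_times K B M \<omega> = lift (tensor B (Omega2 K B) M)
     (\<lambda>(\<eta>, m). pure B (Omega2 K B) M (pure B (Omega1 K B) (Omega1 K B) \<omega> \<eta>) m)"

text \<open>
  The extension of \<open>\<nabla>\<close> to \<open>\<Omega>\<^sup>1B \<otimes>\<^sub>B M \<rightarrow> \<Omega>\<^sup>2B \<otimes>\<^sub>B M\<close>, \<open>\<omega> \<otimes> m \<mapsto> d\<omega> \<otimes> m - \<omega> \<nabla>(m)\<close>. Flatness
  involves no extension to forms of higher degree.
\<close>

definition connection_ext ::
  "('k, 'x) ring_scheme \<Rightarrow> ('k, 'b, 'y) module_scheme \<Rightarrow> ('b, 'm, 'z) module_scheme
    \<Rightarrow> ('m \<Rightarrow> ('b form1 \<times> 'm \<Rightarrow>\<^sub>0 int) set)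
    \<Rightarrow> ('b form1 \<times> 'm \<Rightarrow>\<^sub>0 int) set \<Rightarrow> ('b form2 \<times> 'm \<Rightarrow>\<^sub>0 int) set" where
  "connection_ext K B M nabla =
     (let T = tensor B (Omega2 K B) M in
      lift T (\<lambda>(\<omega>, m). pure B (Omega2 K B) M (d1 K B \<omega>) m \<ominus>\<^bsub>T\<^esub> form_times K B M \<omega> (nabla m)))"

definition flat ::
  "('k, 'x) ring_scheme \<Rightarrow> ('k, 'b, 'y) module_scheme \<Rightarrow> ('b, 'm, 'z) module_scheme
    \<Rightarrow> ('m \<Rightarrow> ('b form1 \<times> 'm \<Rightarrow>\<^sub>0 int) set) \<Rightarrow> bool" where
  "flat K B M nabla \<longleftrightarrow>
     (\<forall>m\<in>carrier M. connection_ext K B M nabla (nabla m) = \<zero>\<^bsub>tensor B (Omega2 K B) M\<^esub>)"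

text \<open>
  Here \<open>i\<^sub>f \<otimes> id\<^sub>M\<close> is composed with the canonical isomorphism \<open>B \<otimes>\<^sub>B M \<rightarrow> M\<close>.
\<close>

definition contraction_id ::
  "('b, 'y) ring_scheme \<Rightarrow> ('b, 'm, 'z) module_scheme \<Rightarrow> ('b \<Rightarrow> 'b)
    \<Rightarrow> ('b form1 \<times> 'm \<Rightarrow>\<^sub>0 int) set \<Rightarrow> 'm" where
  "contraction_id B M f = lift M (\<lambda>(\<omega>, m). contraction B f \<omega> \<odot>\<^bsub>M\<^esub> m)"

definition connection_diff ::
  "('b, 'y) ring_scheme \<Rightarrow> ('b, 'm, 'z) module_scheme \<Rightarrow> ('d \<Rightarrow> 'b \<Rightarrow> 'b) \<Rightarrow> ('d \<Rightarrow> 'm \<Rightarrow> 'm)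
    \<Rightarrow> ('m \<Rightarrow> ('b form1 \<times> 'm \<Rightarrow>\<^sub>0 int) set) \<Rightarrow> 'd \<Rightarrow> 'm \<Rightarrow> 'm" where
  "connection_diff B M \<phi> \<rho> nabla f =
     (\<lambda>m\<in>carrier M. contraction_id B M (\<phi> f) (nabla m) \<ominus>\<^bsub>M\<^esub> \<rho> f m)"

section \<open>The trace\<close>

definition commutator_space ::
  "('k, 'x) ring_scheme \<Rightarrow> ('k, 'b, 'y) module_scheme \<Rightarrow> 'b set" where
  "commutator_space K B =
     \<Inter>{N. submodule N K B \<and>
         (\<forall>a\<in>carrier B. \<forall>b\<in>carrier B. a \<otimes>\<^bsub>B\<^esub> b \<ominus>\<^bsub>B\<^esub> b \<otimes>\<^bsub>B\<^esub> a \<in> N)}"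

definition cyc_class ::
  "('k, 'x) ring_scheme \<Rightarrow> ('k, 'b, 'y) module_scheme \<Rightarrow> 'b \<Rightarrow> 'b set" where
  "cyc_class K B b = commutator_space K B +>\<^bsub>B\<^esub> b"

definition cyc ::
  "('k, 'x) ring_scheme \<Rightarrow> ('k, 'b, 'y) module_scheme \<Rightarrow> ('k, 'b set) module" where
  "cyc K B =
     \<lparr>carrier = a_rcosets\<^bsub>B\<^esub> (commutator_space K B), monoid.mult = undefined, one = undefined,
      ring.zero = commutator_space K B, ring.add = set_add B,
      smult = (\<lambda>k C. the_elem ((\<lambda>b. cyc_class K B (k \<odot>\<^bsub>B\<^esub> b)) ` C))\<rparr>"

text \<open>
  \<open>M\<^sup>* = Hom\<^sub>B(M, B)\<close> is a right \<open>B\<close>-module by \<open>(\<mu> b)(m) = \<mu>(m) b\<close>; it has no left action.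
\<close>

definition dual ::
  "('b, 'y) ring_scheme \<Rightarrow> ('b, 'm, 'z) module_scheme \<Rightarrow> ('b, 'm \<Rightarrow> 'b) bimodule" where
  "dual B M =
     (let P = pointwise (carrier M) (regular B) (linear_maps B M (regular B)) in
      \<lparr>carrier = carrier P, monoid.mult = undefined, one = undefined, ring.zero = \<zero>\<^bsub>P\<^esub>, ring.add = ring.add P,
       smult = undefined, rsmult = (\<lambda>\<mu> b. \<lambda>m\<in>carrier M. \<mu> m \<otimes>\<^bsub>B\<^esub> b)\<rparr>)"

text \<open>
  The canonical map \<open>M\<^sup>* \<otimes>\<^sub>B M \<rightarrow> End\<^sub>B(M)\<close>, \<open>\<mu> \<otimes> m \<mapsto> (x \<mapsto> \<mu>(x) m)\<close>, which is bijective for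
  dualisable \<open>M\<close>.
\<close>

definition dual_tensor_to_End ::
  "('b, 'y) ring_scheme \<Rightarrow> ('b, 'm, 'z) module_scheme
    \<Rightarrow> (('m \<Rightarrow> 'b) \<times> 'm \<Rightarrow>\<^sub>0 int) set \<Rightarrow> 'm \<Rightarrow> 'm" where
  "dual_tensor_to_End B M =
     lift (pointwise (carrier M) M (linear_maps B M M))
       (\<lambda>(\<mu>, m). \<lambda>x\<in>carrier M. \<mu> x \<odot>\<^bsub>M\<^esub> m)"

definition Tr ::
  "('k, 'x) ring_scheme \<Rightarrow> ('k, 'b, 'y) module_scheme \<Rightarrow> ('b, 'm, 'z) module_scheme
    \<Rightarrow> ('m \<Rightarrow> 'm) \<Rightarrow> 'b set" where
  "Tr K B M h =
     lift (cyc K B) (\<lambda>(\<mu>, m). cyc_class K B (\<mu> m))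
       (inv_into (carrier (tensor B (dual B M) M)) (dual_tensor_to_End B M) h)"

section \<open>Divergence cochains\<close>

text \<open>
  A linear map on \<open>\<dd>\<^sup>\<otimes>\<^sup>n\<close> is represented by the corresponding multilinear map, a linear map on
  the \<open>n\<close>-th exterior power of \<open>\<dd>\<close> by the corresponding alternating multilinear map. The arguments
  are lists of length \<open>n\<close> of elements of \<open>\<dd>\<close>, indexed from \<open>0\<close>. Precomposition with \<open>alt\<close>
  becomes \<open>comp_alt\<close>.
\<close>

definition Div ::
  "('k, 'x) ring_scheme \<Rightarrow> ('k, 'b, 'y) module_scheme \<Rightarrow> ('b, 'm, 'z) module_scheme
    \<Rightarrow> ('d \<Rightarrow> 'b \<Rightarrow> 'b) \<Rightarrow> ('d \<Rightarrow> 'm \<Rightarrow> 'm) \<Rightarrow> ('m \<Rightarrow> ('b form1 \<times> 'm \<Rightarrow>\<^sub>0 int) set)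
    \<Rightarrow> 'd list \<Rightarrow> 'b set" where
  "Div K B M \<phi> \<rho> nabla fs =
     Tr K B M (foldr (compose (carrier M)) (map (connection_diff B M \<phi> \<rho> nabla) fs)
                 (\<lambda>m\<in>carrier M. m))"

definition comp_alt ::
  "('v, 'z) ring_scheme \<Rightarrow> ('d list \<Rightarrow> 'v) \<Rightarrow> 'd list \<Rightarrow> 'v" where
  "comp_alt V F fs =
     (\<Oplus>\<^bsub>V\<^esub>s\<in>{s. s permutes {..<length fs}}. [sign s] \<cdot>\<^bsub>V\<^esub> F (permute_list s fs))"

section \<open>Chevalley--Eilenberg cochains\<close>

definition ce_cochains ::
  "('k, 'x) ring_scheme \<Rightarrow> ('k, 'd, 'y) lie_scheme \<Rightarrow> ('k, 'v, 'z) module_scheme \<Rightarrow> nat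
    \<Rightarrow> ('d list \<Rightarrow> 'v) set" where
  "ce_cochains K D V n =
     {\<psi>. (\<forall>xs. length xs = n \<and> set xs \<subseteq> carrier D \<longrightarrow>
            \<psi> xs \<in> carrier V \<and>
            (\<forall>i<n. linear_map K D V (\<lambda>y. \<psi> (xs[i := y]))) \<and>
            (\<forall>i<n. \<forall>j<n. i \<noteq> j \<and> xs ! i = xs ! j \<longrightarrow> \<psi> xs = \<zero>\<^bsub>V\<^esub>))}"

definition ce_differential ::
  "('k, 'd, 'y) lie_scheme \<Rightarrow> ('k, 'v, 'z) module_scheme \<Rightarrow> ('d \<Rightarrow> 'v \<Rightarrow> 'v)
    \<Rightarrow> ('d list \<Rightarrow> 'v) \<Rightarrow> 'd list \<Rightarrow> 'v" where
  "ce_differential D V act \<psi> xs =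
     (\<Oplus>\<^bsub>V\<^esub>i\<in>{..<length xs}. [((-1::int) ^ i)] \<cdot>\<^bsub>V\<^esub> act (xs ! i) (\<psi> (nths xs (- {i}))))
     \<oplus>\<^bsub>V\<^esub>
     finsum V (\<lambda>(i, j). [((-1::int) ^ (i + j))] \<cdot>\<^bsub>V\<^esub>
                 \<psi> (bracket D (xs ! i) (xs ! j) # nths xs (- {i, j})))
       {(i, j). i < j \<and> j < length xs}"

definition ce_cocycle ::
  "('k, 'x) ring_scheme \<Rightarrow> ('k, 'd, 'y) lie_scheme \<Rightarrow> ('k, 'v, 'z) module_scheme
    \<Rightarrow> ('d \<Rightarrow> 'v \<Rightarrow> 'v) \<Rightarrow> nat \<Rightarrow> ('d list \<Rightarrow> 'v) \<Rightarrow> bool" where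
  "ce_cocycle K D V act n \<psi> \<longleftrightarrow>
     \<psi> \<in> ce_cochains K D V n \<and>
     (\<forall>xs. length xs = Suc n \<and> set xs \<subseteq> carrier D \<longrightarrow>
        ce_differential D V act \<psi> xs = \<zero>\<^bsub>V\<^esub>)"

definition cyc_action ::
  "('k, 'x) ring_scheme \<Rightarrow> ('k, 'b, 'y) module_scheme \<Rightarrow> ('d \<Rightarrow> 'b \<Rightarrow> 'b)
    \<Rightarrow> 'd \<Rightarrow> 'b set \<Rightarrow> 'b set" where
  "cyc_action K B \<phi> f C = the_elem ((\<lambda>b. cyc_class K B (\<phi> f b)) ` C)"

end

theory Submission
  imports Defs
begin

text \<open>
  Write \<open>\<nabla>\<^sub>f\<close> for the operator \<open>(i\<^bsub>\<phi>(f)\<^esub> \<otimes> id) \<circ> \<nabla>\<close> on \<open>M\<close>, so that \<open>c(f) = \<nabla>\<^sub>f - \<rho>\<^sub>f\<close>. Both \<open>\<nabla>\<^sub>f\<close> and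
  \<open>\<rho>\<^sub>f\<close> are derivations of \<open>M\<close> along the same derivation \<open>\<phi>(f)\<close> of \<open>B\<close>, so their difference \<open>c(f)\<close> is
  \<open>B\<close>-linear and has a trace. The proof rests on four facts.

  \<^item> Flatness makes \<open>f \<mapsto> \<nabla>\<^sub>f\<close> a Lie homomorphism (\<open>flat_covariant\<close>): contracting \<open>\<nabla>\<^sup>2 m\<close> with
    \<open>i\<^sub>f \<otimes> i\<^sub>g\<close> and antisymmetrising in \<open>f, g\<close> gives \<open>[\<nabla>\<^sub>f, \<nabla>\<^sub>g] m - \<nabla>\<^bsub>[f,g]\<^esub> m\<close>.

  \<^item> Hence \<open>c\<close> is a difference of two Lie homomorphisms, and satisfies a Maurer--Cartan equation. With
    \<open>\<rho>\<close> or \<open>\<nabla>\<close> alone acting it has a quadratic term, \<open>c[f,g] = [\<rho>\<^sub>f, c(g)] - [\<rho>\<^sub>g, c(f)] + [c(f), c(g)]\<close>,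
    but the two quadratic terms have opposite signs. For the sum \<open>S\<^sub>f = \<rho>\<^sub>f + \<nabla>\<^sub>f\<close> the equation is
    linear (\<open>maurer_cartan\<close>): \<open>2 c[f,g] = [S\<^sub>f, c(g)] - [S\<^sub>g, c(f)]\<close>.

  \<^item> The trace is cyclic (\<open>Tr_cyclic\<close>) and intertwines the commutator with a derivation \<open>D\<close> of \<open>M\<close> along
    \<open>\<delta>\<close> with the action of \<open>\<delta>\<close> on \<open>|B|\<close> (\<open>Tr_commutator\<close>): \<open>Tr [D, h] = \<delta> \<cdot> Tr h\<close>. Both are checked on
    endomorphisms of rank one, which span \<open>End\<^sub>B(M)\<close> because \<open>M\<close> is dualisable.

  \<^item> Therefore twice the action of \<open>f\<close> on \<open>Tr(c(f\<^sub>1) \<circ> \<dots> \<circ> c(f\<^sub>k))\<close> is the sum over \<open>p\<close> of the traces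
    in which \<open>c(f\<^sub>p)\<close> is replaced by \<open>[S\<^sub>f, c(f\<^sub>p)]\<close>, and a bracket \<open>c[f,g]\<close> in position \<open>p\<close>, doubled,
    is replaced by \<open>[S\<^sub>f, c(g)] - [S\<^sub>g, c(f)]\<close>. Twice the Chevalley--Eilenberg differential of the
    alternated cochain is thus a signed sum of expressions of one and the same kind, and these
    cancel in pairs for purely combinatorial reasons (\<open>alternating_leibniz_cancel\<close>).

  As \<open>2\<close> is invertible in \<open>\<K>\<close>, the differential itself vanishes. For even \<open>k\<close> a cyclic rotation of the
  \<open>k\<close> arguments is an odd permutation, while cyclicity of the trace makes \<open>Div\<^sub>k\<close> invariant under it;
  so the alternated cochain equals its own negative.

  The bulk of the text makes the objects accessible: \<open>\<Omega>\<^sup>1B\<close>, the tensor products and the trace are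
  given by generators and relators, and each map out of them needs a check that it respects the
  relators. All such checks go through one universal property per construction.
\<close>

section \<open>Integral combinations and additive maps\<close>

text \<open>
  The \<open>\<int>\<close>-linear extension of \<open>g\<close> to the free abelian group. It is the sum inside \<open>lift\<close>, and signed
  sums over permutations are values of it as well; identities among such sums can then be proved
  in a free abelian group, where integer arithmetic applies.
\<close>

definition frag_eval :: "('g, 'z) ring_scheme \<Rightarrow> ('x \<Rightarrow> 'g) \<Rightarrow> ('x \<Rightarrow>\<^sub>0 int) \<Rightarrow> 'g" where
  "frag_eval G g p = (\<Oplus>\<^bsub>G\<^esub>x\<in>Poly_Mapping.keys p. [Poly_Mapping.lookup p x] \<cdot>\<^bsub>G\<^esub> g x)"

text \<open>
  Only additivity is recorded: the operators \<open>\<nabla>\<close>, \<open>\<nabla>\<^sub>f\<close> and \<open>\<rho>\<^sub>f\<close> are not \<open>B\<close>-linear, and many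
  records below differ only in operations other than addition.
\<close>

definition additive_map :: "('g, 'y) ring_scheme \<Rightarrow> ('h, 'z) ring_scheme \<Rightarrow> ('g \<Rightarrow> 'h) \<Rightarrow> bool" where
  "additive_map G H h \<longleftrightarrow> h \<in> carrier G \<rightarrow> carrier H \<and>
     (\<forall>x\<in>carrier G. \<forall>y\<in>carrier G. h (x \<oplus>\<^bsub>G\<^esub> y) = h x \<oplus>\<^bsub>H\<^esub> h y)"

lemma additive_mapI:
  assumes "\<And>x. x \<in> carrier G \<Longrightarrow> h x \<in> carrier H"
    and "\<And>x y. \<lbrakk>x \<in> carrier G; y \<in> carrier G\<rbrakk> \<Longrightarrow> h (x \<oplus>\<^bsub>G\<^esub> y) = h x \<oplus>\<^bsub>H\<^esub> h y"
  shows "additive_map G H h"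
  using assms by (auto simp: additive_map_def)

lemma additive_map_closed: "\<lbrakk>additive_map G H h; x \<in> carrier G\<rbrakk> \<Longrightarrow> h x \<in> carrier H"
  by (auto simp: additive_map_def)

lemma additive_map_add:
  "\<lbrakk>additive_map G H h; x \<in> carrier G; y \<in> carrier G\<rbrakk> \<Longrightarrow> h (x \<oplus>\<^bsub>G\<^esub> y) = h x \<oplus>\<^bsub>H\<^esub> h y"
  by (auto simp: additive_map_def)

lemma additive_map_comp:
  "\<lbrakk>additive_map G H h; additive_map H L h'\<rbrakk> \<Longrightarrow> additive_map G L (\<lambda>x. h' (h x))"
  by (auto simp: additive_map_def Pi_iff)

lemma (in abelian_group) additive_map_abelian_group_hom:
  assumes "abelian_group H" "additive_map G H h"
  shows "abelian_group_hom G H h"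
  using assms abelian_group_axioms
  by (intro abelian_group_homI group_hom.intro group_hom_axioms.intro abelian_group.a_group)
     (auto simp: additive_map_def hom_def)

lemma additive_map_zero:
  assumes "abelian_group G" "abelian_group H" "additive_map G H h"
  shows "h \<zero>\<^bsub>G\<^esub> = \<zero>\<^bsub>H\<^esub>"
  using abelian_group_hom.hom_zero[OF abelian_group.additive_map_abelian_group_hom[OF assms]] .

lemma additive_map_inv:
  assumes "abelian_group G" "abelian_group H" "additive_map G H h" "x \<in> carrier G"
  shows "h (\<ominus>\<^bsub>G\<^esub> x) = \<ominus>\<^bsub>H\<^esub> h x"
  using abelian_group_hom.hom_a_inv[OF abelian_group.additive_map_abelian_group_hom[OF assms(1-3)] assms(4)] .

lemma additive_map_minus:
  assumes "abelian_group G" "abelian_group H" "additive_map G H h" "x \<in> carrier G" "y \<in> carrier G"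
  shows "h (x \<ominus>\<^bsub>G\<^esub> y) = h x \<ominus>\<^bsub>H\<^esub> h y"
  using assms
  by (simp add: a_minus_def additive_map_add additive_map_inv abelian_group.a_inv_closed)

lemma additive_map_add_pow:
  assumes "abelian_group G" "abelian_group H" "additive_map G H h" "x \<in> carrier G"
  shows "h ([(n::int)] \<cdot>\<^bsub>G\<^esub> x) = [n] \<cdot>\<^bsub>H\<^esub> h x"
proof -
  interpret group_hom "add_monoid G" "add_monoid H" h
    using abelian_group_hom.a_group_hom[OF abelian_group.additive_map_abelian_group_hom[OF assms(1-3)]] .
  show ?thesis using hom_int_pow[of x n] assms(4) by (simp add: add_pow_def)
qed

lemma additive_map_finsum:
  assumes "abelian_group G" "abelian_group H" "additive_map G H h" "f \<in> A \<rightarrow> carrier G"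
  shows "h (finsum G f A) = finsum H (\<lambda>a. h (f a)) A"
proof -
  interpret G: abelian_group G by fact
  interpret H: abelian_group H by fact
  show ?thesis using assms(4)
  proof (induction A rule: infinite_finite_induct)
    case (infinite A)
    then show ?case by (simp add: G.finsum_infinite H.finsum_infinite additive_map_zero[OF assms(1-3)])
  next
    case empty
    then show ?case by (simp add: G.finsum_empty H.finsum_empty additive_map_zero[OF assms(1-3)])
  next
    case (insert x F)
    then have "f \<in> F \<rightarrow> carrier G" "f x \<in> carrier G" "(\<lambda>a. h (f a)) \<in> F \<rightarrow> carrier H" "h (f x) \<in> carrier H"
      using assms(3) by (auto simp: additive_map_def)
    with insert show ?case
      by (simp add: G.finsum_insert H.finsum_insert additive_map_add[OF assms(3)] G.finsum_closed)
  qed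
qed

context abelian_group
begin

lemma additive_map_comb:
  assumes "additive_map H G h" "additive_map H G h'"
  shows "additive_map H G (\<lambda>x. h x \<oplus> h' x)" "additive_map H G (\<lambda>x. h x \<ominus> h' x)"
  using assms by (auto simp: additive_map_def Pi_iff a_minus_def a_ac minus_add)

lemma add_pow_zero: "[(0::int)] \<cdot> x = \<zero>"
  by (simp add: add_pow_def)

lemma frag_eval_superset:
  assumes "g \<in> A \<rightarrow> carrier G" "finite A" "Poly_Mapping.keys p \<subseteq> A"
  shows "frag_eval G g p = (\<Oplus>x\<in>A. [Poly_Mapping.lookup p x] \<cdot> g x)"
  unfolding frag_eval_def
  by (rule add.finprod_mono_neutral_cong_left)
     (use assms in \<open>auto simp: in_keys_iff add_pow_zero intro!: add.int_pow_closed\<close>)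

lemma frag_eval_closed:
  "\<lbrakk>g \<in> X \<rightarrow> carrier G; Poly_Mapping.keys p \<subseteq> X\<rbrakk> \<Longrightarrow> frag_eval G g p \<in> carrier G"
  unfolding frag_eval_def by (rule finsum_closed) auto

lemma frag_eval_zero [simp]: "frag_eval G g 0 = \<zero>"
  by (simp add: frag_eval_def)

lemma frag_eval_of: "g x \<in> carrier G \<Longrightarrow> frag_eval G g (frag_of x) = g x"
  by (simp add: frag_eval_def)

lemma frag_eval_add:
  assumes "g \<in> X \<rightarrow> carrier G" "Poly_Mapping.keys p \<subseteq> X" "Poly_Mapping.keys q \<subseteq> X"
  shows "frag_eval G g (p + q) = frag_eval G g p \<oplus> frag_eval G g q"
proof -
  let ?A = "Poly_Mapping.keys p \<union> Poly_Mapping.keys q"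
  have g: "g \<in> ?A \<rightarrow> carrier G" using assms by auto
  have "frag_eval G g (p + q) = (\<Oplus>x\<in>?A. [Poly_Mapping.lookup (p + q) x] \<cdot> g x)"
    by (rule frag_eval_superset) (use g keys_add[of p q] in auto)
  also have "\<dots> = (\<Oplus>x\<in>?A. [Poly_Mapping.lookup p x] \<cdot> g x \<oplus> [Poly_Mapping.lookup q x] \<cdot> g x)"
    by (rule finsum_cong') (use g in \<open>auto simp: lookup_add add.int_pow_mult Pi_iff\<close>)
  also have "\<dots> = (\<Oplus>x\<in>?A. [Poly_Mapping.lookup p x] \<cdot> g x) \<oplus> (\<Oplus>x\<in>?A. [Poly_Mapping.lookup q x] \<cdot> g x)"
    by (rule finsum_addf) (use g in auto)
  also have "\<dots> = frag_eval G g p \<oplus> frag_eval G g q"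
    using frag_eval_superset[OF g, of p] frag_eval_superset[OF g, of q] by simp
  finally show ?thesis .
qed

lemma frag_eval_minus:
  assumes "g \<in> X \<rightarrow> carrier G" "Poly_Mapping.keys p \<subseteq> X"
  shows "frag_eval G g (- p) = \<ominus> frag_eval G g p"
proof -
  have "frag_eval G g (- p) \<oplus> frag_eval G g p = \<zero>"
    using frag_eval_add[OF assms(1), of "- p" p] assms(2) by simp
  then show ?thesis
    using frag_eval_closed[OF assms(1)] assms(2) by (metis minus_equality keys_minus)
qed

lemma frag_eval_diff:
  assumes "g \<in> X \<rightarrow> carrier G" "Poly_Mapping.keys p \<subseteq> X" "Poly_Mapping.keys q \<subseteq> X"
  shows "frag_eval G g (p - q) = frag_eval G g p \<ominus> frag_eval G g q"
  using frag_eval_add[OF assms(1,2), of "- q"] frag_eval_minus[OF assms(1), of q] assms(3)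
  by (simp add: a_minus_def)

lemma frag_eval_hom:
  assumes "g \<in> X \<rightarrow> carrier G"
  shows "frag_eval G g \<in> hom (free_Abelian_group X) (add_monoid G)"
  using frag_eval_closed[OF assms] frag_eval_add[OF assms] by (auto simp: hom_def)

lemma frag_eval_cmul:
  assumes "g \<in> X \<rightarrow> carrier G" "Poly_Mapping.keys p \<subseteq> X"
  shows "frag_eval G g (frag_cmul n p) = [n] \<cdot> frag_eval G g p"
proof -
  interpret h: group_hom "free_Abelian_group X" "add_monoid G" "frag_eval G g"
    by (intro group_hom.intro group_hom_axioms.intro frag_eval_hom a_group assms) auto
  show ?thesis using h.hom_int_pow[of p n] assms(2) by (simp add: add_pow_def)
qed

lemma frag_eval_sum:
  assumes "g \<in> X \<rightarrow> carrier G" "\<And>a. a \<in> A \<Longrightarrow> Poly_Mapping.keys (p a) \<subseteq> X"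
  shows "frag_eval G g (\<Sum>a\<in>A. p a) = (\<Oplus>a\<in>A. frag_eval G g (p a))"
  using assms(2)
proof (induction A rule: infinite_finite_induct)
  case (insert x F)
  have "Poly_Mapping.keys (sum p F) \<subseteq> X"
    using insert.prems keys_sum[of p F] by blast
  moreover have "(\<lambda>a. frag_eval G g (p a)) \<in> F \<rightarrow> carrier G" "frag_eval G g (p x) \<in> carrier G"
    using insert.prems frag_eval_closed[OF assms(1)] by auto
  ultimately show ?case using insert by (simp add: frag_eval_add[OF assms(1)])
qed auto

lemma minus_eq_zero_iff:
  assumes "x \<in> carrier G" "y \<in> carrier G"
  shows "x \<ominus> y = \<zero> \<longleftrightarrow> x = y"
  unfolding a_minus_def
  using add.inv_equality[of x "\<ominus> y"] assms by (auto simp: r_neg)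

lemma minus_add_interchange:
  "\<lbrakk>x \<in> carrier G; y \<in> carrier G; z \<in> carrier G; w \<in> carrier G\<rbrakk>
    \<Longrightarrow> (x \<oplus> y) \<ominus> (z \<oplus> w) = (x \<ominus> z) \<oplus> (y \<ominus> w)"
  by (simp add: a_minus_def minus_add a_ac)

lemma add_cancel_common:
  "\<lbrakk>x \<in> carrier G; y \<in> carrier G; z \<in> carrier G\<rbrakk> \<Longrightarrow> (z \<oplus> x) \<ominus> (z \<oplus> y) = x \<ominus> y"
proof -
  assume a: "x \<in> carrier G" "y \<in> carrier G" "z \<in> carrier G"
  then have "(z \<oplus> x) \<ominus> (z \<oplus> y) = (z \<oplus> \<ominus> z) \<oplus> (x \<ominus> y)"
    by (simp add: a_minus_def minus_add a_ac del: add.r_inv)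
  then show ?thesis using a by (simp add: r_neg)
qed

text \<open>
  Three cancellations of terms that occur with both signs: in the Leibniz rule for \<open>d : \<Omega>\<^sup>1B \<rightarrow> \<Omega>\<^sup>2B\<close>,
  in the curvature identity, and in the Maurer--Cartan equation. In each, the terms that cancel are
  split off as a sum of pairs \<open>u \<oplus> \<ominus> u\<close>.
\<close>

lemma leibniz_cancel:
  assumes "P \<in> carrier G" "Q \<in> carrier G" "R \<in> carrier G" "S \<in> carrier G" "U \<in> carrier G"
  shows "(P \<oplus> Q) \<ominus> (R \<oplus> S) = (P \<ominus> (U \<oplus> R)) \<oplus> ((Q \<oplus> U) \<ominus> S)"
proof -
  have "(P \<ominus> (U \<oplus> R)) \<oplus> ((Q \<oplus> U) \<ominus> S) = (P \<oplus> Q) \<ominus> (R \<oplus> S) \<oplus> (U \<oplus> \<ominus> U)"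
    using assms by (simp add: a_minus_def minus_add a_ac del: add.r_inv)
  then show ?thesis using assms by (simp add: r_neg)
qed

lemma curvature_cancel:
  assumes "x1 \<in> carrier G" "x2 \<in> carrier G" "x3 \<in> carrier G" "x4 \<in> carrier G"
    "y1 \<in> carrier G" "y2 \<in> carrier G" "y3 \<in> carrier G" "y4 \<in> carrier G"
  shows "((x1 \<oplus> x2 \<oplus> x3) \<oplus> x4) \<ominus> ((y1 \<oplus> y2 \<oplus> y3) \<oplus> y4) \<ominus> (x2 \<ominus> y2) =
    ((x1 \<ominus> y3) \<ominus> y4) \<ominus> ((y1 \<ominus> x3) \<ominus> x4)"
proof -
  have "((x1 \<oplus> x2 \<oplus> x3) \<oplus> x4) \<ominus> ((y1 \<oplus> y2 \<oplus> y3) \<oplus> y4) \<ominus> (x2 \<ominus> y2) =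
    ((x1 \<ominus> y3) \<ominus> y4) \<ominus> ((y1 \<ominus> x3) \<ominus> x4) \<oplus> ((x2 \<oplus> \<ominus> x2) \<oplus> (y2 \<oplus> \<ominus> y2))"
    using assms by (simp add: a_minus_def minus_add minus_minus a_ac del: add.r_inv)
  then show ?thesis using assms by (simp add: r_neg)
qed

lemma maurer_cartan_cancel:
  assumes "a \<in> carrier G" "b \<in> carrier G" "p \<in> carrier G" "q \<in> carrier G"
    "u \<in> carrier G" "v \<in> carrier G" "w \<in> carrier G" "z \<in> carrier G"
  shows "(((u \<ominus> p) \<ominus> (v \<ominus> q)) \<oplus> ((a \<ominus> w) \<ominus> (b \<ominus> z))) \<ominus>
      (((z \<ominus> q) \<ominus> (w \<ominus> p)) \<oplus> ((b \<ominus> v) \<ominus> (a \<ominus> u))) =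
    ((a \<ominus> b) \<ominus> (p \<ominus> q)) \<oplus> ((a \<ominus> b) \<ominus> (p \<ominus> q))"
proof -
  have "(((u \<ominus> p) \<ominus> (v \<ominus> q)) \<oplus> ((a \<ominus> w) \<ominus> (b \<ominus> z))) \<ominus>
      (((z \<ominus> q) \<ominus> (w \<ominus> p)) \<oplus> ((b \<ominus> v) \<ominus> (a \<ominus> u))) =
    (((a \<ominus> b) \<ominus> (p \<ominus> q)) \<oplus> ((a \<ominus> b) \<ominus> (p \<ominus> q))) \<oplus>
      (((u \<oplus> \<ominus> u) \<oplus> (v \<oplus> \<ominus> v)) \<oplus> ((w \<oplus> \<ominus> w) \<oplus> (z \<oplus> \<ominus> z)))"
    using assms by (simp add: a_minus_def minus_add minus_minus a_ac del: add.r_inv)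
  then show ?thesis using assms by (simp add: r_neg)
qed

lemma additive_map_finsum_comb:
  assumes "abelian_group H" "\<And>a. a \<in> A \<Longrightarrow> additive_map H G (h a)"
  shows "additive_map H G (\<lambda>x. \<Oplus>a\<in>A. h a x)"
proof (rule additive_mapI)
  fix x y assume x: "x \<in> carrier H" and y: "y \<in> carrier H"
  have c: "(\<lambda>a. h a z) \<in> A \<rightarrow> carrier G" if "z \<in> carrier H" for z
    using that assms(2) by (auto simp: additive_map_def)
  have "x \<oplus>\<^bsub>H\<^esub> y \<in> carrier H" using abelian_groupE(1)[OF assms(1) x y] .
  then have "(\<Oplus>a\<in>A. h a (x \<oplus>\<^bsub>H\<^esub> y)) = (\<Oplus>a\<in>A. h a x \<oplus> h a y)"
    using additive_map_add[OF assms(2) x y] c[OF x] c[OF y] by (intro finsum_cong') auto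
  then show "(\<Oplus>a\<in>A. h a (x \<oplus>\<^bsub>H\<^esub> y)) = (\<Oplus>a\<in>A. h a x) \<oplus> (\<Oplus>a\<in>A. h a y)"
    using finsum_addf[OF c[OF x] c[OF y]] by simp
qed (use assms(2) in \<open>auto simp: additive_map_def intro!: finsum_closed\<close>)

text \<open>
  All relators below have one of two shapes, \<open>x = y + z\<close> or \<open>x = y\<close>.
\<close>

lemma frag_eval_relator3:
  assumes "g x = g y \<oplus> g z" "g x \<in> carrier G" "g y \<in> carrier G" "g z \<in> carrier G"
  shows "frag_eval G g (frag_of x - frag_of y - frag_of z) = \<zero>"
proof -
  have g: "g \<in> {x, y, z} \<rightarrow> carrier G" using assms by auto
  have k: "Poly_Mapping.keys (frag_of y + frag_of z) \<subseteq> {x, y, z}"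
    using keys_add[of "frag_of y" "frag_of z"] by auto
  have "frag_eval G g (frag_of x - (frag_of y + frag_of z)) = g x \<ominus> (g y \<oplus> g z)"
    using assms k by (simp add: frag_eval_diff[OF g] frag_eval_add[OF g] frag_eval_of)
  then show ?thesis using assms by (simp add: diff_diff_eq minus_eq_zero_iff)
qed

lemma frag_eval_relator2:
  assumes "g x = g y" "g y \<in> carrier G"
  shows "frag_eval G g (frag_of x - frag_of y) = \<zero>"
  using assms frag_eval_diff[of g "{x, y}" "frag_of x" "frag_of y"]
  by (simp add: frag_eval_of minus_eq_zero_iff)

end

section \<open>Groups given by generators and relators\<close>

locale presentation =
  fixes X :: "'x set" and R :: "('x \<Rightarrow>\<^sub>0 int) set"
  assumes relators: "r \<in> R \<Longrightarrow> Poly_Mapping.keys r \<subseteq> X"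
begin

abbreviation "cls p \<equiv> relator_group X R #>\<^bsub>free_Abelian_group X\<^esub> p"

lemma relator_subgroup: "subgroup (relator_group X R) (free_Abelian_group X)"
  unfolding relator_group_def
  by (rule group.generate_is_subgroup) (use relators in auto)

lemma relator_normal: "relator_group X R \<lhd> free_Abelian_group X"
  by (rule comm_group.normal_iff_subgroup[THEN iffD2, OF abelian_free_Abelian_group relator_subgroup])

lemma carrier_presented: "carrier (presented X R) = cls ` {p. Poly_Mapping.keys p \<subseteq> X}"
  by (auto simp: presented_def FactGroup_def RCOSETS_def Let_def)

lemma cls_in: "Poly_Mapping.keys p \<subseteq> X \<Longrightarrow> cls p \<in> carrier (presented X R)"
  by (auto simp: carrier_presented)

lemma zero_presented: "\<zero>\<^bsub>presented X R\<^esub> = cls 0"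
  using group.coset_mult_one[OF group_free_Abelian_group, of "relator_group X R" X]
    subgroup.subset[OF relator_subgroup]
  by (simp add: presented_def Let_def FactGroup_def)

lemma add_presented:
  "\<lbrakk>Poly_Mapping.keys p \<subseteq> X; Poly_Mapping.keys q \<subseteq> X\<rbrakk> \<Longrightarrow> cls p \<oplus>\<^bsub>presented X R\<^esub> cls q = cls (p + q)"
  using normal.rcos_sum[OF relator_normal, of p q] by (simp add: presented_def Let_def FactGroup_def)

lemma abelian_group_presented: "abelian_group (presented X R)"
proof -
  have "comm_group (free_Abelian_group X Mod relator_group X R)"
    by (rule comm_group.abelian_FactGroup[OF abelian_free_Abelian_group relator_subgroup])
  moreover have "add_monoid (presented X R) =
      (free_Abelian_group X Mod relator_group X R)"
    by (simp add: presented_def Let_def FactGroup_def)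
  ultimately show ?thesis by (intro comm_group_abelian_groupI) simp
qed

lemma generator_in: "x \<in> X \<Longrightarrow> generator X R x \<in> carrier (presented X R)"
  unfolding generator_def by (rule cls_in) auto

lemma generator_relation:
  assumes "r \<in> R"
  shows "cls r = \<zero>\<^bsub>presented X R\<^esub>"
proof -
  have "r \<in> relator_group X R" using assms by (auto simp: relator_group_def intro: generate.incl)
  then have "cls r = relator_group X R"
    by (rule group.coset_join2[OF group_free_Abelian_group _ relator_subgroup, rotated]) (use assms relators in auto)
  then show ?thesis by (simp add: presented_def Let_def FactGroup_def)
qed

lemma inv_presented:
  assumes "Poly_Mapping.keys p \<subseteq> X"
  shows "\<ominus>\<^bsub>presented X R\<^esub> cls p = cls (- p)"
proof -
  interpret P: abelian_group "presented X R" by (rule abelian_group_presented)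
  have "cls (- p) \<oplus>\<^bsub>presented X R\<^esub> cls p = \<zero>\<^bsub>presented X R\<^esub>"
    using assms by (simp add: add_presented zero_presented)
  then show ?thesis using assms by (intro P.minus_equality cls_in) auto
qed

lemma diff_presented:
  "\<lbrakk>Poly_Mapping.keys p \<subseteq> X; Poly_Mapping.keys q \<subseteq> X\<rbrakk> \<Longrightarrow> cls p \<ominus>\<^bsub>presented X R\<^esub> cls q = cls (p - q)"
  using add_presented[of p "- q"] by (simp add: a_minus_def inv_presented)

lemma generator_eq:
  assumes "frag_of x - frag_of y \<in> R" "x \<in> X" "y \<in> X"
  shows "generator X R x = generator X R y"
  using generator_relation[OF assms(1)] diff_presented[of "frag_of x" "frag_of y"] assms
    abelian_group.minus_eq_zero_iff[OF abelian_group_presented, of "cls (frag_of x)" "cls (frag_of y)"]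
  by (simp add: generator_def cls_in)

lemma generator_add:
  assumes "frag_of x - frag_of y - frag_of z \<in> R" "x \<in> X" "y \<in> X" "z \<in> X"
  shows "generator X R x = generator X R y \<oplus>\<^bsub>presented X R\<^esub> generator X R z"
proof -
  have k: "Poly_Mapping.keys (frag_of y + frag_of z) \<subseteq> X"
    using assms keys_add[of "frag_of y" "frag_of z"] by auto
  have "cls (frag_of x) \<ominus>\<^bsub>presented X R\<^esub> cls (frag_of y + frag_of z) = \<zero>\<^bsub>presented X R\<^esub>"
    using generator_relation[OF assms(1)] diff_presented[OF _ k, of "frag_of x"] assms
    by (simp add: diff_diff_eq)
  then have "cls (frag_of x) = cls (frag_of y + frag_of z)"
    using assms k abelian_group.minus_eq_zero_iff[OF abelian_group_presented] cls_in
    by (metis insert_subset keys_frag_of empty_subsetI)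
  then show ?thesis
    unfolding generator_def using assms by (subst add_presented) auto
qed

lemma presented_induct [consumes 1, case_names zero generator diff]:
  assumes "t \<in> carrier (presented X R)"
    and "P \<zero>\<^bsub>presented X R\<^esub>"
    and "\<And>x. x \<in> X \<Longrightarrow> P (generator X R x)"
    and "\<And>u v. \<lbrakk>u \<in> carrier (presented X R); v \<in> carrier (presented X R); P u; P v\<rbrakk>
           \<Longrightarrow> P (u \<ominus>\<^bsub>presented X R\<^esub> v)"
  shows "P t"
proof -
  obtain p where p: "Poly_Mapping.keys p \<subseteq> X" "t = cls p"
    using assms(1) by (auto simp: carrier_presented)
  have "P (cls p)" using p(1)
  proof (rule free_Abelian_group_induct[where P = "\<lambda>p. P (cls p)"])
    show "P (cls 0)" using assms(2) by (simp add: zero_presented)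
  next
    fix x y :: "'x \<Rightarrow>\<^sub>0 int"
    assume "Poly_Mapping.keys x \<subseteq> X" "Poly_Mapping.keys y \<subseteq> X" "P (cls x)" "P (cls y)"
    then show "P (cls (x - y))"
      using assms(4)[of "cls x" "cls y"] by (simp add: diff_presented cls_in)
  next
    fix a assume "a \<in> X"
    then show "P (cls (frag_of a))" using assms(3)[of a] by (simp add: generator_def)
  qed
  then show ?thesis by (simp add: p)
qed

lemma presented_map_eqI:
  assumes "abelian_group G" "additive_map (presented X R) G h" "additive_map (presented X R) G h'"
    and "\<And>x. x \<in> X \<Longrightarrow> h (generator X R x) = h' (generator X R x)"
    and "t \<in> carrier (presented X R)"
  shows "h t = h' t"
  using assms(5)
proof (induction rule: presented_induct)
  case zero
  then show ?case using additive_map_zero[OF abelian_group_presented assms(1)] assms(2,3) by metis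
next
  case (diff u v)
  then show ?case using additive_map_minus[OF abelian_group_presented assms(1)] assms(2,3) by metis
qed (use assms(4) in auto)

context
  fixes G :: "('g, 'z) ring_scheme" and g :: "'x \<Rightarrow> 'g"
  assumes G: "abelian_group G" and g: "g \<in> X \<rightarrow> carrier G"
    and respects: "\<And>r. r \<in> R \<Longrightarrow> frag_eval G g r = \<zero>\<^bsub>G\<^esub>"
begin

lemma frag_eval_relator_group: "r \<in> relator_group X R \<Longrightarrow> frag_eval G g r = \<zero>\<^bsub>G\<^esub>"
proof -
  interpret G: abelian_group G by (rule G)
  assume "r \<in> relator_group X R"
  then have "frag_eval G g r = \<zero>\<^bsub>G\<^esub> \<and> Poly_Mapping.keys r \<subseteq> X"
    unfolding relator_group_def
  proof (induction rule: generate.induct)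
    case (inv h)
    then show ?case using G.frag_eval_minus[OF g, of h] relators respects by auto
  next
    case (eng h1 h2)
    then show ?case using G.frag_eval_add[OF g, of h1 h2] keys_add[of h1 h2] by auto
  qed (use relators respects in auto)
  then show ?thesis ..
qed

text \<open>
  The \<open>\<int>\<close>-linear extension of \<open>g\<close> vanishes on the subgroup generated by the relators, hence is
  constant on each coset, so that \<open>lift\<close> takes the unique value of it there.
\<close>

lemma lift_cls:
  assumes p: "Poly_Mapping.keys p \<subseteq> X"
  shows "lift G g (cls p) = frag_eval G g p"
proof -
  interpret G: abelian_group G by (rule G)
  have "frag_eval G g ` cls p = {frag_eval G g p}"
  proof -
    have "frag_eval G g q = frag_eval G g p" if q: "q \<in> cls p" for q
    proof -
      obtain r where r: "r \<in> relator_group X R" "q = r + p"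
        using q by (auto simp: r_coset_def)
      have "Poly_Mapping.keys r \<subseteq> X" using subsetD[OF subgroup.subset[OF relator_subgroup] r(1)] by simp
      then show ?thesis
        using r G.frag_eval_add[OF g _ p, of r] frag_eval_relator_group G.frag_eval_closed[OF g p] by simp
    qed
    moreover have "p \<in> cls p"
      using group.rcos_self[OF group_free_Abelian_group _ relator_subgroup] p by auto
    ultimately show ?thesis by blast
  qed
  then show ?thesis by (simp add: lift_def frag_eval_def)
qed

lemma lift_generator: "x \<in> X \<Longrightarrow> lift G g (generator X R x) = g x"
  using abelian_group.frag_eval_of[OF G, of g x] g by (subst generator_def, subst lift_cls) auto

lemma additive_lift: "additive_map (presented X R) G (lift G g)"
proof (rule additive_mapI)
  interpret G: abelian_group G by (rule G)
  fix x y assume "x \<in> carrier (presented X R)" "y \<in> carrier (presented X R)"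
  then obtain p q where "Poly_Mapping.keys p \<subseteq> X" "x = cls p" "Poly_Mapping.keys q \<subseteq> X" "y = cls q"
    by (auto simp: carrier_presented)
  note pq = this
  then have "Poly_Mapping.keys (p + q) \<subseteq> X" using keys_add[of p q] by blast
  with pq show "lift G g (x \<oplus>\<^bsub>presented X R\<^esub> y) = lift G g x \<oplus>\<^bsub>G\<^esub> lift G g y"
    by (simp only: pq add_presented lift_cls G.frag_eval_add[OF g])
next
  interpret G: abelian_group G by (rule G)
  fix x assume "x \<in> carrier (presented X R)"
  then show "lift G g x \<in> carrier G"
    by (auto simp: carrier_presented lift_cls G.frag_eval_closed[OF g])
qed

end

end

section \<open>Tensor products\<close>

lemma abelian_group_cong:
  assumes "abelian_group G" "carrier H = carrier G" "\<zero>\<^bsub>H\<^esub> = \<zero>\<^bsub>G\<^esub>" "add H = add G"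
  shows "abelian_group H"
  using abelian_groupE[OF assms(1)] assms(2-4)
  by (intro abelian_groupI) auto

text \<open>
  The locale asks for what a tensor product of abelian groups over \<open>B\<close> needs and for no module axioms,
  because it is used for left factors with different structure: \<open>M\<^sup>*\<close> has no left action, and
  \<open>\<Omega>\<^sup>2B\<close> enters only through its right action.
\<close>

locale tensor_pair =
  fixes B :: "('b, 'x) ring_scheme" and W :: "('b, 'w, 'y) bimodule_scheme"
    and M :: "('b, 'm, 'z) module_scheme"
  assumes abelian_group_W: "abelian_group W" and abelian_group_M: "abelian_group M"
    and rsmult_closed: "\<lbrakk>w \<in> carrier W; b \<in> carrier B\<rbrakk> \<Longrightarrow> rsmult W w b \<in> carrier W"
    and smult_closed: "\<lbrakk>b \<in> carrier B; m \<in> carrier M\<rbrakk> \<Longrightarrow> b \<odot>\<^bsub>M\<^esub> m \<in> carrier M"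
begin

abbreviation T where "T \<equiv> tensor B W M"
abbreviation tens (infixl \<open>\<otimes>t\<close> 75) where "w \<otimes>t m \<equiv> pure B W M w m"

interpretation W: abelian_group W by (rule abelian_group_W)
interpretation M: abelian_group M by (rule abelian_group_M)

sublocale P: presentation "carrier W \<times> carrier M" "tensor_relators B W M"
proof
  fix r assume "r \<in> tensor_relators B W M"
  then show "Poly_Mapping.keys r \<subseteq> carrier W \<times> carrier M"
    unfolding tensor_relators_def using rsmult_closed smult_closed
    by (auto dest!: subsetD[OF keys_diff])
qed

lemma tensor_simps:
  "carrier T = carrier (presented (carrier W \<times> carrier M) (tensor_relators B W M))"
  "\<zero>\<^bsub>T\<^esub> = \<zero>\<^bsub>presented (carrier W \<times> carrier M) (tensor_relators B W M)\<^esub>"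
  "add T = add (presented (carrier W \<times> carrier M) (tensor_relators B W M))"
  by (simp_all add: tensor_def tensor_group_def Let_def)

lemma abelian_group_tensor: "abelian_group T"
  by (rule abelian_group_cong[OF P.abelian_group_presented]) (simp_all add: tensor_simps)

lemma additive_map_tensor_iff:
  "additive_map T G h \<longleftrightarrow> additive_map (presented (carrier W \<times> carrier M) (tensor_relators B W M)) G h"
  by (simp add: additive_map_def tensor_simps)

lemma pure_closed: "\<lbrakk>w \<in> carrier W; m \<in> carrier M\<rbrakk> \<Longrightarrow> w \<otimes>t m \<in> carrier T"
  unfolding pure_def tensor_simps by (rule P.generator_in) simp

lemma pure_add_left:
  "\<lbrakk>w \<in> carrier W; w' \<in> carrier W; m \<in> carrier M\<rbrakk> \<Longrightarrow> (w \<oplus>\<^bsub>W\<^esub> w') \<otimes>t m = w \<otimes>t m \<oplus>\<^bsub>T\<^esub> w' \<otimes>t m"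
  unfolding pure_def tensor_simps
  by (rule P.generator_add) (auto simp: tensor_relators_def)

lemma pure_add_right:
  "\<lbrakk>w \<in> carrier W; m \<in> carrier M; m' \<in> carrier M\<rbrakk> \<Longrightarrow> w \<otimes>t (m \<oplus>\<^bsub>M\<^esub> m') = w \<otimes>t m \<oplus>\<^bsub>T\<^esub> w \<otimes>t m'"
  unfolding pure_def tensor_simps
  by (rule P.generator_add) (auto simp: tensor_relators_def)

lemma pure_balanced:
  "\<lbrakk>w \<in> carrier W; b \<in> carrier B; m \<in> carrier M\<rbrakk> \<Longrightarrow> rsmult W w b \<otimes>t m = w \<otimes>t (b \<odot>\<^bsub>M\<^esub> m)"
  unfolding pure_def
  by (rule P.generator_eq) (auto simp: tensor_relators_def rsmult_closed smult_closed)

lemma tensor_map_eqI: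
  assumes "abelian_group G" "additive_map T G h" "additive_map T G h'"
    and "\<And>w m. \<lbrakk>w \<in> carrier W; m \<in> carrier M\<rbrakk> \<Longrightarrow> h (w \<otimes>t m) = h' (w \<otimes>t m)"
    and "t \<in> carrier T"
  shows "h t = h' t"
proof (rule P.presented_map_eqI[OF assms(1)])
  fix x assume "x \<in> carrier W \<times> carrier M"
  then obtain w m where "x = (w, m)" "w \<in> carrier W" "m \<in> carrier M" by blast
  then show "h (generator (carrier W \<times> carrier M) (tensor_relators B W M) x) =
      h' (generator (carrier W \<times> carrier M) (tensor_relators B W M) x)"
    using assms(4)[of w m] by (simp only: pure_def)
qed (use assms(2,3,5) in \<open>simp_all only: additive_map_tensor_iff tensor_simps\<close>)

context
  fixes G :: "('g, 'v) ring_scheme" and g :: "'w \<Rightarrow> 'm \<Rightarrow> 'g"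
  assumes G: "abelian_group G"
    and g_closed: "\<And>w m. \<lbrakk>w \<in> carrier W; m \<in> carrier M\<rbrakk> \<Longrightarrow> g w m \<in> carrier G"
    and g_add_left: "\<And>w w' m. \<lbrakk>w \<in> carrier W; w' \<in> carrier W; m \<in> carrier M\<rbrakk>
        \<Longrightarrow> g (w \<oplus>\<^bsub>W\<^esub> w') m = g w m \<oplus>\<^bsub>G\<^esub> g w' m"
    and g_add_right: "\<And>w m m'. \<lbrakk>w \<in> carrier W; m \<in> carrier M; m' \<in> carrier M\<rbrakk>
        \<Longrightarrow> g w (m \<oplus>\<^bsub>M\<^esub> m') = g w m \<oplus>\<^bsub>G\<^esub> g w m'"
    and g_balanced: "\<And>w b m. \<lbrakk>w \<in> carrier W; b \<in> carrier B; m \<in> carrier M\<rbrakk>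
        \<Longrightarrow> g (rsmult W w b) m = g w (b \<odot>\<^bsub>M\<^esub> m)"
begin

text \<open>
  The universal property: a balanced biadditive map kills the three kinds of relators.
\<close>

lemma balanced_respects:
  assumes "r \<in> tensor_relators B W M"
  shows "frag_eval G (\<lambda>(w, m). g w m) r = \<zero>\<^bsub>G\<^esub>"
proof -
  interpret G: abelian_group G by (rule G)
  show ?thesis
    using assms unfolding tensor_relators_def
    by (auto intro!: G.frag_eval_relator3 G.frag_eval_relator2
       simp: g_add_left g_add_right g_balanced g_closed smult_closed rsmult_closed)
qed

lemma additive_tensor_lift: "additive_map T G (lift G (\<lambda>(w, m). g w m))"
  unfolding additive_map_tensor_iff
  by (rule P.additive_lift[OF G _ balanced_respects]) (auto simp: g_closed)

lemma tensor_lift_pure: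
  "\<lbrakk>w \<in> carrier W; m \<in> carrier M\<rbrakk> \<Longrightarrow> lift G (\<lambda>(w, m). g w m) (w \<otimes>t m) = g w m"
  unfolding pure_def
  by (subst P.lift_generator[OF G _ balanced_respects]) (auto simp: g_closed)

end

end

lemma bitensor_simps:
  "carrier (bitensor B W V) = carrier (tensor B W V)"
  "\<zero>\<^bsub>bitensor B W V\<^esub> = \<zero>\<^bsub>tensor B W V\<^esub>"
  "add (bitensor B W V) = add (tensor B W V)"
  "smult (bitensor B W V) = smult (tensor B W V)"
  "rsmult (bitensor B W V) = (\<lambda>t b. lift (tensor B W V) (\<lambda>(w, v). pure B W V w (rsmult V v b)) t)"
  by (simp_all add: bitensor_def Let_def)

section \<open>Noncommutative forms\<close>

context assoc_algebra
begin

abbreviation \<Omega> where "\<Omega> \<equiv> Omega1 K B"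
abbreviation \<Omega>2 where "\<Omega>2 \<equiv> Omega2 K B"
abbreviation fg where "fg \<equiv> form_gen K B"
abbreviation d where "d \<equiv> d0 K B"

sublocale F: presentation "form_gens B" "form_relators K B"
proof
  fix r assume "r \<in> form_relators K B"
  then show "Poly_Mapping.keys r \<subseteq> form_gens B"
    unfolding form_relators_def form_gens_def
    by (auto dest!: subsetD[OF keys_diff])
qed

lemma Omega1_simps:
  "carrier \<Omega> = carrier (presented (form_gens B) (form_relators K B))"
  "\<zero>\<^bsub>\<Omega>\<^esub> = \<zero>\<^bsub>presented (form_gens B) (form_relators K B)\<^esub>"
  "add \<Omega> = add (presented (form_gens B) (form_relators K B))"
  by (simp_all add: Omega1_def Let_def)

lemma abelian_group_Omega1: "abelian_group \<Omega>"
  by (rule abelian_group_cong[OF F.abelian_group_presented]) (simp_all add: Omega1_simps)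

lemma form_gen_closed:
  "\<lbrakk>a \<in> carrier B; b \<in> carrier B; c \<in> carrier B\<rbrakk> \<Longrightarrow> fg a b c \<in> carrier \<Omega>"
  unfolding form_gen_def Omega1_simps by (rule F.generator_in) (simp add: form_gens_def)

lemma form_gen_add:
  assumes "a \<in> carrier B" "b \<in> carrier B" "c \<in> carrier B" "e \<in> carrier B"
  shows "fg (a \<oplus>\<^bsub>B\<^esub> e) b c = fg a b c \<oplus>\<^bsub>\<Omega>\<^esub> fg e b c"
    and "fg a (b \<oplus>\<^bsub>B\<^esub> e) c = fg a b c \<oplus>\<^bsub>\<Omega>\<^esub> fg a e c"
    and "fg a b (c \<oplus>\<^bsub>B\<^esub> e) = fg a b c \<oplus>\<^bsub>\<Omega>\<^esub> fg a b e"
proof -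
  have "frag_of (a \<oplus>\<^bsub>B\<^esub> e, b, c) - frag_of (a, b, c) - frag_of (e, b, c) \<in> form_relators K B"
    "frag_of (a, b \<oplus>\<^bsub>B\<^esub> e, c) - frag_of (a, b, c) - frag_of (a, e, c) \<in> form_relators K B"
    "frag_of (a, b, c \<oplus>\<^bsub>B\<^esub> e) - frag_of (a, b, c) - frag_of (a, b, e) \<in> form_relators K B"
    using assms unfolding form_relators_def by blast+
  then show "fg (a \<oplus>\<^bsub>B\<^esub> e) b c = fg a b c \<oplus>\<^bsub>\<Omega>\<^esub> fg e b c"
    and "fg a (b \<oplus>\<^bsub>B\<^esub> e) c = fg a b c \<oplus>\<^bsub>\<Omega>\<^esub> fg a e c"
    and "fg a b (c \<oplus>\<^bsub>B\<^esub> e) = fg a b c \<oplus>\<^bsub>\<Omega>\<^esub> fg a b e"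
    unfolding form_gen_def Omega1_simps
    using assms by - (rule F.generator_add; simp add: form_gens_def)+
qed

lemma form_gen_scalar:
  assumes "k \<in> carrier K" "a \<in> carrier B" "b \<in> carrier B" "c \<in> carrier B"
  shows "fg a (k \<odot>\<^bsub>B\<^esub> b) c = fg (k \<odot>\<^bsub>B\<^esub> a) b c"
  unfolding form_gen_def using assms
  by (intro F.generator_eq) (auto simp: form_gens_def form_relators_def)

lemma form_gen_leibniz:
  assumes "a \<in> carrier B" "b \<in> carrier B" "b' \<in> carrier B" "c \<in> carrier B"
  shows "fg a (b \<otimes>\<^bsub>B\<^esub> b') c = fg a b (b' \<otimes>\<^bsub>B\<^esub> c) \<oplus>\<^bsub>\<Omega>\<^esub> fg (a \<otimes>\<^bsub>B\<^esub> b) b' c"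
proof -
  have "frag_of (a, b \<otimes>\<^bsub>B\<^esub> b', c) - frag_of (a, b, b' \<otimes>\<^bsub>B\<^esub> c) - frag_of (a \<otimes>\<^bsub>B\<^esub> b, b', c) \<in> form_relators K B"
    using assms unfolding form_relators_def by blast
  then show ?thesis
    unfolding form_gen_def Omega1_simps
    using assms by - (rule F.generator_add; simp add: form_gens_def)
qed

lemma form_map_eqI:
  assumes "abelian_group G" "additive_map \<Omega> G h" "additive_map \<Omega> G h'"
    and "\<And>a b c. \<lbrakk>a \<in> carrier B; b \<in> carrier B; c \<in> carrier B\<rbrakk> \<Longrightarrow> h (fg a b c) = h' (fg a b c)"
    and "\<omega> \<in> carrier \<Omega>"
  shows "h \<omega> = h' \<omega>"
proof (rule F.presented_map_eqI[OF assms(1)])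
  fix x assume "x \<in> form_gens B"
  then obtain a b c where "x = (a, b, c)" "a \<in> carrier B" "b \<in> carrier B" "c \<in> carrier B"
    by (auto simp: form_gens_def)
  then show "h (generator (form_gens B) (form_relators K B) x) = h' (generator (form_gens B) (form_relators K B) x)"
    using assms(4)[of a b c] by (simp only: form_gen_def)
qed (use assms(2,3,5) in \<open>auto simp: additive_map_def Omega1_simps\<close>)

context
  fixes G :: "('g, 'v) ring_scheme" and g :: "'c \<Rightarrow> 'c \<Rightarrow> 'c \<Rightarrow> 'g"
  assumes G: "abelian_group G"
    and g_closed: "\<And>a b c. \<lbrakk>a \<in> carrier B; b \<in> carrier B; c \<in> carrier B\<rbrakk> \<Longrightarrow> g a b c \<in> carrier G"
    and g_add: "\<And>a b c e. \<lbrakk>a \<in> carrier B; b \<in> carrier B; c \<in> carrier B; e \<in> carrier B\<rbrakk>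
        \<Longrightarrow> g (a \<oplus>\<^bsub>B\<^esub> e) b c = g a b c \<oplus>\<^bsub>G\<^esub> g e b c"
      "\<And>a b c e. \<lbrakk>a \<in> carrier B; b \<in> carrier B; c \<in> carrier B; e \<in> carrier B\<rbrakk>
        \<Longrightarrow> g a (b \<oplus>\<^bsub>B\<^esub> e) c = g a b c \<oplus>\<^bsub>G\<^esub> g a e c"
      "\<And>a b c e. \<lbrakk>a \<in> carrier B; b \<in> carrier B; c \<in> carrier B; e \<in> carrier B\<rbrakk>
        \<Longrightarrow> g a b (c \<oplus>\<^bsub>B\<^esub> e) = g a b c \<oplus>\<^bsub>G\<^esub> g a b e"
    and g_scalar: "\<And>k a b c. \<lbrakk>k \<in> carrier K; a \<in> carrier B; b \<in> carrier B; c \<in> carrier B\<rbrakk>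
        \<Longrightarrow> g a (k \<odot>\<^bsub>B\<^esub> b) c = g (k \<odot>\<^bsub>B\<^esub> a) b c"
    and g_leibniz: "\<And>a b b' c. \<lbrakk>a \<in> carrier B; b \<in> carrier B; b' \<in> carrier B; c \<in> carrier B\<rbrakk>
        \<Longrightarrow> g a (b \<otimes>\<^bsub>B\<^esub> b') c = g a b (b' \<otimes>\<^bsub>B\<^esub> c) \<oplus>\<^bsub>G\<^esub> g (a \<otimes>\<^bsub>B\<^esub> b) b' c"
begin

text \<open>
  The universal property of \<open>\<Omega>\<^sup>1B\<close>, for maps prescribed on the elements \<open>a db c\<close>.
\<close>

lemma form_respects:
  assumes "r \<in> form_relators K B"
  shows "frag_eval G (\<lambda>(a, b, c). g a b c) r = \<zero>\<^bsub>G\<^esub>"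
proof -
  interpret G: abelian_group G by (rule G)
  show ?thesis
    using assms unfolding form_relators_def
    by (auto intro!: G.frag_eval_relator3 G.frag_eval_relator2
       simp: g_add g_scalar g_leibniz g_closed)
qed

lemma additive_form_lift: "additive_map \<Omega> G (lift G (\<lambda>(a, b, c). g a b c))"
proof -
  have "additive_map (presented (form_gens B) (form_relators K B)) G (lift G (\<lambda>(a, b, c). g a b c))"
    by (rule F.additive_lift[OF G _ form_respects]) (auto simp: g_closed form_gens_def)
  then show ?thesis by (simp add: additive_map_def Omega1_simps)
qed

lemma form_lift_gen:
  "\<lbrakk>a \<in> carrier B; b \<in> carrier B; c \<in> carrier B\<rbrakk> \<Longrightarrow> lift G (\<lambda>(a, b, c). g a b c) (fg a b c) = g a b c"
  unfolding form_gen_def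
  by (subst F.lift_generator[OF G _ form_respects]) (auto simp: g_closed form_gens_def)

end

lemma Omega1_actions:
  "smult \<Omega> = (\<lambda>e. lift (presented (form_gens B) (form_relators K B)) (\<lambda>(a, b, c). fg (e \<otimes>\<^bsub>B\<^esub> a) b c))"
  "rsmult \<Omega> = (\<lambda>\<omega> e. lift (presented (form_gens B) (form_relators K B)) (\<lambda>(a, b, c). fg a b (c \<otimes>\<^bsub>B\<^esub> e)) \<omega>)"
  by (simp_all add: Omega1_def Let_def)

lemma
  assumes e: "e \<in> carrier B"
  shows additive_form_smult: "additive_map \<Omega> \<Omega> (\<lambda>\<omega>. e \<odot>\<^bsub>\<Omega>\<^esub> \<omega>)" (is ?A)
    and form_smult_gen: "\<lbrakk>a \<in> carrier B; b \<in> carrier B; c \<in> carrier B\<rbrakk>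
      \<Longrightarrow> e \<odot>\<^bsub>\<Omega>\<^esub> fg a b c = fg (e \<otimes>\<^bsub>B\<^esub> a) b c" (is "\<lbrakk>_; _; _\<rbrakk> \<Longrightarrow> ?B")
proof -
  let ?P = "presented (form_gens B) (form_relators K B)"
  let ?g = "\<lambda>a b c. fg (e \<otimes>\<^bsub>B\<^esub> a) b c"
  note * = F.abelian_group_presented
  have g: "\<And>a b c. \<lbrakk>a \<in> carrier B; b \<in> carrier B; c \<in> carrier B\<rbrakk> \<Longrightarrow> ?g a b c \<in> carrier ?P"
    using e form_gen_closed by (simp flip: Omega1_simps)
  note add = form_gen_add[unfolded Omega1_simps]
  note lz = form_gen_leibniz[unfolded Omega1_simps]
  have "additive_map \<Omega> ?P (lift ?P (\<lambda>(a, b, c). ?g a b c))"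
    by (rule additive_form_lift[OF * g])
      (use e in \<open>auto simp: add B.r_distr form_gen_scalar lz smult_mult_right[symmetric] B.m_assoc\<close>)
  then show ?A
    by (simp add: Omega1_actions additive_map_def Omega1_simps)
  assume "a \<in> carrier B" "b \<in> carrier B" "c \<in> carrier B"
  then have "lift ?P (\<lambda>(a, b, c). ?g a b c) (fg a b c) = ?g a b c"
    by (intro form_lift_gen[OF * g])
      (use e in \<open>auto simp: add B.r_distr form_gen_scalar lz smult_mult_right[symmetric] B.m_assoc\<close>)
  then show ?B by (simp add: Omega1_actions)
qed

lemma
  assumes e: "e \<in> carrier B"
  shows additive_form_rsmult: "additive_map \<Omega> \<Omega> (\<lambda>\<omega>. rsmult \<Omega> \<omega> e)" (is ?A)
    and form_rsmult_gen: "\<lbrakk>a \<in> carrier B; b \<in> carrier B; c \<in> carrier B\<rbrakk>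
      \<Longrightarrow> rsmult \<Omega> (fg a b c) e = fg a b (c \<otimes>\<^bsub>B\<^esub> e)" (is "\<lbrakk>_; _; _\<rbrakk> \<Longrightarrow> ?B")
proof -
  let ?P = "presented (form_gens B) (form_relators K B)"
  let ?g = "\<lambda>a b c. fg a b (c \<otimes>\<^bsub>B\<^esub> e)"
  note * = F.abelian_group_presented
  have g: "\<And>a b c. \<lbrakk>a \<in> carrier B; b \<in> carrier B; c \<in> carrier B\<rbrakk> \<Longrightarrow> ?g a b c \<in> carrier ?P"
    using e form_gen_closed by (simp flip: Omega1_simps)
  note add = form_gen_add[unfolded Omega1_simps]
  note lz = form_gen_leibniz[unfolded Omega1_simps]
  have "additive_map \<Omega> ?P (lift ?P (\<lambda>(a, b, c). ?g a b c))"
    by (rule additive_form_lift[OF * g])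
      (use e in \<open>auto simp: add B.l_distr form_gen_scalar lz B.m_assoc\<close>)
  then show ?A
    by (simp add: Omega1_actions additive_map_def Omega1_simps)
  assume "a \<in> carrier B" "b \<in> carrier B" "c \<in> carrier B"
  then have "lift ?P (\<lambda>(a, b, c). ?g a b c) (fg a b c) = ?g a b c"
    by (intro form_lift_gen[OF * g])
      (use e in \<open>auto simp: add B.l_distr form_gen_scalar lz B.m_assoc\<close>)
  then show ?B by (simp add: Omega1_actions)
qed

lemma form_smult_closed: "\<lbrakk>e \<in> carrier B; \<omega> \<in> carrier \<Omega>\<rbrakk> \<Longrightarrow> e \<odot>\<^bsub>\<Omega>\<^esub> \<omega> \<in> carrier \<Omega>"
  using additive_map_closed[OF additive_form_smult] .

lemma form_rsmult_closed: "\<lbrakk>e \<in> carrier B; \<omega> \<in> carrier \<Omega>\<rbrakk> \<Longrightarrow> rsmult \<Omega> \<omega> e \<in> carrier \<Omega>"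
  using additive_map_closed[OF additive_form_rsmult] .

text \<open>
  Compatibility of the two actions is what makes the left action on \<open>\<Omega>\<^sup>1B \<otimes>\<^sub>B M\<close> and the right
  action on \<open>\<Omega>\<^sup>1B \<otimes>\<^sub>B \<Omega>\<^sup>1B\<close> well defined.
\<close>

lemma form_smult_rsmult:
  assumes "e \<in> carrier B" "e' \<in> carrier B" "\<omega> \<in> carrier \<Omega>"
  shows "e \<odot>\<^bsub>\<Omega>\<^esub> rsmult \<Omega> \<omega> e' = rsmult \<Omega> (e \<odot>\<^bsub>\<Omega>\<^esub> \<omega>) e'"
  by (rule form_map_eqI[OF abelian_group_Omega1 additive_map_comp[OF additive_form_rsmult[OF assms(2)] additive_form_smult[OF assms(1)]]
      additive_map_comp[OF additive_form_smult[OF assms(1)] additive_form_rsmult[OF assms(2)]]])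
    (use assms in \<open>simp_all add: form_smult_gen form_rsmult_gen\<close>)

text \<open>
  The Leibniz rule for \<open>1 = 1 \<cdot> 1\<close> gives \<open>d1 = d1 + d1\<close>. With homogeneity, \<open>d(k1) = 0\<close> follows, and the
  Leibniz rule for \<open>b \<cdot> k1\<close> then shows that \<open>\<K>\<close> acts centrally on \<open>\<Omega>\<^sup>1B\<close>.
\<close>

lemma form_gen_one:
  assumes "a \<in> carrier B" "c \<in> carrier B"
  shows "fg a \<one>\<^bsub>B\<^esub> c = \<zero>\<^bsub>\<Omega>\<^esub>"
proof -
  interpret W: abelian_group \<Omega> by (rule abelian_group_Omega1)
  have "fg a \<one>\<^bsub>B\<^esub> c = fg a \<one>\<^bsub>B\<^esub> c \<oplus>\<^bsub>\<Omega>\<^esub> fg a \<one>\<^bsub>B\<^esub> c"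
    using form_gen_leibniz[of a "\<one>\<^bsub>B\<^esub>" "\<one>\<^bsub>B\<^esub>" c] assms by simp
  then show ?thesis using form_gen_closed[of a "\<one>\<^bsub>B\<^esub>" c] assms by (simp add: W.add.r_cancel_one')
qed

lemma form_gen_central:
  assumes "k \<in> carrier K" "a \<in> carrier B" "b \<in> carrier B" "c \<in> carrier B"
  shows "fg (k \<odot>\<^bsub>B\<^esub> a) b c = fg a b (k \<odot>\<^bsub>B\<^esub> c)"
proof -
  interpret W: abelian_group \<Omega> by (rule abelian_group_Omega1)
  let ?k = "k \<odot>\<^bsub>B\<^esub> \<one>\<^bsub>B\<^esub>"
  have k: "b \<otimes>\<^bsub>B\<^esub> ?k = k \<odot>\<^bsub>B\<^esub> b" "?k \<otimes>\<^bsub>B\<^esub> c = k \<odot>\<^bsub>B\<^esub> c" "?k \<in> carrier B"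
    using assms by (simp_all add: smult_mult_left smult_mult_right)
  have "fg (a \<otimes>\<^bsub>B\<^esub> b) ?k c = \<zero>\<^bsub>\<Omega>\<^esub>"
    using assms by (simp add: form_gen_scalar form_gen_one)
  then have "fg a (k \<odot>\<^bsub>B\<^esub> b) c = fg a b (k \<odot>\<^bsub>B\<^esub> c)"
    using form_gen_leibniz[of a b ?k c] assms k form_gen_closed[of a b "k \<odot>\<^bsub>B\<^esub> c"] by simp
  then show ?thesis using assms by (simp add: form_gen_scalar)
qed

lemma d_closed: "a \<in> carrier B \<Longrightarrow> d a \<in> carrier \<Omega>"
  by (simp add: d0_def form_gen_closed)

sublocale O2: tensor_pair B \<Omega> \<Omega>
  by (rule tensor_pair.intro) (simp_all add: abelian_group_Omega1 form_smult_closed form_rsmult_closed)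

lemma Omega2_simps:
  "carrier \<Omega>2 = carrier (tensor B \<Omega> \<Omega>)" "\<zero>\<^bsub>\<Omega>2\<^esub> = \<zero>\<^bsub>tensor B \<Omega> \<Omega>\<^esub>" "add \<Omega>2 = add (tensor B \<Omega> \<Omega>)"
  "rsmult \<Omega>2 = (\<lambda>t b. lift (tensor B \<Omega> \<Omega>) (\<lambda>(w, v). pure B \<Omega> \<Omega> w (rsmult \<Omega> v b)) t)"
  unfolding Omega2_def by (rule bitensor_simps)+

lemma abelian_group_Omega2: "abelian_group \<Omega>2"
  by (rule abelian_group_cong[OF O2.abelian_group_tensor]) (simp_all add: Omega2_simps)

abbreviation wedge (infixl \<open>\<otimes>\<Omega>\<close> 75) where "\<omega> \<otimes>\<Omega> \<eta> \<equiv> pure B \<Omega> \<Omega> \<omega> \<eta>"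

lemma wedge_closed: "\<lbrakk>\<omega> \<in> carrier \<Omega>; \<eta> \<in> carrier \<Omega>\<rbrakk> \<Longrightarrow> \<omega> \<otimes>\<Omega> \<eta> \<in> carrier \<Omega>2"
  by (simp add: Omega2_simps O2.pure_closed)

lemmas wedge_add_left = O2.pure_add_left[folded Omega2_simps]
lemmas wedge_add_right = O2.pure_add_right[folded Omega2_simps]
lemmas wedge_balanced = O2.pure_balanced

lemma additive_wedge_left: "\<eta> \<in> carrier \<Omega> \<Longrightarrow> additive_map \<Omega> \<Omega>2 (\<lambda>\<omega>. \<omega> \<otimes>\<Omega> \<eta>)"
  by (rule additive_mapI) (auto simp: wedge_closed wedge_add_left)

lemma Omega2_map_eqI:
  assumes "abelian_group G" "additive_map \<Omega>2 G h" "additive_map \<Omega>2 G h'"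
    and "\<And>\<omega> \<eta>. \<lbrakk>\<omega> \<in> carrier \<Omega>; \<eta> \<in> carrier \<Omega>\<rbrakk> \<Longrightarrow> h (\<omega> \<otimes>\<Omega> \<eta>) = h' (\<omega> \<otimes>\<Omega> \<eta>)"
    and "t \<in> carrier \<Omega>2"
  shows "h t = h' t"
proof (rule O2.tensor_map_eqI[OF assms(1)])
  show "h (\<omega> \<otimes>\<Omega> \<eta>) = h' (\<omega> \<otimes>\<Omega> \<eta>)" if "\<omega> \<in> carrier \<Omega>" "\<eta> \<in> carrier \<Omega>" for \<omega> \<eta>
    using assms(4)[OF that] .
qed (use assms(2,3,5) in \<open>auto simp: additive_map_def Omega2_simps\<close>)

lemma
  assumes e: "e \<in> carrier B"
  shows additive_Omega2_rsmult: "additive_map \<Omega>2 \<Omega>2 (\<lambda>t. rsmult \<Omega>2 t e)" (is ?A)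
    and Omega2_rsmult_wedge: "\<lbrakk>\<omega> \<in> carrier \<Omega>; \<eta> \<in> carrier \<Omega>\<rbrakk>
      \<Longrightarrow> rsmult \<Omega>2 (\<omega> \<otimes>\<Omega> \<eta>) e = \<omega> \<otimes>\<Omega> rsmult \<Omega> \<eta> e" (is "\<lbrakk>_; _\<rbrakk> \<Longrightarrow> ?B")
proof -
  let ?T = "tensor B \<Omega> \<Omega>"
  let ?g = "\<lambda>w v. w \<otimes>\<Omega> rsmult \<Omega> v e"
  note closed = O2.pure_closed form_rsmult_closed[OF e] form_smult_closed form_rsmult_closed e
  note simps = closed O2.pure_add_left O2.pure_add_right additive_map_add[OF additive_form_rsmult[OF e]]
    O2.pure_balanced form_smult_rsmult
  have "additive_map ?T ?T (lift ?T (\<lambda>(w, v). ?g w v))"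
    by (rule O2.additive_tensor_lift[OF O2.abelian_group_tensor]) (simp_all add: simps)
  then show ?A by (simp add: additive_map_def Omega2_simps)
  assume "\<omega> \<in> carrier \<Omega>" "\<eta> \<in> carrier \<Omega>"
  then have "lift ?T (\<lambda>(w, v). ?g w v) (\<omega> \<otimes>\<Omega> \<eta>) = ?g \<omega> \<eta>"
    by (intro O2.tensor_lift_pure[OF O2.abelian_group_tensor]) (simp_all add: simps)
  then show ?B by (simp add: Omega2_simps)
qed

lemma Omega2_rsmult_closed: "\<lbrakk>t \<in> carrier \<Omega>2; e \<in> carrier B\<rbrakk> \<Longrightarrow> rsmult \<Omega>2 t e \<in> carrier \<Omega>2"
  using additive_map_closed[OF additive_Omega2_rsmult] .

end

section \<open>The exterior derivative and contractions\<close>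

context assoc_algebra
begin

lemma d_mult:
  assumes "a \<in> carrier B" "b \<in> carrier B"
  shows "d (a \<otimes>\<^bsub>B\<^esub> b) = fg \<one>\<^bsub>B\<^esub> a b \<oplus>\<^bsub>\<Omega>\<^esub> fg a b \<one>\<^bsub>B\<^esub>"
  using form_gen_leibniz[of "\<one>\<^bsub>B\<^esub>" a b "\<one>\<^bsub>B\<^esub>"] assms by (simp add: d0_def)

lemma wedge_shift:
  assumes "a \<in> carrier B" "b \<in> carrier B" "c \<in> carrier B" "b' \<in> carrier B" "c' \<in> carrier B"
  shows "fg a b c \<otimes>\<Omega> fg \<one>\<^bsub>B\<^esub> b' c' = fg a b \<one>\<^bsub>B\<^esub> \<otimes>\<Omega> fg c b' c'"
  using wedge_balanced[of "fg a b \<one>\<^bsub>B\<^esub>" c "fg \<one>\<^bsub>B\<^esub> b' c'"] assms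
  by (simp add: form_gen_closed form_rsmult_gen form_smult_gen)

text \<open>
  The value of \<open>d\<close> on \<open>a db c\<close>.
\<close>

definition d1_gen where
  "d1_gen a b c = d a \<otimes>\<Omega> fg \<one>\<^bsub>B\<^esub> b c \<ominus>\<^bsub>\<Omega>2\<^esub> fg a b \<one>\<^bsub>B\<^esub> \<otimes>\<Omega> d c"

lemma d1_eq: "d1 K B = lift \<Omega>2 (\<lambda>(a, b, c). d1_gen a b c)"
  by (simp add: d1_def d1_gen_def)

lemma d1_gen_closed:
  "\<lbrakk>a \<in> carrier B; b \<in> carrier B; c \<in> carrier B\<rbrakk> \<Longrightarrow> d1_gen a b c \<in> carrier \<Omega>2"
  using abelian_group.minus_closed[OF abelian_group_Omega2]
  by (simp add: d1_gen_def wedge_closed form_gen_closed d_closed)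

lemma d1_gen_add:
  assumes "a \<in> carrier B" "b \<in> carrier B" "c \<in> carrier B" "e \<in> carrier B"
  shows "d1_gen (a \<oplus>\<^bsub>B\<^esub> e) b c = d1_gen a b c \<oplus>\<^bsub>\<Omega>2\<^esub> d1_gen e b c"
    and "d1_gen a (b \<oplus>\<^bsub>B\<^esub> e) c = d1_gen a b c \<oplus>\<^bsub>\<Omega>2\<^esub> d1_gen a e c"
    and "d1_gen a b (c \<oplus>\<^bsub>B\<^esub> e) = d1_gen a b c \<oplus>\<^bsub>\<Omega>2\<^esub> d1_gen a b e"
  using assms unfolding d1_gen_def d0_def
  by (simp_all add: form_gen_add form_gen_closed wedge_add_left wedge_add_right
      abelian_group.minus_add_interchange[OF abelian_group_Omega2] wedge_closed)

text \<open>
  Here centrality of \<open>\<K>\<close> is needed: in \<open>da \<otimes> d(kb) c\<close> the scalar has to move across the tensor sign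
  and into \<open>da\<close>.
\<close>

lemma d1_gen_scalar:
  assumes "k \<in> carrier K" "a \<in> carrier B" "b \<in> carrier B" "c \<in> carrier B"
  shows "d1_gen a (k \<odot>\<^bsub>B\<^esub> b) c = d1_gen (k \<odot>\<^bsub>B\<^esub> a) b c"
proof -
  let ?k = "k \<odot>\<^bsub>B\<^esub> \<one>\<^bsub>B\<^esub>"
  have "d a \<otimes>\<Omega> fg \<one>\<^bsub>B\<^esub> (k \<odot>\<^bsub>B\<^esub> b) c = d a \<otimes>\<Omega> fg ?k b c"
    using assms by (simp add: form_gen_scalar)
  also have "\<dots> = fg \<one>\<^bsub>B\<^esub> a ?k \<otimes>\<Omega> fg \<one>\<^bsub>B\<^esub> b c"
    using assms by (simp add: wedge_shift d0_def)
  also have "fg \<one>\<^bsub>B\<^esub> a ?k = d (k \<odot>\<^bsub>B\<^esub> a)"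
    using assms by (simp add: form_gen_central[symmetric] form_gen_scalar d0_def)
  finally show ?thesis using assms by (simp add: d1_gen_def form_gen_scalar)
qed

text \<open>
  Expanding \<open>d(b'c)\<close> and \<open>d(ab)\<close> on the right hand side produces \<open>a db \<otimes> db' c\<close> with both signs; the
  remaining terms match those of the left hand side after moving \<open>b\<close> or \<open>b'\<close> across the tensor sign.
\<close>

lemma d1_gen_leibniz:
  assumes "a \<in> carrier B" "b \<in> carrier B" "b' \<in> carrier B" "c \<in> carrier B"
  shows "d1_gen a (b \<otimes>\<^bsub>B\<^esub> b') c = d1_gen a b (b' \<otimes>\<^bsub>B\<^esub> c) \<oplus>\<^bsub>\<Omega>2\<^esub> d1_gen (a \<otimes>\<^bsub>B\<^esub> b) b' c"
proof -
  interpret W: abelian_group \<Omega>2 by (rule abelian_group_Omega2)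
  have 1: "fg \<one>\<^bsub>B\<^esub> (b \<otimes>\<^bsub>B\<^esub> b') c = fg \<one>\<^bsub>B\<^esub> b (b' \<otimes>\<^bsub>B\<^esub> c) \<oplus>\<^bsub>\<Omega>\<^esub> fg b b' c"
    and 2: "fg a (b \<otimes>\<^bsub>B\<^esub> b') \<one>\<^bsub>B\<^esub> = fg a b b' \<oplus>\<^bsub>\<Omega>\<^esub> fg (a \<otimes>\<^bsub>B\<^esub> b) b' \<one>\<^bsub>B\<^esub>"
    using assms form_gen_leibniz[of "\<one>\<^bsub>B\<^esub>" b b' c] form_gen_leibniz[of a b b' "\<one>\<^bsub>B\<^esub>"] by simp_all
  have 3: "fg \<one>\<^bsub>B\<^esub> a b \<otimes>\<Omega> fg \<one>\<^bsub>B\<^esub> b' c = d a \<otimes>\<Omega> fg b b' c"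
    and 4: "fg a b b' \<otimes>\<Omega> d c = fg a b \<one>\<^bsub>B\<^esub> \<otimes>\<Omega> fg b' c \<one>\<^bsub>B\<^esub>"
    using assms wedge_shift[of "\<one>\<^bsub>B\<^esub>" a b b' c] wedge_shift[of a b b' c "\<one>\<^bsub>B\<^esub>"] by (simp_all add: d0_def)
  have "d1_gen a (b \<otimes>\<^bsub>B\<^esub> b') c =
     (d a \<otimes>\<Omega> fg \<one>\<^bsub>B\<^esub> b (b' \<otimes>\<^bsub>B\<^esub> c) \<oplus>\<^bsub>\<Omega>2\<^esub> d a \<otimes>\<Omega> fg b b' c) \<ominus>\<^bsub>\<Omega>2\<^esub>
     (fg a b b' \<otimes>\<Omega> d c \<oplus>\<^bsub>\<Omega>2\<^esub> fg (a \<otimes>\<^bsub>B\<^esub> b) b' \<one>\<^bsub>B\<^esub> \<otimes>\<Omega> d c)"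
    using assms by (simp add: d1_gen_def 1 2 wedge_add_left wedge_add_right form_gen_closed d_closed)
  also have "\<dots> = (d a \<otimes>\<Omega> fg \<one>\<^bsub>B\<^esub> b (b' \<otimes>\<^bsub>B\<^esub> c) \<ominus>\<^bsub>\<Omega>2\<^esub>
        (fg a b \<one>\<^bsub>B\<^esub> \<otimes>\<Omega> fg \<one>\<^bsub>B\<^esub> b' c \<oplus>\<^bsub>\<Omega>2\<^esub> fg a b b' \<otimes>\<Omega> d c)) \<oplus>\<^bsub>\<Omega>2\<^esub>
     ((d a \<otimes>\<Omega> fg b b' c \<oplus>\<^bsub>\<Omega>2\<^esub> fg a b \<one>\<^bsub>B\<^esub> \<otimes>\<Omega> fg \<one>\<^bsub>B\<^esub> b' c) \<ominus>\<^bsub>\<Omega>2\<^esub> fg (a \<otimes>\<^bsub>B\<^esub> b) b' \<one>\<^bsub>B\<^esub> \<otimes>\<Omega> d c)"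
    using assms by (intro W.leibniz_cancel) (auto intro!: wedge_closed form_gen_closed d_closed)
  also have "\<dots> = d1_gen a b (b' \<otimes>\<^bsub>B\<^esub> c) \<oplus>\<^bsub>\<Omega>2\<^esub> d1_gen (a \<otimes>\<^bsub>B\<^esub> b) b' c"
    using assms by (simp add: d1_gen_def d_mult wedge_add_left wedge_add_right form_gen_closed 3 4)
  finally show ?thesis .
qed

lemma additive_d1: "additive_map \<Omega> \<Omega>2 (d1 K B)"
  unfolding d1_eq
  by (rule additive_form_lift[OF abelian_group_Omega2 d1_gen_closed d1_gen_add d1_gen_scalar d1_gen_leibniz])

lemma d1_form_gen:
  "\<lbrakk>a \<in> carrier B; b \<in> carrier B; c \<in> carrier B\<rbrakk> \<Longrightarrow> d1 K B (fg a b c) = d1_gen a b c"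
  unfolding d1_eq
  by (rule form_lift_gen[OF abelian_group_Omega2 d1_gen_closed d1_gen_add d1_gen_scalar d1_gen_leibniz])

text \<open>The graded Leibniz rule \<open>d(\<omega>e) = (d\<omega>)e - \<omega> de\<close> makes the extended connection balanced.\<close>

lemma d1_rsmult:
  assumes e: "e \<in> carrier B" and \<omega>: "\<omega> \<in> carrier \<Omega>"
  shows "d1 K B (rsmult \<Omega> \<omega> e) = rsmult \<Omega>2 (d1 K B \<omega>) e \<ominus>\<^bsub>\<Omega>2\<^esub> \<omega> \<otimes>\<Omega> d e"
proof (rule form_map_eqI[OF abelian_group_Omega2 _ _ _ \<omega>])
  interpret W: abelian_group \<Omega>2 by (rule abelian_group_Omega2)
  show "additive_map \<Omega> \<Omega>2 (\<lambda>\<omega>. d1 K B (rsmult \<Omega> \<omega> e))"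
    by (rule additive_map_comp[OF additive_form_rsmult[OF e] additive_d1])
  show "additive_map \<Omega> \<Omega>2 (\<lambda>\<omega>. rsmult \<Omega>2 (d1 K B \<omega>) e \<ominus>\<^bsub>\<Omega>2\<^esub> \<omega> \<otimes>\<Omega> d e)"
    by (intro W.additive_map_comb additive_map_comp[OF additive_d1 additive_Omega2_rsmult[OF e]]
        additive_wedge_left d_closed e)
  fix a b c assume abc: "a \<in> carrier B" "b \<in> carrier B" "c \<in> carrier B"
  have 1: "rsmult \<Omega>2 (d1_gen a b c) e = d a \<otimes>\<Omega> fg \<one>\<^bsub>B\<^esub> b (c \<otimes>\<^bsub>B\<^esub> e) \<ominus>\<^bsub>\<Omega>2\<^esub> fg a b \<one>\<^bsub>B\<^esub> \<otimes>\<Omega> fg \<one>\<^bsub>B\<^esub> c e"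
    using abc e unfolding d1_gen_def
    by (simp add: additive_map_minus[OF abelian_group_Omega2 abelian_group_Omega2 additive_Omega2_rsmult[OF e]]
       wedge_closed form_gen_closed d_closed Omega2_rsmult_wedge form_rsmult_gen) (simp add: d0_def form_rsmult_gen)
  have 2: "fg a b c \<otimes>\<Omega> d e = fg a b \<one>\<^bsub>B\<^esub> \<otimes>\<Omega> fg c e \<one>\<^bsub>B\<^esub>"
    using abc e by (simp add: d0_def wedge_shift)
  show "d1 K B (rsmult \<Omega> (fg a b c) e) = rsmult \<Omega>2 (d1 K B (fg a b c)) e \<ominus>\<^bsub>\<Omega>2\<^esub> fg a b c \<otimes>\<Omega> d e"
    using abc e
    by (simp add: form_rsmult_gen d1_form_gen 1 2)
      (simp add: d1_gen_def d_mult wedge_add_right form_gen_closed wedge_closed d_closed a_minus_def W.minus_add W.a_ac)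
qed

lemma Der_carrier:
  "f \<in> carrier (Der_lie K B) \<longleftrightarrow> f \<in> linear_maps K B B \<and> (\<forall>a\<in>carrier B. \<forall>b\<in>carrier B.
        f (a \<otimes>\<^bsub>B\<^esub> b) = f a \<otimes>\<^bsub>B\<^esub> b \<oplus>\<^bsub>B\<^esub> a \<otimes>\<^bsub>B\<^esub> f b)"
  by (simp add: Der_lie_def commutator_lie_def Let_def)

lemma Der_props:
  assumes "f \<in> carrier (Der_lie K B)"
  shows Der_closed: "a \<in> carrier B \<Longrightarrow> f a \<in> carrier B"
    and Der_add: "\<lbrakk>a \<in> carrier B; b \<in> carrier B\<rbrakk> \<Longrightarrow> f (a \<oplus>\<^bsub>B\<^esub> b) = f a \<oplus>\<^bsub>B\<^esub> f b"
    and Der_smult: "\<lbrakk>k \<in> carrier K; a \<in> carrier B\<rbrakk> \<Longrightarrow> f (k \<odot>\<^bsub>B\<^esub> a) = k \<odot>\<^bsub>B\<^esub> f a"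
    and Der_mult: "\<lbrakk>a \<in> carrier B; b \<in> carrier B\<rbrakk>
       \<Longrightarrow> f (a \<otimes>\<^bsub>B\<^esub> b) = f a \<otimes>\<^bsub>B\<^esub> b \<oplus>\<^bsub>B\<^esub> a \<otimes>\<^bsub>B\<^esub> f b"
    and additive_Der: "additive_map B B f"
  using assms by (auto simp: Der_carrier linear_maps_def linear_map_def additive_map_def)

lemma
  assumes f: "f \<in> carrier (Der_lie K B)"
  shows additive_contraction: "additive_map \<Omega> B (contraction B f)" (is ?A)
    and contraction_gen: "\<lbrakk>a \<in> carrier B; b \<in> carrier B; c \<in> carrier B\<rbrakk>
      \<Longrightarrow> contraction B f (fg a b c) = a \<otimes>\<^bsub>B\<^esub> f b \<otimes>\<^bsub>B\<^esub> c" (is "\<lbrakk>_; _; _\<rbrakk> \<Longrightarrow> ?B")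
proof -
  note simps = Der_closed[OF f] Der_add[OF f] Der_smult[OF f] Der_mult[OF f]
    B.l_distr B.r_distr B.m_assoc smult_mult_left smult_mult_right
  show ?A unfolding contraction_def
    by (rule additive_form_lift[OF B.is_abelian_group]) (simp_all add: simps)
  assume "a \<in> carrier B" "b \<in> carrier B" "c \<in> carrier B"
  then show ?B unfolding contraction_def
    by (intro form_lift_gen[OF B.is_abelian_group]) (simp_all add: simps)
qed

lemma contraction_closed:
  "\<lbrakk>f \<in> carrier (Der_lie K B); \<omega> \<in> carrier \<Omega>\<rbrakk> \<Longrightarrow> contraction B f \<omega> \<in> carrier B"
  using additive_map_closed[OF additive_contraction] .

lemma additive_lmult: "e \<in> carrier B \<Longrightarrow> additive_map B B (\<lambda>b. e \<otimes>\<^bsub>B\<^esub> b)"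
  by (rule additive_mapI) (auto simp: B.r_distr)

lemma additive_rmult: "e \<in> carrier B \<Longrightarrow> additive_map B B (\<lambda>b. b \<otimes>\<^bsub>B\<^esub> e)"
  by (rule additive_mapI) (auto simp: B.l_distr)

lemma contraction_smult:
  assumes f: "f \<in> carrier (Der_lie K B)" and e: "e \<in> carrier B" and \<omega>: "\<omega> \<in> carrier \<Omega>"
  shows "contraction B f (e \<odot>\<^bsub>\<Omega>\<^esub> \<omega>) = e \<otimes>\<^bsub>B\<^esub> contraction B f \<omega>"
  by (rule form_map_eqI[OF B.is_abelian_group
     additive_map_comp[OF additive_form_smult[OF e] additive_contraction[OF f]]
     additive_map_comp[OF additive_contraction[OF f] additive_lmult[OF e]] _ \<omega>])
   (use e in \<open>simp_all add: contraction_gen[OF f] form_smult_gen Der_closed[OF f] B.m_assoc\<close>)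

lemma contraction_rsmult:
  assumes f: "f \<in> carrier (Der_lie K B)" and e: "e \<in> carrier B" and \<omega>: "\<omega> \<in> carrier \<Omega>"
  shows "contraction B f (rsmult \<Omega> \<omega> e) = contraction B f \<omega> \<otimes>\<^bsub>B\<^esub> e"
  by (rule form_map_eqI[OF B.is_abelian_group
     additive_map_comp[OF additive_form_rsmult[OF e] additive_contraction[OF f]]
     additive_map_comp[OF additive_contraction[OF f] additive_rmult[OF e]] _ \<omega>])
   (use e in \<open>simp_all add: contraction_gen[OF f] form_rsmult_gen Der_closed[OF f] B.m_assoc\<close>)

text \<open>
  This is \<open>i\<^sub>f \<otimes> i\<^sub>g\<close> followed by \<open>B \<otimes>\<^sub>B B \<rightarrow> B\<close>. It is not antisymmetric in \<open>f, g\<close>; antisymmetry enters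
  only in the curvature identity.
\<close>

definition contraction2 where
  "contraction2 f g = lift B (\<lambda>(\<omega>, \<eta>). contraction B f \<omega> \<otimes>\<^bsub>B\<^esub> contraction B g \<eta>)"

lemma
  assumes f: "f \<in> carrier (Der_lie K B)" and g: "g \<in> carrier (Der_lie K B)"
  shows additive_contraction2: "additive_map \<Omega>2 B (contraction2 f g)" (is ?A)
    and contraction2_wedge: "\<lbrakk>\<omega> \<in> carrier \<Omega>; \<eta> \<in> carrier \<Omega>\<rbrakk>
      \<Longrightarrow> contraction2 f g (\<omega> \<otimes>\<Omega> \<eta>) = contraction B f \<omega> \<otimes>\<^bsub>B\<^esub> contraction B g \<eta>" (is "\<lbrakk>_; _\<rbrakk> \<Longrightarrow> ?B")
proof -
  note simps = contraction_closed[OF f] contraction_closed[OF g]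
    additive_map_add[OF additive_contraction[OF f]] additive_map_add[OF additive_contraction[OF g]]
    B.l_distr B.r_distr B.m_assoc contraction_rsmult[OF f] contraction_smult[OF g]
  have "additive_map (tensor B \<Omega> \<Omega>) B (contraction2 f g)" unfolding contraction2_def
    by (rule O2.additive_tensor_lift[OF B.is_abelian_group]) (simp_all add: simps)
  then show ?A by (simp add: additive_map_def Omega2_simps)
  assume "\<omega> \<in> carrier \<Omega>" "\<eta> \<in> carrier \<Omega>"
  then show ?B unfolding contraction2_def
    by (intro O2.tensor_lift_pure[OF B.is_abelian_group]) (simp_all add: simps)
qed

lemma contraction2_rsmult:
  assumes f: "f \<in> carrier (Der_lie K B)" and g: "g \<in> carrier (Der_lie K B)"
    and e: "e \<in> carrier B" and t: "t \<in> carrier \<Omega>2"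
  shows "contraction2 f g (rsmult \<Omega>2 t e) = contraction2 f g t \<otimes>\<^bsub>B\<^esub> e"
  by (rule Omega2_map_eqI[OF B.is_abelian_group
     additive_map_comp[OF additive_Omega2_rsmult[OF e] additive_contraction2[OF f g]]
     additive_map_comp[OF additive_contraction2[OF f g] additive_rmult[OF e]] _ t])
   (use e in \<open>simp_all add: contraction2_wedge[OF f g] Omega2_rsmult_wedge form_rsmult_closed
      contraction_rsmult[OF g] contraction_closed[OF f] contraction_closed[OF g] B.m_assoc\<close>)

lemma contraction2_d1:
  assumes f: "f \<in> carrier (Der_lie K B)" and g: "g \<in> carrier (Der_lie K B)"
    and "a \<in> carrier B" "b \<in> carrier B" "c \<in> carrier B"
  shows "contraction2 f g (d1 K B (fg a b c)) =
    f a \<otimes>\<^bsub>B\<^esub> g b \<otimes>\<^bsub>B\<^esub> c \<ominus>\<^bsub>B\<^esub> a \<otimes>\<^bsub>B\<^esub> f b \<otimes>\<^bsub>B\<^esub> g c"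
  using assms(3-)
  by (simp add: d1_form_gen d1_gen_def wedge_closed form_gen_closed d_closed
      additive_map_minus[OF abelian_group_Omega2 B.is_abelian_group additive_contraction2[OF f g]]
      contraction2_wedge[OF f g])
    (simp add: d0_def contraction_gen[OF f] contraction_gen[OF g] Der_closed[OF f] Der_closed[OF g] B.m_assoc)

end

section \<open>Connections and flatness\<close>

locale algebra_module = assoc_algebra K B + L: left_module B M
  for K (structure) and B (structure) and M
begin

abbreviation \<Omega>M where "\<Omega>M \<equiv> tensor B \<Omega> M"
abbreviation \<Omega>2M where "\<Omega>2M \<equiv> tensor B \<Omega>2 M"
abbreviation t1 (infixl \<open>\<otimes>\<^sub>1\<close> 74) where "\<omega> \<otimes>\<^sub>1 m \<equiv> pure B \<Omega> M \<omega> m"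
abbreviation t2 (infixl \<open>\<otimes>\<^sub>2\<close> 74) where "\<omega> \<otimes>\<^sub>2 m \<equiv> pure B \<Omega>2 M \<omega> m"

sublocale T1: tensor_pair B \<Omega> M
  by (rule tensor_pair.intro) (simp_all add: abelian_group_Omega1 form_rsmult_closed L.smult_closed L.M.abelian_group_axioms)

sublocale T2: tensor_pair B \<Omega>2 M
  by (rule tensor_pair.intro) (simp_all add: abelian_group_Omega2 Omega2_rsmult_closed L.smult_closed L.M.abelian_group_axioms)

lemma additive_act: "b \<in> carrier B \<Longrightarrow> additive_map M M (\<lambda>m. b \<odot>\<^bsub>M\<^esub> m)"
  by (rule additive_mapI) (auto simp: L.smult_closed L.smult_r_distr)

lemma additive_act_left: "m \<in> carrier M \<Longrightarrow> additive_map B M (\<lambda>b. b \<odot>\<^bsub>M\<^esub> m)"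
  by (rule additive_mapI) (auto simp: L.smult_closed L.smult_l_distr)

lemma tensor_smult: "smult \<Omega>M = (\<lambda>b. lift (tensor_group B \<Omega> M) (\<lambda>(w, m). (b \<odot>\<^bsub>\<Omega>\<^esub> w) \<otimes>\<^sub>1 m))"
  by (simp add: tensor_def Let_def)

lemma
  assumes e: "e \<in> carrier B"
  shows additive_T1_smult: "additive_map \<Omega>M \<Omega>M (\<lambda>t. e \<odot>\<^bsub>\<Omega>M\<^esub> t)" (is ?A)
    and T1_smult_pure: "\<lbrakk>\<omega> \<in> carrier \<Omega>; m \<in> carrier M\<rbrakk> \<Longrightarrow> e \<odot>\<^bsub>\<Omega>M\<^esub> (\<omega> \<otimes>\<^sub>1 m) = (e \<odot>\<^bsub>\<Omega>\<^esub> \<omega>) \<otimes>\<^sub>1 m"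
       (is "\<lbrakk>_; _\<rbrakk> \<Longrightarrow> ?B")
proof -
  let ?T = "tensor_group B \<Omega> M"
  have T: "carrier \<Omega>M = carrier ?T" "\<zero>\<^bsub>\<Omega>M\<^esub> = \<zero>\<^bsub>?T\<^esub>" "add \<Omega>M = add ?T"
    by (simp_all add: tensor_def Let_def)
  have ag: "abelian_group ?T" by (rule abelian_group_cong[OF T1.abelian_group_tensor]) (simp_all add: T)
  note simps = T1.pure_closed[unfolded T] T1.pure_add_left[unfolded T] T1.pure_add_right[unfolded T]
     form_smult_closed[OF e] additive_map_add[OF additive_form_smult[OF e]]
     form_smult_rsmult[OF e] T1.pure_balanced
  have "additive_map \<Omega>M ?T (lift ?T (\<lambda>(w, m). (e \<odot>\<^bsub>\<Omega>\<^esub> w) \<otimes>\<^sub>1 m))"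
    by (rule T1.additive_tensor_lift[OF ag]) (simp_all add: simps)
  then show ?A by (simp add: additive_map_def T tensor_smult)
  assume "\<omega> \<in> carrier \<Omega>" "m \<in> carrier M"
  then have "lift ?T (\<lambda>(w, m). (e \<odot>\<^bsub>\<Omega>\<^esub> w) \<otimes>\<^sub>1 m) (\<omega> \<otimes>\<^sub>1 m) = (e \<odot>\<^bsub>\<Omega>\<^esub> \<omega>) \<otimes>\<^sub>1 m"
    by (intro T1.tensor_lift_pure[OF ag]) (simp_all add: simps)
  then show ?B by (simp add: tensor_smult)
qed

lemma T1_smult_closed: "\<lbrakk>e \<in> carrier B; t \<in> carrier \<Omega>M\<rbrakk> \<Longrightarrow> e \<odot>\<^bsub>\<Omega>M\<^esub> t \<in> carrier \<Omega>M"
  using additive_map_closed[OF additive_T1_smult] .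

abbreviation \<kappa> where "\<kappa> \<equiv> contraction_id B M"

lemma
  assumes f: "f \<in> carrier (Der_lie K B)"
  shows additive_contraction_id: "additive_map \<Omega>M M (\<kappa> f)" (is ?A)
    and contraction_id_pure: "\<lbrakk>\<omega> \<in> carrier \<Omega>; m \<in> carrier M\<rbrakk> \<Longrightarrow> \<kappa> f (\<omega> \<otimes>\<^sub>1 m) = contraction B f \<omega> \<odot>\<^bsub>M\<^esub> m"
       (is "\<lbrakk>_; _\<rbrakk> \<Longrightarrow> ?B")
proof -
  note simps = contraction_closed[OF f] additive_map_add[OF additive_contraction[OF f]]
    L.smult_closed L.smult_l_distr L.smult_r_distr L.smult_assoc contraction_rsmult[OF f]
  show ?A unfolding contraction_id_def
    by (rule T1.additive_tensor_lift[OF L.M.abelian_group_axioms]) (simp_all add: simps)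
  assume "\<omega> \<in> carrier \<Omega>" "m \<in> carrier M"
  then show ?B unfolding contraction_id_def
    by (intro T1.tensor_lift_pure[OF L.M.abelian_group_axioms]) (simp_all add: simps)
qed

lemma contraction_id_closed: "\<lbrakk>f \<in> carrier (Der_lie K B); t \<in> carrier \<Omega>M\<rbrakk> \<Longrightarrow> \<kappa> f t \<in> carrier M"
  using additive_map_closed[OF additive_contraction_id] .

lemma contraction_id_smult:
  assumes f: "f \<in> carrier (Der_lie K B)" and e: "e \<in> carrier B" and t: "t \<in> carrier \<Omega>M"
  shows "\<kappa> f (e \<odot>\<^bsub>\<Omega>M\<^esub> t) = e \<odot>\<^bsub>M\<^esub> \<kappa> f t"
  by (rule T1.tensor_map_eqI[OF L.M.abelian_group_axioms
     additive_map_comp[OF additive_T1_smult[OF e] additive_contraction_id[OF f]]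
     additive_map_comp[OF additive_contraction_id[OF f] additive_act[OF e]] _ t])
   (use e in \<open>simp_all add: contraction_id_pure[OF f] T1_smult_pure form_smult_closed contraction_smult[OF f]
      contraction_closed[OF f] L.smult_assoc\<close>)

text \<open>
  The form of the induction used for identities in \<open>\<Omega>\<^sup>1B \<otimes>\<^sub>B M\<close>: it passes from tensors to forms and
  from forms to generators at once.
\<close>

lemma T1_map_eqI:
  assumes G: "abelian_group G" and h: "additive_map \<Omega>M G h" "additive_map \<Omega>M G h'"
    and gen: "\<And>a b c m. \<lbrakk>a \<in> carrier B; b \<in> carrier B; c \<in> carrier B; m \<in> carrier M\<rbrakk>
       \<Longrightarrow> h (fg a b c \<otimes>\<^sub>1 m) = h' (fg a b c \<otimes>\<^sub>1 m)"
    and t: "t \<in> carrier \<Omega>M"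
  shows "h t = h' t"
proof (rule T1.tensor_map_eqI[OF G h _ t])
  fix \<omega> m assume \<omega>: "\<omega> \<in> carrier \<Omega>" and m: "m \<in> carrier M"
  have "additive_map \<Omega> \<Omega>M (\<lambda>\<omega>. \<omega> \<otimes>\<^sub>1 m)"
    using m by (intro additive_mapI) (auto simp: T1.pure_closed T1.pure_add_left)
  note add = additive_map_comp[OF this]
  show "h (\<omega> \<otimes>\<^sub>1 m) = h' (\<omega> \<otimes>\<^sub>1 m)"
    by (rule form_map_eqI[OF G add[OF h(1)] add[OF h(2)] _ \<omega>]) (use m gen in auto)
qed

abbreviation ft where "ft \<equiv> form_times K B M"

lemma
  assumes \<omega>: "\<omega> \<in> carrier \<Omega>"
  shows additive_form_times: "additive_map \<Omega>M \<Omega>2M (ft \<omega>)" (is ?A)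
    and form_times_pure: "\<lbrakk>\<eta> \<in> carrier \<Omega>; m \<in> carrier M\<rbrakk> \<Longrightarrow> ft \<omega> (\<eta> \<otimes>\<^sub>1 m) = (\<omega> \<otimes>\<Omega> \<eta>) \<otimes>\<^sub>2 m"
       (is "\<lbrakk>_; _\<rbrakk> \<Longrightarrow> ?B")
proof -
  note simps = \<omega> T2.pure_closed wedge_closed T2.pure_add_left T2.pure_add_right
     wedge_add_right Omega2_rsmult_wedge[symmetric] T2.pure_balanced
  show ?A unfolding form_times_def
    by (rule T1.additive_tensor_lift[OF T2.abelian_group_tensor]) (simp_all add: simps)
  assume "\<eta> \<in> carrier \<Omega>" "m \<in> carrier M"
  then show ?B unfolding form_times_def
    by (intro T1.tensor_lift_pure[OF T2.abelian_group_tensor]) (simp_all add: simps)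
qed

lemma form_times_closed: "\<lbrakk>\<omega> \<in> carrier \<Omega>; t \<in> carrier \<Omega>M\<rbrakk> \<Longrightarrow> ft \<omega> t \<in> carrier \<Omega>2M"
  using additive_map_closed[OF additive_form_times] .

lemma form_times_add_left:
  assumes \<omega>: "\<omega> \<in> carrier \<Omega>" "\<omega>' \<in> carrier \<Omega>" and t: "t \<in> carrier \<Omega>M"
  shows "ft (\<omega> \<oplus>\<^bsub>\<Omega>\<^esub> \<omega>') t = ft \<omega> t \<oplus>\<^bsub>\<Omega>2M\<^esub> ft \<omega>' t"
proof -
  interpret W: abelian_group \<Omega> by (rule abelian_group_Omega1)
  interpret Z: abelian_group \<Omega>2M by (rule T2.abelian_group_tensor)
  show ?thesis
    by (rule T1.tensor_map_eqI[OF Z.abelian_group_axioms additive_form_times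
          Z.additive_map_comb(1)[OF additive_form_times additive_form_times] _ t])
      (use \<omega> in \<open>auto simp: form_times_pure wedge_add_left T2.pure_add_left wedge_closed\<close>)
qed

lemma form_times_rsmult:
  assumes \<omega>: "\<omega> \<in> carrier \<Omega>" and e: "e \<in> carrier B" and t: "t \<in> carrier \<Omega>M"
  shows "ft (rsmult \<Omega> \<omega> e) t = ft \<omega> (e \<odot>\<^bsub>\<Omega>M\<^esub> t)"
  by (rule T1.tensor_map_eqI[OF T2.abelian_group_tensor additive_form_times
        additive_map_comp[OF additive_T1_smult[OF e] additive_form_times] _ t])
    (use \<omega> e in \<open>auto simp: form_times_pure form_rsmult_closed form_smult_closed T1_smult_pure wedge_balanced\<close>)

text \<open>
  The contraction \<open>i\<^sub>f \<otimes> i\<^sub>g \<otimes> id\<^sub>M\<close>, through which elements of \<open>\<Omega>\<^sup>2B \<otimes>\<^sub>B M\<close> are tested.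
\<close>

definition contraction2_id where
  "contraction2_id f g = lift M (\<lambda>(\<eta>, m). contraction2 f g \<eta> \<odot>\<^bsub>M\<^esub> m)"

lemma
  assumes f: "f \<in> carrier (Der_lie K B)" and g: "g \<in> carrier (Der_lie K B)"
  shows additive_contraction2_id: "additive_map \<Omega>2M M (contraction2_id f g)" (is ?A)
    and contraction2_id_pure: "\<lbrakk>\<eta> \<in> carrier \<Omega>2; m \<in> carrier M\<rbrakk>
      \<Longrightarrow> contraction2_id f g (\<eta> \<otimes>\<^sub>2 m) = contraction2 f g \<eta> \<odot>\<^bsub>M\<^esub> m" (is "\<lbrakk>_; _\<rbrakk> \<Longrightarrow> ?B")
proof -
  note simps = additive_map_closed[OF additive_contraction2[OF f g]] additive_map_add[OF additive_contraction2[OF f g]]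
    L.smult_closed L.smult_l_distr L.smult_r_distr L.smult_assoc contraction2_rsmult[OF f g]
  show ?A unfolding contraction2_id_def
    by (rule T2.additive_tensor_lift[OF L.M.abelian_group_axioms]) (simp_all add: simps)
  assume "\<eta> \<in> carrier \<Omega>2" "m \<in> carrier M"
  then show ?B unfolding contraction2_id_def
    by (intro T2.tensor_lift_pure[OF L.M.abelian_group_axioms]) (simp_all add: simps)
qed

lemma contraction2_id_form_times:
  assumes f: "f \<in> carrier (Der_lie K B)" and g: "g \<in> carrier (Der_lie K B)"
    and \<omega>: "\<omega> \<in> carrier \<Omega>" and t: "t \<in> carrier \<Omega>M"
  shows "contraction2_id f g (ft \<omega> t) = contraction B f \<omega> \<odot>\<^bsub>M\<^esub> \<kappa> g t"
  by (rule T1.tensor_map_eqI[OF L.M.abelian_group_axioms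
     additive_map_comp[OF additive_form_times[OF \<omega>] additive_contraction2_id[OF f g]]
     additive_map_comp[OF additive_contraction_id[OF g] additive_act[OF contraction_closed[OF f \<omega>]]] _ t])
   (use \<omega> in \<open>simp_all add: form_times_pure contraction2_id_pure[OF f g] wedge_closed contraction2_wedge[OF f g]
      contraction_id_pure[OF g] contraction_closed[OF f] contraction_closed[OF g] L.smult_assoc\<close>)

end

locale module_connection = algebra_module +
  fixes nabla
  assumes conn: "connection K B M nabla"
begin

lemma nabla_closed: "m \<in> carrier M \<Longrightarrow> nabla m \<in> carrier \<Omega>M"
  and nabla_add: "\<lbrakk>m \<in> carrier M; m' \<in> carrier M\<rbrakk> \<Longrightarrow> nabla (m \<oplus>\<^bsub>M\<^esub> m') = nabla m \<oplus>\<^bsub>\<Omega>M\<^esub> nabla m'"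
  and nabla_smult: "\<lbrakk>b \<in> carrier B; m \<in> carrier M\<rbrakk>
     \<Longrightarrow> nabla (b \<odot>\<^bsub>M\<^esub> m) = d b \<otimes>\<^sub>1 m \<oplus>\<^bsub>\<Omega>M\<^esub> b \<odot>\<^bsub>\<Omega>M\<^esub> nabla m"
  using conn by (auto simp: connection_def Let_def linear_map_def restrict_scalars_def)

lemma additive_nabla: "additive_map M \<Omega>M nabla"
  by (rule additive_mapI) (auto simp: nabla_closed nabla_add)

abbreviation ext where "ext \<equiv> connection_ext K B M nabla"

text \<open>
  The formula \<open>\<omega> \<otimes> m \<mapsto> d\<omega> \<otimes> m - \<omega> \<nabla>(m)\<close> is balanced because the term \<open>- \<omega> \<otimes> db \<otimes> m\<close> arises on both
  sides: from \<open>d(\<omega>b)\<close> on one, from \<open>\<nabla>(bm)\<close> on the other.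
\<close>

lemma
  shows additive_connection_ext: "additive_map \<Omega>M \<Omega>2M ext" (is ?A)
    and connection_ext_pure: "\<lbrakk>\<omega> \<in> carrier \<Omega>; m \<in> carrier M\<rbrakk>
       \<Longrightarrow> ext (\<omega> \<otimes>\<^sub>1 m) = d1 K B \<omega> \<otimes>\<^sub>2 m \<ominus>\<^bsub>\<Omega>2M\<^esub> ft \<omega> (nabla m)" (is "\<lbrakk>_; _\<rbrakk> \<Longrightarrow> ?B")
proof -
  interpret Z: abelian_group \<Omega>2M by (rule T2.abelian_group_tensor)
  interpret W: abelian_group \<Omega>2 by (rule abelian_group_Omega2)
  let ?g = "\<lambda>\<omega> m. d1 K B \<omega> \<otimes>\<^sub>2 m \<ominus>\<^bsub>\<Omega>2M\<^esub> ft \<omega> (nabla m)"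
  note closed = additive_map_closed[OF additive_d1] T2.pure_closed nabla_closed form_times_closed
    T1.pure_closed d_closed wedge_closed L.smult_closed form_rsmult_closed Omega2_rsmult_closed T1_smult_closed
  have cl: "?g \<omega> m \<in> carrier \<Omega>2M" if "\<omega> \<in> carrier \<Omega>" "m \<in> carrier M" for \<omega> m
    using that by (simp add: closed)
  have al: "?g (\<omega> \<oplus>\<^bsub>\<Omega>\<^esub> \<omega>') m = ?g \<omega> m \<oplus>\<^bsub>\<Omega>2M\<^esub> ?g \<omega>' m"
    if "\<omega> \<in> carrier \<Omega>" "\<omega>' \<in> carrier \<Omega>" "m \<in> carrier M" for \<omega> \<omega>' m
    using that by (simp add: closed additive_map_add[OF additive_d1] T2.pure_add_left form_times_add_left
       Z.minus_add_interchange)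
  have ar: "?g \<omega> (m \<oplus>\<^bsub>M\<^esub> m') = ?g \<omega> m \<oplus>\<^bsub>\<Omega>2M\<^esub> ?g \<omega> m'"
    if "\<omega> \<in> carrier \<Omega>" "m \<in> carrier M" "m' \<in> carrier M" for \<omega> m m'
    using that by (simp add: closed nabla_add T2.pure_add_right additive_map_add[OF additive_form_times]
       Z.minus_add_interchange)
  have ba: "?g (rsmult \<Omega> \<omega> b) m = ?g \<omega> (b \<odot>\<^bsub>M\<^esub> m)"
    if h: "\<omega> \<in> carrier \<Omega>" "b \<in> carrier B" "m \<in> carrier M" for \<omega> b m
  proof -
    have add: "additive_map \<Omega>2 \<Omega>2M (\<lambda>\<eta>. \<eta> \<otimes>\<^sub>2 m)"
      using h by (intro additive_mapI) (auto simp: T2.pure_closed T2.pure_add_left)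
    have "d1 K B (rsmult \<Omega> \<omega> b) \<otimes>\<^sub>2 m = d1 K B \<omega> \<otimes>\<^sub>2 (b \<odot>\<^bsub>M\<^esub> m) \<ominus>\<^bsub>\<Omega>2M\<^esub> (\<omega> \<otimes>\<Omega> d b) \<otimes>\<^sub>2 m"
      using h by (simp add: d1_rsmult closed additive_map_minus[OF abelian_group_Omega2 T2.abelian_group_tensor add]
           T2.pure_balanced)
    moreover have "ft \<omega> (nabla (b \<odot>\<^bsub>M\<^esub> m)) = (\<omega> \<otimes>\<Omega> d b) \<otimes>\<^sub>2 m \<oplus>\<^bsub>\<Omega>2M\<^esub> ft (rsmult \<Omega> \<omega> b) (nabla m)"
      using h by (simp add: nabla_smult additive_map_add[OF additive_form_times] closed form_times_pure form_times_rsmult)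
    ultimately show ?thesis
      using h by (simp add: closed a_minus_def Z.minus_add Z.a_assoc)
  qed
  show ?A unfolding connection_ext_def Let_def
    by (rule T1.additive_tensor_lift[OF T2.abelian_group_tensor cl al ar ba])
  show "\<lbrakk>\<omega> \<in> carrier \<Omega>; m \<in> carrier M\<rbrakk> \<Longrightarrow> ?B" unfolding connection_ext_def Let_def
    by (rule T1.tensor_lift_pure[OF T2.abelian_group_tensor cl al ar ba])
qed

text \<open>
  The operator \<open>(i\<^sub>f \<otimes> id\<^sub>M) \<circ> \<nabla>\<close>, a covariant derivative along the derivation \<open>f\<close> of \<open>B\<close>.
\<close>

definition covariant ("\<nabla>") where "\<nabla> f m = \<kappa> f (nabla m)"

lemma covariant_closed: "\<lbrakk>f \<in> carrier (Der_lie K B); m \<in> carrier M\<rbrakk> \<Longrightarrow> \<nabla> f m \<in> carrier M"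
  by (simp add: covariant_def nabla_closed contraction_id_closed)

lemma additive_covariant: "f \<in> carrier (Der_lie K B) \<Longrightarrow> additive_map M M (\<nabla> f)"
  unfolding covariant_def by (rule additive_map_comp[OF additive_nabla additive_contraction_id])

lemma contraction_id_d:
  assumes f: "f \<in> carrier (Der_lie K B)" and "b \<in> carrier B" "m \<in> carrier M"
  shows "\<kappa> f (d b \<otimes>\<^sub>1 m) = f b \<odot>\<^bsub>M\<^esub> m"
  using assms by (simp add: contraction_id_pure[OF f] d_closed) (simp add: d0_def contraction_gen[OF f] Der_closed[OF f])

lemma covariant_smult:
  assumes f: "f \<in> carrier (Der_lie K B)" and b: "b \<in> carrier B" and m: "m \<in> carrier M"
  shows "\<nabla> f (b \<odot>\<^bsub>M\<^esub> m) = f b \<odot>\<^bsub>M\<^esub> m \<oplus>\<^bsub>M\<^esub> b \<odot>\<^bsub>M\<^esub> \<nabla> f m"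
  using assms unfolding covariant_def
  by (simp add: nabla_smult additive_map_add[OF additive_contraction_id[OF f]] T1.pure_closed d_closed
     T1_smult_closed nabla_closed contraction_id_d contraction_id_smult[OF f])

text \<open>
  For \<open>t = a db c \<otimes> m\<close> the derivation rule gives
  \<open>\<nabla>\<^sub>f (i\<^sub>g t) = f(a) g(b) c m + a f(g(b)) c m + a g(b) f(c) m + a g(b) c \<nabla>\<^sub>f m\<close>, while the double
  contraction of \<open>\<nabla>t\<close> is \<open>f(a) g(b) c m - a f(b) g(c) m - a f(b) c \<nabla>\<^sub>g m\<close>. The difference of the two is
  symmetric in \<open>f, g\<close> up to the term \<open>a f(g(b)) c m\<close>, whose antisymmetrisation is \<open>i\<^sub>h t\<close>.
  Stating this for every \<open>t\<close>, rather than for \<open>\<nabla> m\<close>, reduces it to such \<open>t\<close> by additivity.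
\<close>

lemma curvature_identity:
  assumes f: "f \<in> carrier (Der_lie K B)" and g: "g \<in> carrier (Der_lie K B)" and h: "h \<in> carrier (Der_lie K B)"
    and hfg: "\<And>b. b \<in> carrier B \<Longrightarrow> h b = f (g b) \<ominus>\<^bsub>B\<^esub> g (f b)"
    and t: "t \<in> carrier \<Omega>M"
  shows "\<nabla> f (\<kappa> g t) \<ominus>\<^bsub>M\<^esub> \<nabla> g (\<kappa> f t) \<ominus>\<^bsub>M\<^esub> \<kappa> h t =
     contraction2_id f g (ext t) \<ominus>\<^bsub>M\<^esub> contraction2_id g f (ext t)"
proof (rule T1_map_eqI[OF L.M.abelian_group_axioms _ _ _ t])
  show "additive_map \<Omega>M M (\<lambda>t. \<nabla> f (\<kappa> g t) \<ominus>\<^bsub>M\<^esub> \<nabla> g (\<kappa> f t) \<ominus>\<^bsub>M\<^esub> \<kappa> h t)"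
    by (intro L.M.additive_map_comb additive_map_comp[OF additive_contraction_id additive_covariant]
      additive_contraction_id f g h)
  show "additive_map \<Omega>M M (\<lambda>t. contraction2_id f g (ext t) \<ominus>\<^bsub>M\<^esub> contraction2_id g f (ext t))"
    by (intro L.M.additive_map_comb additive_map_comp[OF additive_connection_ext additive_contraction2_id] f g)
  fix a b c m assume abc: "a \<in> carrier B" "b \<in> carrier B" "c \<in> carrier B" and m: "m \<in> carrier M"
  have cov: "\<nabla> f (\<kappa> g (fg a b c \<otimes>\<^sub>1 m)) =
      (f a \<otimes>\<^bsub>B\<^esub> g b \<otimes>\<^bsub>B\<^esub> c) \<odot>\<^bsub>M\<^esub> m \<oplus>\<^bsub>M\<^esub> (a \<otimes>\<^bsub>B\<^esub> f (g b) \<otimes>\<^bsub>B\<^esub> c) \<odot>\<^bsub>M\<^esub> m \<oplus>\<^bsub>M\<^esub>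
      (a \<otimes>\<^bsub>B\<^esub> g b \<otimes>\<^bsub>B\<^esub> f c) \<odot>\<^bsub>M\<^esub> m \<oplus>\<^bsub>M\<^esub> (a \<otimes>\<^bsub>B\<^esub> g b \<otimes>\<^bsub>B\<^esub> c) \<odot>\<^bsub>M\<^esub> \<nabla> f m"
    if f: "f \<in> carrier (Der_lie K B)" and g: "g \<in> carrier (Der_lie K B)" for f g
    using abc m by (simp add: contraction_id_pure[OF g] form_gen_closed contraction_gen[OF g] covariant_smult[OF f]
       Der_closed[OF f] Der_closed[OF g] Der_mult[OF f] B.l_distr L.smult_l_distr L.smult_closed)
  have cur: "contraction2_id f g (ext (fg a b c \<otimes>\<^sub>1 m)) =
      (f a \<otimes>\<^bsub>B\<^esub> g b \<otimes>\<^bsub>B\<^esub> c) \<odot>\<^bsub>M\<^esub> m \<ominus>\<^bsub>M\<^esub> (a \<otimes>\<^bsub>B\<^esub> f b \<otimes>\<^bsub>B\<^esub> g c) \<odot>\<^bsub>M\<^esub> m \<ominus>\<^bsub>M\<^esub>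
      (a \<otimes>\<^bsub>B\<^esub> f b \<otimes>\<^bsub>B\<^esub> c) \<odot>\<^bsub>M\<^esub> \<nabla> g m"
    if f: "f \<in> carrier (Der_lie K B)" and g: "g \<in> carrier (Der_lie K B)" for f g
    using abc m
    by (simp add: connection_ext_pure form_gen_closed T2.pure_closed form_times_closed nabla_closed
       additive_map_closed[OF additive_d1] contraction2_id_pure[OF f g] contraction2_id_form_times[OF f g]
       additive_map_minus[OF T2.abelian_group_tensor L.M.abelian_group_axioms additive_contraction2_id[OF f g]]
       contraction2_d1[OF f g] contraction_gen[OF f] covariant_def[symmetric]
       additive_map_minus[OF B.is_abelian_group L.M.abelian_group_axioms additive_act_left]
       Der_closed[OF f] Der_closed[OF g])
  have hm: "\<kappa> h (fg a b c \<otimes>\<^sub>1 m) = (a \<otimes>\<^bsub>B\<^esub> f (g b) \<otimes>\<^bsub>B\<^esub> c) \<odot>\<^bsub>M\<^esub> m \<ominus>\<^bsub>M\<^esub> (a \<otimes>\<^bsub>B\<^esub> g (f b) \<otimes>\<^bsub>B\<^esub> c) \<odot>\<^bsub>M\<^esub> m"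
    using abc m
    by (simp add: contraction_id_pure[OF h] form_gen_closed contraction_gen[OF h] hfg
      Der_closed[OF f] Der_closed[OF g]
      additive_map_minus[OF B.is_abelian_group B.is_abelian_group additive_lmult]
      additive_map_minus[OF B.is_abelian_group B.is_abelian_group additive_rmult]
      additive_map_minus[OF B.is_abelian_group L.M.abelian_group_axioms additive_act_left])
  show "\<nabla> f (\<kappa> g (fg a b c \<otimes>\<^sub>1 m)) \<ominus>\<^bsub>M\<^esub> \<nabla> g (\<kappa> f (fg a b c \<otimes>\<^sub>1 m)) \<ominus>\<^bsub>M\<^esub> \<kappa> h (fg a b c \<otimes>\<^sub>1 m) =
     contraction2_id f g (ext (fg a b c \<otimes>\<^sub>1 m)) \<ominus>\<^bsub>M\<^esub> contraction2_id g f (ext (fg a b c \<otimes>\<^sub>1 m))"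
    unfolding cov[OF f g] cov[OF g f] cur[OF f g] cur[OF g f] hm
    using abc m by (intro L.M.curvature_cancel)
     (simp_all add: L.smult_closed Der_closed[OF f] Der_closed[OF g] covariant_closed f g)
qed

lemma flat_covariant:
  assumes flat: "flat K B M nabla"
    and f: "f \<in> carrier (Der_lie K B)" and g: "g \<in> carrier (Der_lie K B)" and h: "h \<in> carrier (Der_lie K B)"
    and hfg: "\<And>b. b \<in> carrier B \<Longrightarrow> h b = f (g b) \<ominus>\<^bsub>B\<^esub> g (f b)"
    and m: "m \<in> carrier M"
  shows "\<nabla> h m = \<nabla> f (\<nabla> g m) \<ominus>\<^bsub>M\<^esub> \<nabla> g (\<nabla> f m)"
proof -
  have "ext (nabla m) = \<zero>\<^bsub>\<Omega>2M\<^esub>" using flat m by (simp add: flat_def)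
  then have "\<nabla> f (\<nabla> g m) \<ominus>\<^bsub>M\<^esub> \<nabla> g (\<nabla> f m) \<ominus>\<^bsub>M\<^esub> \<nabla> h m = \<zero>\<^bsub>M\<^esub>"
    using curvature_identity[OF f g h hfg nabla_closed[OF m]]
      additive_map_zero[OF T2.abelian_group_tensor L.M.abelian_group_axioms additive_contraction2_id] f g
    by (simp add: covariant_def a_minus_def)
  then show ?thesis
    using f g h m by (subst (asm) L.M.minus_eq_zero_iff) (auto simp: covariant_closed)
qed

end

section \<open>The quotient by commutators\<close>

context assoc_algebra
begin

abbreviation Cm where "Cm \<equiv> commutator_space K B"
abbreviation cc where "cc \<equiv> cyc_class K B"

lemma submodule_commutator_space: "submodule Cm K B"
proof -
  note E = submoduleE
  let ?\<N> = "{N. submodule N K B \<and>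
         (\<forall>a\<in>carrier B. \<forall>b\<in>carrier B. a \<otimes>\<^bsub>B\<^esub> b \<ominus>\<^bsub>B\<^esub> b \<otimes>\<^bsub>B\<^esub> a \<in> N)}"
  have ne: "carrier B \<in> ?\<N>" using carrier_is_submodule by auto
  show ?thesis
    unfolding commutator_space_def
  proof (rule submoduleI)
    show "\<Inter>?\<N> \<subseteq> carrier B" using ne by blast
    show "\<zero>\<^bsub>B\<^esub> \<in> \<Inter>?\<N>"
    proof (rule InterI)
      fix N assume "N \<in> ?\<N>"
      then have N: "submodule N K B" by auto
      obtain x where x: "x \<in> N" using E(2)[OF N] by auto
      then show "\<zero>\<^bsub>B\<^esub> \<in> N"
        using E(5)[OF N x E(3)[OF N x]] E(1)[OF N] M.r_neg[of x] by auto
    qed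
  next
    fix a assume "a \<in> \<Inter>?\<N>"
    then show "\<ominus>\<^bsub>B\<^esub> a \<in> \<Inter>?\<N>" using E(3) by blast
  next
    fix a b assume "a \<in> \<Inter>?\<N>" "b \<in> \<Inter>?\<N>"
    then show "a \<oplus>\<^bsub>B\<^esub> b \<in> \<Inter>?\<N>" using E(5) by blast
  next
    fix k a assume "k \<in> carrier K" "a \<in> \<Inter>?\<N>"
    then show "k \<odot>\<^bsub>B\<^esub> a \<in> \<Inter>?\<N>" using E(4) by blast
  qed
qed

lemma commutator_in_Cm: "\<lbrakk>a \<in> carrier B; b \<in> carrier B\<rbrakk> \<Longrightarrow> a \<otimes>\<^bsub>B\<^esub> b \<ominus>\<^bsub>B\<^esub> b \<otimes>\<^bsub>B\<^esub> a \<in> Cm"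
  by (auto simp: commutator_space_def)

lemma Cm_least:
  "\<lbrakk>submodule N K B; \<And>a b. \<lbrakk>a \<in> carrier B; b \<in> carrier B\<rbrakk> \<Longrightarrow> a \<otimes>\<^bsub>B\<^esub> b \<ominus>\<^bsub>B\<^esub> b \<otimes>\<^bsub>B\<^esub> a \<in> N\<rbrakk> \<Longrightarrow> Cm \<subseteq> N"
  by (auto simp: commutator_space_def)

lemmas Cm_props = submoduleE[OF submodule_commutator_space]

sublocale Cm: abelian_subgroup Cm B
  by (rule abelian_subgroupI3)
    (use submodule.axioms(1)[OF submodule_commutator_space] B.is_abelian_group in \<open>auto intro: additive_subgroup.intro\<close>)

lemma cyc_carrier: "carrier (cyc K B) = cc ` carrier B"
  by (auto simp: cyc_def cyc_class_def A_RCOSETS_def RCOSETS_def a_r_coset_def)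

lemma cc_closed: "b \<in> carrier B \<Longrightarrow> cc b \<in> carrier (cyc K B)"
  by (auto simp: cyc_carrier)

lemma cc_add: "\<lbrakk>a \<in> carrier B; b \<in> carrier B\<rbrakk> \<Longrightarrow> cc (a \<oplus>\<^bsub>B\<^esub> b) = cc a \<oplus>\<^bsub>cyc K B\<^esub> cc b"
  by (simp add: cyc_def cyc_class_def Cm.a_rcos_sum)

lemma additive_cc: "additive_map B (cyc K B) cc"
  by (rule additive_mapI) (auto simp: cc_closed cc_add)

lemma abelian_group_cyc: "abelian_group (cyc K B)"
proof -
  note * = comm_groupE[OF Cm.a_factorgroup_is_comm_group, unfolded A_FactGroup_def', simplified]
  show ?thesis using * by (intro abelian_groupI) (simp_all add: cyc_def)
qed

lemma cc_eqI:
  assumes "a \<in> carrier B" "b \<in> carrier B" "a \<ominus>\<^bsub>B\<^esub> b \<in> Cm"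
  shows "cc a = cc b"
proof -
  have "a \<in> Cm +>\<^bsub>B\<^esub> b" using Cm.a_rcos_module_minus[OF B.ring_axioms, of b a] assms by simp
  then show ?thesis unfolding cyc_class_def
    using Cm.a_repr_independence'[of a b] assms by simp
qed

lemma cc_commute: "\<lbrakk>a \<in> carrier B; b \<in> carrier B\<rbrakk> \<Longrightarrow> cc (a \<otimes>\<^bsub>B\<^esub> b) = cc (b \<otimes>\<^bsub>B\<^esub> a)"
  by (rule cc_eqI) (auto simp: commutator_in_Cm)

text \<open>
  An additive map that preserves the span of commutators induces a map on \<open>|B|\<close>; both the scalar
  multiplication of \<open>|B|\<close> and the action of derivations on it are defined in this way.
\<close>

lemma cc_descend:
  assumes h: "additive_map B B h" "\<And>b. b \<in> Cm \<Longrightarrow> h b \<in> Cm" and b: "b \<in> carrier B"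
  shows "the_elem ((\<lambda>b. cc (h b)) ` cc b) = cc (h b)"
proof -
  have "cc (h b') = cc (h b)" if "b' \<in> cc b" for b'
  proof (rule cc_eqI)
    have b': "b' \<in> carrier B"
      using that b Cm.a_elemrcos_carrier by (auto simp: cyc_class_def)
    have "b' \<ominus>\<^bsub>B\<^esub> b \<in> Cm" using that Cm.a_rcos_module_minus[OF B.ring_axioms, of b b'] b b' by (simp add: cyc_class_def)
    then show "h b' \<ominus>\<^bsub>B\<^esub> h b \<in> Cm"
      using h(2) additive_map_minus[OF B.is_abelian_group B.is_abelian_group h(1) b' b] by metis
    show "h b' \<in> carrier B" "h b \<in> carrier B" using additive_map_closed[OF h(1)] b b' by auto
  qed
  moreover have "b \<in> cc b" using Cm.a_rcos_self b by (simp add: cyc_class_def)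
  ultimately have "(\<lambda>b. cc (h b)) ` cc b = {cc (h b)}" by blast
  then show ?thesis by simp
qed

lemma additive_smult: "k \<in> carrier K \<Longrightarrow> additive_map B B (\<lambda>b. k \<odot>\<^bsub>B\<^esub> b)"
  by (rule additive_mapI) (auto simp: smult_r_distr)

lemma cc_smult: "\<lbrakk>k \<in> carrier K; b \<in> carrier B\<rbrakk> \<Longrightarrow> k \<odot>\<^bsub>cyc K B\<^esub> cc b = cc (k \<odot>\<^bsub>B\<^esub> b)"
  using cc_descend[OF additive_smult[of k]] Cm_props(4) by (simp add: cyc_def)

lemma additive_cyc_smult:
  assumes "k \<in> carrier K" shows "additive_map (cyc K B) (cyc K B) (\<lambda>v. k \<odot>\<^bsub>cyc K B\<^esub> v)"
  using assms by (intro additive_mapI) (auto simp: cyc_carrier cc_smult cc_add[symmetric] smult_r_distr)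

text \<open>
  A derivation sends \<open>[a, b]\<close> to \<open>[f(a), b] + [a, f(b)]\<close>.
\<close>

lemma Der_Cm:
  assumes f: "f \<in> carrier (Der_lie K B)" and b: "b \<in> Cm"
  shows "f b \<in> Cm"
proof -
  note fz = additive_map_zero[OF B.is_abelian_group B.is_abelian_group additive_Der[OF f]]
    additive_map_inv[OF B.is_abelian_group B.is_abelian_group additive_Der[OF f]]
    additive_map_minus[OF B.is_abelian_group B.is_abelian_group additive_Der[OF f]]
  let ?N = "{b \<in> carrier B. f b \<in> Cm}"
  have "Cm \<subseteq> ?N"
  proof (rule Cm_least)
    show "submodule ?N K B"
      by (rule submoduleI)
       (use Cm_props Cm.zero_closed in \<open>auto simp: fz Der_add[OF f] Der_smult[OF f]\<close>)
    fix a b assume ab: "a \<in> carrier B" "b \<in> carrier B"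
    note cl = ab Der_closed[OF f ab(1)] Der_closed[OF f ab(2)]
    have "f (a \<otimes>\<^bsub>B\<^esub> b \<ominus>\<^bsub>B\<^esub> b \<otimes>\<^bsub>B\<^esub> a) =
        (f a \<otimes>\<^bsub>B\<^esub> b \<ominus>\<^bsub>B\<^esub> b \<otimes>\<^bsub>B\<^esub> f a) \<oplus>\<^bsub>B\<^esub> (a \<otimes>\<^bsub>B\<^esub> f b \<ominus>\<^bsub>B\<^esub> f b \<otimes>\<^bsub>B\<^esub> a)"
      using cl by (simp add: fz Der_mult[OF f]) (simp add: a_minus_def M.minus_add M.a_ac)
    moreover have "\<dots> \<in> Cm" using cl by (intro Cm_props(5) commutator_in_Cm)
    ultimately show "a \<otimes>\<^bsub>B\<^esub> b \<ominus>\<^bsub>B\<^esub> b \<otimes>\<^bsub>B\<^esub> a \<in> ?N" using ab by simp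
  qed
  then show ?thesis using b by auto
qed

abbreviation act where "act f C \<equiv> the_elem ((\<lambda>b. cc (f b)) ` C)"

lemma act_cc: "\<lbrakk>f \<in> carrier (Der_lie K B); b \<in> carrier B\<rbrakk> \<Longrightarrow> act f (cc b) = cc (f b)"
  by (rule cc_descend[OF additive_Der Der_Cm])

lemma additive_act_cyc:
  assumes "f \<in> carrier (Der_lie K B)" shows "additive_map (cyc K B) (cyc K B) (act f)"
  using assms
  by (intro additive_mapI) (auto simp: cyc_carrier act_cc cc_add[symmetric] Der_add Der_closed)

text \<open>
  The characteristic of \<open>\<K>\<close> enters here: \<open>v\<close> is recovered from \<open>2v\<close> by the inverse of \<open>1 + 1\<close> in \<open>\<K>\<close>.
\<close>

lemma cyc_no_2_torsion:
  assumes K: "field K" and two: "\<one>\<^bsub>K\<^esub> \<oplus>\<^bsub>K\<^esub> \<one>\<^bsub>K\<^esub> \<noteq> \<zero>\<^bsub>K\<^esub>"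
    and v: "v \<in> carrier (cyc K B)" "v \<oplus>\<^bsub>cyc K B\<^esub> v = \<zero>\<^bsub>cyc K B\<^esub>"
  shows "v = \<zero>\<^bsub>cyc K B\<^esub>"
proof -
  interpret K: field K by fact
  obtain b where b: "b \<in> carrier B" "v = cc b" using v by (auto simp: cyc_carrier)
  have z: "cc \<zero>\<^bsub>B\<^esub> = \<zero>\<^bsub>cyc K B\<^esub>"
    by (rule additive_map_zero[OF B.is_abelian_group abelian_group_cyc additive_cc])
  let ?t = "\<one>\<^bsub>K\<^esub> \<oplus>\<^bsub>K\<^esub> \<one>\<^bsub>K\<^esub>"
  have t: "?t \<in> Units K" using two by (simp add: K.field_Units)
  have "cc (b \<oplus>\<^bsub>B\<^esub> b) = cc \<zero>\<^bsub>B\<^esub>" using v b z by (simp add: cc_add)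
  then have "cc (?t \<odot>\<^bsub>B\<^esub> b) = cc \<zero>\<^bsub>B\<^esub>" using b by (simp add: smult_l_distr)
  then have "cc (inv\<^bsub>K\<^esub> ?t \<odot>\<^bsub>B\<^esub> (?t \<odot>\<^bsub>B\<^esub> b)) = cc (inv\<^bsub>K\<^esub> ?t \<odot>\<^bsub>B\<^esub> \<zero>\<^bsub>B\<^esub>)"
    using t b cc_smult[of "inv\<^bsub>K\<^esub> ?t"] by (metis R.Units_inv_closed R.Units_closed smult_closed M.zero_closed)
  moreover have "inv\<^bsub>K\<^esub> ?t \<odot>\<^bsub>B\<^esub> (?t \<odot>\<^bsub>B\<^esub> b) = b"
    using t b by (simp add: smult_assoc1[symmetric])
  moreover have "inv\<^bsub>K\<^esub> ?t \<odot>\<^bsub>B\<^esub> \<zero>\<^bsub>B\<^esub> = \<zero>\<^bsub>B\<^esub>" using t by simp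
  ultimately show ?thesis using b z by simp
qed

end

section \<open>Linear endomorphisms and the trace\<close>

lemma abelian_group_pointwise:
  assumes V: "abelian_group V" and C: "C \<subseteq> X \<rightarrow>\<^sub>E carrier V"
    and zero: "(\<lambda>x\<in>X. \<zero>\<^bsub>V\<^esub>) \<in> C"
    and add: "\<And>g h. \<lbrakk>g \<in> C; h \<in> C\<rbrakk> \<Longrightarrow> (\<lambda>x\<in>X. g x \<oplus>\<^bsub>V\<^esub> h x) \<in> C"
    and neg: "\<And>g. g \<in> C \<Longrightarrow> (\<lambda>x\<in>X. \<ominus>\<^bsub>V\<^esub> g x) \<in> C"
  shows "abelian_group (pointwise X V C)"
proof -
  interpret V: abelian_group V by fact
  have cl: "g x \<in> carrier V" if "g \<in> C" "x \<in> X" for g x using C that by (auto simp: PiE_def Pi_def)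
  have ext: "g = (\<lambda>x\<in>X. g x)" if "g \<in> C" for g
    using C that by (intro extensionalityI[of _ X]) (auto simp: PiE_def)
  show ?thesis
  proof (rule abelian_groupI)
    fix g assume g: "g \<in> carrier (pointwise X V C)"
    then have gC: "g \<in> C" by (simp add: pointwise_def)
    have "(\<lambda>x\<in>X. (\<lambda>x\<in>X. \<zero>\<^bsub>V\<^esub>) x \<oplus>\<^bsub>V\<^esub> g x) = (\<lambda>x\<in>X. g x)"
      by (rule restrict_ext) (simp add: cl gC)
    then show "\<zero>\<^bsub>pointwise X V C\<^esub> \<oplus>\<^bsub>pointwise X V C\<^esub> g = g"
      using ext[OF gC] by (simp add: pointwise_def)
    have "(\<lambda>x\<in>X. (\<lambda>x\<in>X. \<ominus>\<^bsub>V\<^esub> g x) x \<oplus>\<^bsub>V\<^esub> g x) = (\<lambda>x\<in>X. \<zero>\<^bsub>V\<^esub>)"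
      by (rule restrict_ext) (simp add: cl gC V.l_neg)
    then show "\<exists>h\<in>carrier (pointwise X V C). h \<oplus>\<^bsub>pointwise X V C\<^esub> g = \<zero>\<^bsub>pointwise X V C\<^esub>"
      using neg[OF gC] by (intro bexI[of _ "\<lambda>x\<in>X. \<ominus>\<^bsub>V\<^esub> g x"]) (simp_all add: pointwise_def)
    fix h assume h: "h \<in> carrier (pointwise X V C)"
    show "g \<oplus>\<^bsub>pointwise X V C\<^esub> h = h \<oplus>\<^bsub>pointwise X V C\<^esub> g"
      using g h by (auto simp: pointwise_def cl V.a_comm intro!: restrict_ext)
  qed (use zero add in \<open>auto simp: pointwise_def cl V.a_assoc intro!: restrict_ext\<close>)
qed

lemma linear_maps_D:
  assumes "h \<in> linear_maps R V W"
  shows "x \<in> carrier V \<Longrightarrow> h x \<in> carrier W"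
    and "\<lbrakk>x \<in> carrier V; y \<in> carrier V\<rbrakk> \<Longrightarrow> h (x \<oplus>\<^bsub>V\<^esub> y) = h x \<oplus>\<^bsub>W\<^esub> h y"
    and "\<lbrakk>r \<in> carrier R; x \<in> carrier V\<rbrakk> \<Longrightarrow> h (r \<odot>\<^bsub>V\<^esub> x) = r \<odot>\<^bsub>W\<^esub> h x"
    and "h \<in> extensional (carrier V)" and "additive_map V W h"
  using assms by (auto simp: linear_maps_def linear_map_def additive_map_def)

lemma restrict_linear_maps:
  assumes "\<And>x. x \<in> carrier V \<Longrightarrow> h x \<in> carrier W"
    and "\<And>x y. \<lbrakk>x \<in> carrier V; y \<in> carrier V\<rbrakk> \<Longrightarrow> h (x \<oplus>\<^bsub>V\<^esub> y) = h x \<oplus>\<^bsub>W\<^esub> h y"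
    and "\<And>r x. \<lbrakk>r \<in> carrier R; x \<in> carrier V\<rbrakk> \<Longrightarrow> h (r \<odot>\<^bsub>V\<^esub> x) = r \<odot>\<^bsub>W\<^esub> h x"
    and "left_module R V"
  shows "(\<lambda>x\<in>carrier V. h x) \<in> linear_maps R V W"
proof -
  interpret V: left_module R V by fact
  show ?thesis using assms(1-3) by (auto simp: linear_maps_def linear_map_def V.smult_closed)
qed

lemma abelian_group_linear_maps:
  assumes V: "left_module R V" and W: "left_module R W"
  shows "abelian_group (pointwise (carrier V) W (linear_maps R V W))"
proof -
  interpret V: left_module R V by fact
  interpret W: left_module R W by fact
  have act: "additive_map W W (\<lambda>x. r \<odot>\<^bsub>W\<^esub> x)" if "r \<in> carrier R" for r
    using that by (intro additive_mapI) (auto simp: W.smult_closed W.smult_r_distr)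
  note ag = W.M.abelian_group_axioms
  show ?thesis
  proof (rule abelian_group_pointwise[OF ag])
    show "linear_maps R V W \<subseteq> carrier V \<rightarrow>\<^sub>E carrier W"
      by (auto simp: linear_maps_def linear_map_def PiE_def)
    show "(\<lambda>x\<in>carrier V. \<zero>\<^bsub>W\<^esub>) \<in> linear_maps R V W"
      using additive_map_zero[OF ag ag act] by (intro restrict_linear_maps V) auto
    fix g h assume g: "g \<in> linear_maps R V W" and h: "h \<in> linear_maps R V W"
    show "(\<lambda>x\<in>carrier V. g x \<oplus>\<^bsub>W\<^esub> h x) \<in> linear_maps R V W"
      using linear_maps_D(1-3)[OF g] linear_maps_D(1-3)[OF h]
      by (intro restrict_linear_maps V) (auto simp: W.M.a_ac W.smult_r_distr)
    show "(\<lambda>x\<in>carrier V. \<ominus>\<^bsub>W\<^esub> g x) \<in> linear_maps R V W"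
      using linear_maps_D(1-3)[OF g] additive_map_inv[OF ag ag act]
      by (intro restrict_linear_maps V) (auto simp: W.M.minus_add)
  qed
qed

lemma left_module_regular:
  assumes "ring B" shows "left_module B (regular B)"
proof -
  interpret B: ring B by fact
  have "abelian_group (regular B)"
    by (rule abelian_group_cong[OF B.is_abelian_group]) (simp_all add: regular_def)
  then show ?thesis
    by (intro left_module.intro left_module_axioms.intro B.ring_axioms)
      (auto simp: regular_def B.l_distr B.r_distr B.m_assoc)
qed

lemma pointwise_simps:
  "carrier (pointwise X V C) = C"
  "g \<oplus>\<^bsub>pointwise X V C\<^esub> h = (\<lambda>x\<in>X. g x \<oplus>\<^bsub>V\<^esub> h x)"
  "\<zero>\<^bsub>pointwise X V C\<^esub> = (\<lambda>x\<in>X. \<zero>\<^bsub>V\<^esub>)"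
  by (simp_all add: pointwise_def)

lemma additive_evaluation:
  assumes "\<And>g. g \<in> C \<Longrightarrow> g x \<in> carrier V" "x \<in> X"
  shows "additive_map (pointwise X V C) V (\<lambda>g. g x)"
  using assms by (intro additive_mapI) (auto simp: pointwise_simps)

context algebra_module
begin

abbreviation Dual where "Dual \<equiv> dual B M"
abbreviation EndM where "EndM \<equiv> linear_maps B M M"
abbreviation E where "E \<equiv> pointwise (carrier M) M EndM"
abbreviation DM where "DM \<equiv> tensor B Dual M"

lemma abelian_group_End: "abelian_group E"
  by (rule abelian_group_linear_maps[OF L.left_module_axioms L.left_module_axioms])

lemma Dual_simps:
  "carrier Dual = linear_maps B M (regular B)"
  "\<mu> \<oplus>\<^bsub>Dual\<^esub> \<nu> = (\<lambda>m\<in>carrier M. \<mu> m \<oplus>\<^bsub>B\<^esub> \<nu> m)"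
  "rsmult Dual \<mu> b = (\<lambda>m\<in>carrier M. \<mu> m \<otimes>\<^bsub>B\<^esub> b)"
  by (simp_all add: dual_def Let_def pointwise_def regular_def)

lemma abelian_group_Dual: "abelian_group Dual"
  by (rule abelian_group_cong[OF abelian_group_linear_maps[OF L.left_module_axioms left_module_regular[OF B.ring_axioms]]])
    (simp_all add: dual_def Let_def pointwise_def)

lemma Dual_D:
  assumes "\<mu> \<in> carrier Dual"
  shows "m \<in> carrier M \<Longrightarrow> \<mu> m \<in> carrier B"
    and "\<lbrakk>m \<in> carrier M; m' \<in> carrier M\<rbrakk> \<Longrightarrow> \<mu> (m \<oplus>\<^bsub>M\<^esub> m') = \<mu> m \<oplus>\<^bsub>B\<^esub> \<mu> m'"
    and "\<lbrakk>b \<in> carrier B; m \<in> carrier M\<rbrakk> \<Longrightarrow> \<mu> (b \<odot>\<^bsub>M\<^esub> m) = b \<otimes>\<^bsub>B\<^esub> \<mu> m"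
    and "\<mu> \<in> extensional (carrier M)" and "additive_map M B \<mu>"
  using linear_maps_D[OF assms[unfolded Dual_simps]] by (simp_all add: regular_def additive_map_def)

lemma restrict_Dual:
  assumes "\<And>x. x \<in> carrier M \<Longrightarrow> h x \<in> carrier B"
    and "\<And>x y. \<lbrakk>x \<in> carrier M; y \<in> carrier M\<rbrakk> \<Longrightarrow> h (x \<oplus>\<^bsub>M\<^esub> y) = h x \<oplus>\<^bsub>B\<^esub> h y"
    and "\<And>r x. \<lbrakk>r \<in> carrier B; x \<in> carrier M\<rbrakk> \<Longrightarrow> h (r \<odot>\<^bsub>M\<^esub> x) = r \<otimes>\<^bsub>B\<^esub> h x"
  shows "(\<lambda>x\<in>carrier M. h x) \<in> carrier Dual"
  unfolding Dual_simps
  by (rule restrict_linear_maps) (use assms L.left_module_axioms in \<open>auto simp: regular_def\<close>)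

lemmas restrict_End = restrict_linear_maps[OF _ _ _ L.left_module_axioms, where W = M]

sublocale TD: tensor_pair B Dual M
  by (rule tensor_pair.intro)
    (auto simp: abelian_group_Dual L.M.abelian_group_axioms L.smult_closed Dual_simps(3) Dual_D B.l_distr B.m_assoc
      intro!: restrict_Dual)

text \<open>
  The image of \<open>\<mu> \<otimes> m\<close> in \<open>End\<^sub>B(M)\<close>.
\<close>

definition rank_one where "rank_one \<mu> m = (\<lambda>x\<in>carrier M. \<mu> x \<odot>\<^bsub>M\<^esub> m)"

lemma rank_one_End: "\<lbrakk>\<mu> \<in> carrier Dual; m \<in> carrier M\<rbrakk> \<Longrightarrow> rank_one \<mu> m \<in> EndM"
  unfolding rank_one_def
  by (rule restrict_End) (auto simp: Dual_D L.smult_closed L.smult_l_distr L.smult_assoc)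

abbreviation \<Phi> where "\<Phi> \<equiv> dual_tensor_to_End B M"

lemma
  shows additive_dual_tensor: "additive_map DM E \<Phi>" (is ?A)
    and dual_tensor_pure: "\<lbrakk>\<mu> \<in> carrier Dual; m \<in> carrier M\<rbrakk> \<Longrightarrow> \<Phi> (pure B Dual M \<mu> m) = rank_one \<mu> m"
      (is "\<lbrakk>_; _\<rbrakk> \<Longrightarrow> ?B")
proof -
  let ?g = "\<lambda>\<mu> m. \<lambda>x\<in>carrier M. \<mu> x \<odot>\<^bsub>M\<^esub> m"
  have cl: "?g \<mu> m \<in> carrier E" if "\<mu> \<in> carrier Dual" "m \<in> carrier M" for \<mu> m
    using rank_one_End[OF that] by (simp add: rank_one_def pointwise_simps)
  have al: "?g (\<mu> \<oplus>\<^bsub>Dual\<^esub> \<nu>) m = ?g \<mu> m \<oplus>\<^bsub>E\<^esub> ?g \<nu> m"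
    if "\<mu> \<in> carrier Dual" "\<nu> \<in> carrier Dual" "m \<in> carrier M" for \<mu> \<nu> m
    using that by (auto simp: pointwise_simps Dual_simps(2) L.smult_l_distr Dual_D(1) intro!: restrict_ext)
  have ar: "?g \<mu> (m \<oplus>\<^bsub>M\<^esub> m') = ?g \<mu> m \<oplus>\<^bsub>E\<^esub> ?g \<mu> m'"
    if "\<mu> \<in> carrier Dual" "m \<in> carrier M" "m' \<in> carrier M" for \<mu> m m'
    using that by (auto simp: pointwise_simps L.smult_r_distr Dual_D(1) intro!: restrict_ext)
  have ba: "?g (rsmult Dual \<mu> b) m = ?g \<mu> (b \<odot>\<^bsub>M\<^esub> m)"
    if "\<mu> \<in> carrier Dual" "b \<in> carrier B" "m \<in> carrier M" for \<mu> b m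
    using that by (auto simp: Dual_simps(3) L.smult_assoc Dual_D(1) intro!: restrict_ext)
  show ?A unfolding dual_tensor_to_End_def
    by (rule TD.additive_tensor_lift[OF abelian_group_End cl al ar ba])
  show "\<lbrakk>\<mu> \<in> carrier Dual; m \<in> carrier M\<rbrakk> \<Longrightarrow> ?B" unfolding dual_tensor_to_End_def rank_one_def
    by (rule TD.tensor_lift_pure[OF abelian_group_End cl al ar ba])
qed

text \<open>
  The map \<open>M\<^sup>* \<otimes>\<^sub>B M \<rightarrow> |B|\<close> that becomes the trace. It is balanced because \<open>|\<mu>(m) b| = |b \<mu>(m)|\<close>.
\<close>

definition eval_class where "eval_class = lift (cyc K B) (\<lambda>(\<mu>, m). cc (\<mu> m))"

lemma
  shows additive_eval_class: "additive_map DM (cyc K B) eval_class" (is ?A)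
    and eval_class_pure: "\<lbrakk>\<mu> \<in> carrier Dual; m \<in> carrier M\<rbrakk> \<Longrightarrow> eval_class (pure B Dual M \<mu> m) = cc (\<mu> m)"
      (is "\<lbrakk>_; _\<rbrakk> \<Longrightarrow> ?B")
proof -
  note simps = cc_closed cc_add[symmetric] Dual_D Dual_simps(2,3) L.M.a_closed cc_commute L.smult_closed
  show ?A unfolding eval_class_def
    by (rule TD.additive_tensor_lift[OF abelian_group_cyc]) (simp_all add: simps)
  assume "\<mu> \<in> carrier Dual" "m \<in> carrier M"
  then show ?B unfolding eval_class_def
    by (intro TD.tensor_lift_pure[OF abelian_group_cyc]) (simp_all add: simps)
qed

end

locale projective_module = algebra_module +
  assumes fgp: "fin_gen_projective B M"
begin

text \<open>
  If \<open>M\<close> is a summand of \<open>B\<^sup>n\<close>, the coordinates of the inclusion and the projections of the standard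
  basis vectors form a dual basis.
\<close>

lemma dual_basis:
  obtains n :: nat and e and x where "\<And>a. a < n \<Longrightarrow> e a \<in> carrier Dual" "\<And>a. a < n \<Longrightarrow> x a \<in> carrier M"
    "\<And>m. m \<in> carrier M \<Longrightarrow> m = (\<Oplus>\<^bsub>M\<^esub>a\<in>{..<n}. e a m \<odot>\<^bsub>M\<^esub> x a)"
proof -
  obtain n i p where i: "linear_map B M (free_module B n) i" and p: "linear_map B (free_module B n) M p"
    and pi: "\<And>m. m \<in> carrier M \<Longrightarrow> p (i m) = m"
    using fgp by (auto simp: fin_gen_projective_def)
  let ?F = "free_module B n"
  have F: "carrier ?F = {..<n} \<rightarrow>\<^sub>E carrier B" "add ?F = (\<lambda>g h. \<lambda>x\<in>{..<n}. g x \<oplus>\<^bsub>B\<^esub> h x)"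
    "smult ?F = (\<lambda>b h. \<lambda>x\<in>{..<n}. b \<otimes>\<^bsub>B\<^esub> h x)"
    by (simp_all add: free_module_def pointwise_def regular_def)
  interpret reg: left_module B "regular B" by (rule left_module_regular[OF B.ring_axioms])
  have reg: "carrier (regular B) = carrier B" by (simp add: regular_def)
  have agF: "abelian_group ?F"
    unfolding free_module_def reg[symmetric]
    by (rule abelian_group_pointwise[OF reg.M.abelian_group_axioms]) auto
  define \<delta> where "\<delta> a = (\<lambda>j\<in>{..<n}. if j = a then \<one>\<^bsub>B\<^esub> else \<zero>\<^bsub>B\<^esub>)" for a :: nat
  have \<delta>: "\<delta> a \<in> carrier ?F" for a by (auto simp: F \<delta>_def)
  have sm: "b \<odot>\<^bsub>?F\<^esub> \<delta> a \<in> carrier ?F" if "b \<in> carrier B" for a b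
    using that by (auto simp: F \<delta>_def)
  have expand: "v = (\<Oplus>\<^bsub>?F\<^esub>a\<in>{..<n}. v a \<odot>\<^bsub>?F\<^esub> \<delta> a)" (is "v = ?s") if v: "v \<in> carrier ?F" for v
  proof (rule PiE_ext)
    interpret F: abelian_group ?F by (rule agF)
    have vc: "a < n \<Longrightarrow> v a \<in> carrier B" for a using v by (auto simp: F)
    have fc: "(\<lambda>a. v a \<odot>\<^bsub>?F\<^esub> \<delta> a) \<in> {..<n} \<rightarrow> carrier ?F" using vc sm by auto
    show "v \<in> {..<n} \<rightarrow>\<^sub>E carrier B" using v by (simp add: F)
    show "?s \<in> {..<n} \<rightarrow>\<^sub>E carrier B" using F.finsum_closed[OF fc] by (simp add: F)
    fix j assume j: "j \<in> {..<n}"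
    have ev: "additive_map ?F B (\<lambda>g. g j)"
      using j by (intro additive_mapI) (auto simp: F)
    have "?s j = (\<Oplus>\<^bsub>B\<^esub>a\<in>{..<n}. (v a \<odot>\<^bsub>?F\<^esub> \<delta> a) j)"
      by (rule additive_map_finsum[OF agF B.is_abelian_group ev fc])
    also have "\<dots> = (\<Oplus>\<^bsub>B\<^esub>a\<in>{..<n}. if j = a then v a else \<zero>\<^bsub>B\<^esub>)"
      using vc j by (intro M.finsum_cong') (auto simp: F \<delta>_def)
    also have "\<dots> = v j" using vc j by (intro M.finsum_singleton) auto
    finally show "v j = ?s j" by simp
  qed
  have addp: "additive_map ?F M p" and addi: "additive_map M ?F i"
    using p i by (auto simp: linear_map_def additive_map_def)
  have im: "i m a \<in> carrier B" if "m \<in> carrier M" "a < n" for m a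
    using additive_map_closed[OF addi that(1)] that(2) by (auto simp: F)
  show ?thesis
  proof (rule that[of n "\<lambda>a. \<lambda>m\<in>carrier M. i m a" "\<lambda>a. p (\<delta> a)"])
    fix a assume a: "a < n"
    show "(\<lambda>m\<in>carrier M. i m a) \<in> carrier Dual"
      using a i im by (intro restrict_Dual) (auto simp: linear_map_def F)
    show "p (\<delta> a) \<in> carrier M" using additive_map_closed[OF addp \<delta>] .
  next
    fix m assume m: "m \<in> carrier M"
    have fc: "(\<lambda>a. i m a \<odot>\<^bsub>?F\<^esub> \<delta> a) \<in> {..<n} \<rightarrow> carrier ?F" using im[OF m] sm by auto
    have "m = p (\<Oplus>\<^bsub>?F\<^esub>a\<in>{..<n}. i m a \<odot>\<^bsub>?F\<^esub> \<delta> a)"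
      using pi[OF m] expand[OF additive_map_closed[OF addi m]] by simp
    also have "\<dots> = (\<Oplus>\<^bsub>M\<^esub>a\<in>{..<n}. p (i m a \<odot>\<^bsub>?F\<^esub> \<delta> a))"
      by (rule additive_map_finsum[OF agF L.M.abelian_group_axioms addp fc])
    also have "\<dots> = (\<Oplus>\<^bsub>M\<^esub>a\<in>{..<n}. (\<lambda>m\<in>carrier M. i m a) m \<odot>\<^bsub>M\<^esub> p (\<delta> a))"
      using p \<delta> m im[OF m] additive_map_closed[OF addp \<delta>]
      by (intro L.M.finsum_cong') (auto simp: linear_map_def L.smult_closed)
    finally show "m = (\<Oplus>\<^bsub>M\<^esub>a\<in>{..<n}. (\<lambda>m\<in>carrier M. i m a) m \<odot>\<^bsub>M\<^esub> p (\<delta> a))" .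
  qed
qed

text \<open>
  A retraction is \<open>h \<mapsto> \<Sum>\<^sub>a (e\<^sub>a \<circ> h) \<otimes> x\<^sub>a\<close> for a dual basis \<open>e\<^sub>a, x\<^sub>a\<close>: on \<open>\<mu> \<otimes> m\<close> it gives
  \<open>\<Sum>\<^sub>a \<mu> e\<^sub>a(m) \<otimes> x\<^sub>a = \<mu> \<otimes> \<Sum>\<^sub>a e\<^sub>a(m) x\<^sub>a = \<mu> \<otimes> m\<close>.
\<close>

lemma dual_tensor_inj: "inj_on \<Phi> (carrier DM)"
proof -
  interpret D: abelian_group DM by (rule TD.abelian_group_tensor)
  interpret E: abelian_group E by (rule abelian_group_End)
  obtain n :: nat and e and x where e: "\<And>a. a < n \<Longrightarrow> e a \<in> carrier Dual" and x: "\<And>a. a < n \<Longrightarrow> x a \<in> carrier M"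
    and ex: "\<And>m. m \<in> carrier M \<Longrightarrow> m = (\<Oplus>\<^bsub>M\<^esub>a\<in>{..<n}. e a m \<odot>\<^bsub>M\<^esub> x a)"
    by (rule dual_basis) blast
  define r where "r h = (\<Oplus>\<^bsub>DM\<^esub>a\<in>{..<n}. pure B Dual M (\<lambda>y\<in>carrier M. e a (h y)) (x a))" for h
  have comp: "additive_map E Dual (\<lambda>h. \<lambda>y\<in>carrier M. e a (h y))" if "a < n" for a
  proof (rule additive_mapI)
    fix h h' assume "h \<in> carrier E" "h' \<in> carrier E"
    then have h: "h \<in> EndM" "h' \<in> EndM" by (simp_all add: pointwise_simps)
    show "(\<lambda>y\<in>carrier M. e a (h y)) \<in> carrier Dual"
      using linear_maps_D(1-3)[OF h(1)] Dual_D(1-3)[OF e[OF that]] by (intro restrict_Dual) auto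
    show "(\<lambda>y\<in>carrier M. e a ((h \<oplus>\<^bsub>E\<^esub> h') y)) = (\<lambda>y\<in>carrier M. e a (h y)) \<oplus>\<^bsub>Dual\<^esub> (\<lambda>y\<in>carrier M. e a (h' y))"
      using linear_maps_D(1-3)[OF h(1)] linear_maps_D(1-3)[OF h(2)] Dual_D(1-3)[OF e[OF that]]
      by (auto simp: pointwise_simps Dual_simps intro!: restrict_ext)
  qed
  have pl: "additive_map Dual DM (\<lambda>\<mu>. pure B Dual M \<mu> m)" if "m \<in> carrier M" for m
    using that by (intro additive_mapI) (auto simp: TD.pure_closed TD.pure_add_left)
  have radd: "additive_map E DM r"
    unfolding r_def
    by (intro D.additive_map_finsum_comb abelian_group_End additive_map_comp[OF comp pl]) (use x in auto)
  have retr: "t = r (\<Phi> t)" if t: "t \<in> carrier DM" for t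
  proof (rule TD.tensor_map_eqI[OF D.abelian_group_axioms _ additive_map_comp[OF additive_dual_tensor radd] _ t])
    show "additive_map DM DM (\<lambda>t. t)" by (rule additive_mapI) auto
    fix \<mu> m assume \<mu>: "\<mu> \<in> carrier Dual" and m: "m \<in> carrier M"
    have em: "a < n \<Longrightarrow> e a m \<in> carrier B" for a using Dual_D(1)[OF e m] .
    have fc: "(\<lambda>a. e a m \<odot>\<^bsub>M\<^esub> x a) \<in> {..<n} \<rightarrow> carrier M" using em x by (auto simp: L.smult_closed)
    have pr: "additive_map M DM (\<lambda>m. pure B Dual M \<mu> m)"
      using \<mu> by (intro additive_mapI) (auto simp: TD.pure_closed TD.pure_add_right)
    have "pure B Dual M \<mu> m = pure B Dual M \<mu> (\<Oplus>\<^bsub>M\<^esub>a\<in>{..<n}. e a m \<odot>\<^bsub>M\<^esub> x a)"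
      using ex[OF m] by simp
    also have "\<dots> = (\<Oplus>\<^bsub>DM\<^esub>a\<in>{..<n}. pure B Dual M \<mu> (e a m \<odot>\<^bsub>M\<^esub> x a))"
      by (rule additive_map_finsum[OF L.M.abelian_group_axioms D.abelian_group_axioms pr fc])
    also have "\<dots> = r (\<Phi> (pure B Dual M \<mu> m))"
      unfolding r_def dual_tensor_pure[OF \<mu> m]
    proof (rule D.finsum_cong'[OF refl])
      fix a assume a: "a \<in> {..<n}"
      have "(\<lambda>y\<in>carrier M. e a (rank_one \<mu> m y)) = rsmult Dual \<mu> (e a m)"
        using a m \<mu> Dual_D(1-3)[OF e[of a]] by (auto simp: rank_one_def Dual_simps Dual_D(1)[OF \<mu>] intro!: restrict_ext)
      then show "pure B Dual M \<mu> (e a m \<odot>\<^bsub>M\<^esub> x a) = pure B Dual M (\<lambda>y\<in>carrier M. e a (rank_one \<mu> m y)) (x a)"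
        using a em x \<mu> by (simp add: TD.pure_balanced)
    next
      show "(\<lambda>a. pure B Dual M (\<lambda>y\<in>carrier M. e a (rank_one \<mu> m y)) (x a)) \<in> {..<n} \<rightarrow> carrier DM"
        using additive_map_closed[OF comp] rank_one_End[OF \<mu> m] x
        by (auto simp: pointwise_simps intro!: TD.pure_closed)
    qed
    finally show "pure B Dual M \<mu> m = r (\<Phi> (pure B Dual M \<mu> m))" .
  qed
  then show ?thesis by (intro inj_on_inverseI[of _ r]) simp
qed

text \<open>
  By the dual basis expansion, \<open>h(m) = \<Sum>\<^sub>a e\<^sub>a(m) h(x\<^sub>a)\<close>.
\<close>

lemma dual_tensor_surj:
  assumes h: "h \<in> EndM"
  shows "\<exists>t\<in>carrier DM. \<Phi> t = h"
proof -
  interpret D: abelian_group DM by (rule TD.abelian_group_tensor)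
  interpret E: abelian_group E by (rule abelian_group_End)
  obtain n :: nat and e and x where e: "\<And>a. a < n \<Longrightarrow> e a \<in> carrier Dual" and x: "\<And>a. a < n \<Longrightarrow> x a \<in> carrier M"
    and ex: "\<And>m. m \<in> carrier M \<Longrightarrow> m = (\<Oplus>\<^bsub>M\<^esub>a\<in>{..<n}. e a m \<odot>\<^bsub>M\<^esub> x a)"
    by (rule dual_basis) blast
  note hD = linear_maps_D[OF h]
  let ?t = "\<Oplus>\<^bsub>DM\<^esub>a\<in>{..<n}. pure B Dual M (e a) (h (x a))"
  have fc: "(\<lambda>a. pure B Dual M (e a) (h (x a))) \<in> {..<n} \<rightarrow> carrier DM"
    using e x hD(1) by (auto intro!: TD.pure_closed)
  have t: "?t \<in> carrier DM" by (rule D.finsum_closed[OF fc])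
  have ro: "a < n \<Longrightarrow> rank_one (e a) (h (x a)) \<in> EndM" for a using rank_one_End[OF e hD(1)[OF x]] .
  have \<Phi>t: "\<Phi> ?t = (\<Oplus>\<^bsub>E\<^esub>a\<in>{..<n}. rank_one (e a) (h (x a)))"
    unfolding additive_map_finsum[OF D.abelian_group_axioms abelian_group_End additive_dual_tensor fc]
    by (rule E.finsum_cong') (use e x hD(1) ro in \<open>auto simp: dual_tensor_pure pointwise_simps\<close>)
  have "\<Phi> ?t = h"
  proof (rule extensionalityI)
    show "\<Phi> ?t \<in> extensional (carrier M)"
      using additive_map_closed[OF additive_dual_tensor t] by (simp add: pointwise_simps linear_maps_D(4))
    show "h \<in> extensional (carrier M)" by (rule hD(4))
    fix m assume m: "m \<in> carrier M"
    have ev: "additive_map E M (\<lambda>g. g m)"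
      by (rule additive_evaluation) (use m linear_maps_D(1) in auto)
    have fe: "(\<lambda>a. e a m \<odot>\<^bsub>M\<^esub> x a) \<in> {..<n} \<rightarrow> carrier M"
      using Dual_D(1)[OF e m] x by (auto simp: L.smult_closed)
    have "\<Phi> ?t m = (\<Oplus>\<^bsub>M\<^esub>a\<in>{..<n}. rank_one (e a) (h (x a)) m)"
      unfolding \<Phi>t
      by (rule additive_map_finsum[OF abelian_group_End L.M.abelian_group_axioms ev]) (use ro in \<open>auto simp: pointwise_simps\<close>)
    also have "\<dots> = (\<Oplus>\<^bsub>M\<^esub>a\<in>{..<n}. h (e a m \<odot>\<^bsub>M\<^esub> x a))"
      using m x hD(1,3) Dual_D(1)[OF e m]
      by (intro L.M.finsum_cong') (auto simp: rank_one_def L.smult_closed)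
    also have "\<dots> = h (\<Oplus>\<^bsub>M\<^esub>a\<in>{..<n}. e a m \<odot>\<^bsub>M\<^esub> x a)"
      by (rule additive_map_finsum[OF L.M.abelian_group_axioms L.M.abelian_group_axioms hD(5) fe, symmetric])
    finally show "\<Phi> ?t m = h m" using ex[OF m] by simp
  qed
  with t show ?thesis by blast
qed

abbreviation tr where "tr \<equiv> Tr K B M"

lemma Tr_dual_tensor: "t \<in> carrier DM \<Longrightarrow> tr (\<Phi> t) = eval_class t"
  by (simp add: Tr_def inv_into_f_f[OF dual_tensor_inj] eval_class_def)

lemma Tr_rank_one: "\<lbrakk>\<mu> \<in> carrier Dual; m \<in> carrier M\<rbrakk> \<Longrightarrow> tr (rank_one \<mu> m) = cc (\<mu> m)"
  using Tr_dual_tensor[of "pure B Dual M \<mu> m"] by (simp add: dual_tensor_pure TD.pure_closed eval_class_pure)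

lemma additive_Tr: "additive_map E (cyc K B) tr"
proof (rule additive_mapI)
  interpret D: abelian_group DM by (rule TD.abelian_group_tensor)
  fix h h' assume h: "h \<in> carrier E" "h' \<in> carrier E"
  then obtain t t' where t: "t \<in> carrier DM" "h = \<Phi> t" "t' \<in> carrier DM" "h' = \<Phi> t'"
    using dual_tensor_surj by (metis pointwise_simps(1))
  show "tr h \<in> carrier (cyc K B)"
    using t by (simp add: Tr_dual_tensor additive_map_closed[OF additive_eval_class])
  have "tr (h \<oplus>\<^bsub>E\<^esub> h') = tr (\<Phi> (t \<oplus>\<^bsub>DM\<^esub> t'))"
    using t additive_map_add[OF additive_dual_tensor] by simp
  also have "\<dots> = tr h \<oplus>\<^bsub>cyc K B\<^esub> tr h'"
    using t by (simp add: Tr_dual_tensor additive_map_add[OF additive_eval_class])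
  finally show "tr (h \<oplus>\<^bsub>E\<^esub> h') = tr h \<oplus>\<^bsub>cyc K B\<^esub> tr h'" .
qed

text \<open>
  Endomorphisms are sums of endomorphisms of rank one, so additive identities for the trace need
  to be checked on these only.
\<close>

lemma End_map_eqI:
  assumes "abelian_group G" "additive_map E G F" "additive_map E G F'"
    and "\<And>\<mu> m. \<lbrakk>\<mu> \<in> carrier Dual; m \<in> carrier M\<rbrakk> \<Longrightarrow> F (rank_one \<mu> m) = F' (rank_one \<mu> m)"
    and "h \<in> EndM"
  shows "F h = F' h"
proof -
  obtain t where t: "t \<in> carrier DM" "\<Phi> t = h" using dual_tensor_surj assms(5) by blast
  have "F (\<Phi> t) = F' (\<Phi> t)"
    by (rule TD.tensor_map_eqI[OF assms(1) additive_map_comp[OF additive_dual_tensor assms(2)]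
       additive_map_comp[OF additive_dual_tensor assms(3)] _ t(1)])
      (simp add: dual_tensor_pure assms(4))
  then show ?thesis using t by simp
qed

end

section \<open>Products of endomorphisms and derivations\<close>

context algebra_module
begin

lemma End_iff: "h \<in> carrier E \<longleftrightarrow> h \<in> EndM" by (simp add: pointwise_simps)

lemma End_add: "\<lbrakk>g \<in> EndM; h \<in> EndM\<rbrakk> \<Longrightarrow> g \<oplus>\<^bsub>E\<^esub> h \<in> EndM"
  using abelian_groupE(1)[OF abelian_group_End] by (simp add: End_iff)

lemma compose_End: "\<lbrakk>g \<in> EndM; h \<in> EndM\<rbrakk> \<Longrightarrow> compose (carrier M) g h \<in> EndM"
  unfolding compose_def by (rule restrict_End) (auto simp: linear_maps_D)

lemma additive_compose_left: "g \<in> EndM \<Longrightarrow> additive_map E E (\<lambda>h. compose (carrier M) g h)"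
  by (rule additive_mapI)
    (auto simp: End_iff compose_End, auto simp: pointwise_simps compose_def linear_maps_D intro!: restrict_ext)

lemma additive_compose_right: "g \<in> EndM \<Longrightarrow> additive_map E E (\<lambda>h. compose (carrier M) h g)"
  by (rule additive_mapI)
    (auto simp: End_iff compose_End, auto simp: pointwise_simps compose_def linear_maps_D intro!: restrict_ext)

text \<open>
  The action of a scalar of \<open>\<K>\<close> on \<open>End\<^sub>B(M)\<close>; general elements of \<open>B\<close> do not act, for lack of
  commutativity.
\<close>

definition scale where "scale k h = (\<lambda>x\<in>carrier M. (k \<odot>\<^bsub>B\<^esub> \<one>\<^bsub>B\<^esub>) \<odot>\<^bsub>M\<^esub> h x)"

lemma scalar_central:
  assumes "k \<in> carrier K" "b \<in> carrier B"
  shows "(k \<odot>\<^bsub>B\<^esub> \<one>\<^bsub>B\<^esub>) \<otimes>\<^bsub>B\<^esub> b = k \<odot>\<^bsub>B\<^esub> b" "b \<otimes>\<^bsub>B\<^esub> (k \<odot>\<^bsub>B\<^esub> \<one>\<^bsub>B\<^esub>) = k \<odot>\<^bsub>B\<^esub> b"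
  using assms by (simp_all add: smult_mult_left smult_mult_right)

lemma scalar_act:
  assumes "k \<in> carrier K" "b \<in> carrier B" "m \<in> carrier M"
  shows "(k \<odot>\<^bsub>B\<^esub> \<one>\<^bsub>B\<^esub>) \<odot>\<^bsub>M\<^esub> (b \<odot>\<^bsub>M\<^esub> m) = (k \<odot>\<^bsub>B\<^esub> b) \<odot>\<^bsub>M\<^esub> m"
    "b \<odot>\<^bsub>M\<^esub> ((k \<odot>\<^bsub>B\<^esub> \<one>\<^bsub>B\<^esub>) \<odot>\<^bsub>M\<^esub> m) = (k \<odot>\<^bsub>B\<^esub> b) \<odot>\<^bsub>M\<^esub> m"
  using assms by (simp_all add: L.smult_assoc[symmetric] scalar_central)

lemma scale_End: "\<lbrakk>k \<in> carrier K; h \<in> EndM\<rbrakk> \<Longrightarrow> scale k h \<in> EndM"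
  unfolding scale_def
  by (rule restrict_End) (auto simp: linear_maps_D L.smult_closed L.smult_r_distr scalar_act)

lemma additive_scale: "k \<in> carrier K \<Longrightarrow> additive_map E E (scale k)"
  by (rule additive_mapI)
    (auto simp: End_iff scale_End, auto simp: pointwise_simps scale_def linear_maps_D L.smult_closed L.smult_r_distr intro!: restrict_ext)

definition commutator where "commutator D h = (\<lambda>x\<in>carrier M. D (h x) \<ominus>\<^bsub>M\<^esub> h (D x))"

text \<open>
  Neither \<open>\<rho>\<^sub>f\<close> nor \<open>\<nabla>\<^sub>f\<close> is \<open>B\<close>-linear, but their commutators with \<open>B\<close>-linear maps are; this notion
  covers both.
\<close>

definition derivation_along where
  "derivation_along \<delta> D \<longleftrightarrow> \<delta> \<in> carrier (Der_lie K B) \<and> additive_map M M D \<and>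
     (\<forall>b\<in>carrier B. \<forall>m\<in>carrier M. D (b \<odot>\<^bsub>M\<^esub> m) = \<delta> b \<odot>\<^bsub>M\<^esub> m \<oplus>\<^bsub>M\<^esub> b \<odot>\<^bsub>M\<^esub> D m)"

lemma commutator_End:
  assumes D: "derivation_along \<delta> D" and h: "h \<in> EndM"
  shows "commutator D h \<in> EndM"
proof -
  have \<delta>: "\<delta> \<in> carrier (Der_lie K B)" and Da: "additive_map M M D"
    and Dm: "\<And>b m. \<lbrakk>b \<in> carrier B; m \<in> carrier M\<rbrakk> \<Longrightarrow> D (b \<odot>\<^bsub>M\<^esub> m) = \<delta> b \<odot>\<^bsub>M\<^esub> m \<oplus>\<^bsub>M\<^esub> b \<odot>\<^bsub>M\<^esub> D m"
    using D by (auto simp: derivation_along_def)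
  note simps = linear_maps_D(1-3)[OF h] additive_map_closed[OF Da] additive_map_add[OF Da] Dm
     L.smult_closed Der_closed[OF \<delta>]
  show ?thesis unfolding commutator_def
    by (rule restrict_End)
      (auto simp: simps L.M.minus_add_interchange L.M.add_cancel_common
        L.M.minus_eq_zero_iff
        additive_map_minus[OF L.M.abelian_group_axioms L.M.abelian_group_axioms additive_act])
qed

lemma additive_commutator:
  assumes D: "derivation_along \<delta> D"
  shows "additive_map E E (commutator D)"
proof (rule additive_mapI)
  fix g h assume "g \<in> carrier E" "h \<in> carrier E"
  then have gh: "g \<in> EndM" "h \<in> EndM" by (simp_all add: End_iff)
  have Da: "additive_map M M D" using D by (auto simp: derivation_along_def)
  show "commutator D (g \<oplus>\<^bsub>E\<^esub> h) = commutator D g \<oplus>\<^bsub>E\<^esub> commutator D h"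
    using gh by (auto simp: pointwise_simps commutator_def linear_maps_D additive_map_closed[OF Da]
       additive_map_add[OF Da] L.M.minus_add_interchange intro!: restrict_ext)
qed (simp add: End_iff commutator_End[OF D])

lemma commutator_compose:
  assumes D: "derivation_along \<delta> D" and g: "g \<in> EndM" and h: "h \<in> EndM"
  shows "commutator D (compose (carrier M) g h) =
    compose (carrier M) (commutator D g) h \<oplus>\<^bsub>E\<^esub> compose (carrier M) g (commutator D h)"
proof -
  have Da: "additive_map M M D" using D by (auto simp: derivation_along_def)
  have tele: "x \<ominus>\<^bsub>M\<^esub> y = (x \<ominus>\<^bsub>M\<^esub> z) \<oplus>\<^bsub>M\<^esub> (z \<ominus>\<^bsub>M\<^esub> y)"
    if "x \<in> carrier M" "y \<in> carrier M" "z \<in> carrier M" for x y z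
    using L.M.add_cancel_common[of x y "\<ominus>\<^bsub>M\<^esub> z"] that
    by (simp add: a_minus_def L.M.minus_add L.M.minus_minus L.M.a_ac)
  show ?thesis
    using g h
    by (auto simp: pointwise_simps commutator_def compose_def linear_maps_D additive_map_closed[OF Da]
       additive_map_minus[OF L.M.abelian_group_axioms L.M.abelian_group_axioms linear_maps_D(5)[OF g]]
      intro!: restrict_ext tele)
qed

definition idM where "idM = (\<lambda>m\<in>carrier M. m)"

definition composite where "composite hs = foldr (compose (carrier M)) hs idM"

lemma composite_simps [simp]:
  "composite [] = idM" "composite (h # hs) = compose (carrier M) h (composite hs)"
  by (simp_all add: composite_def)

lemma id_End: "idM \<in> EndM"
  unfolding idM_def by (rule restrict_End) auto

lemma composite_End: "set hs \<subseteq> EndM \<Longrightarrow> composite hs \<in> EndM"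
  by (induction hs) (auto simp: id_End compose_End)

lemma compose_idM:
  assumes "g \<in> EndM"
  shows "compose (carrier M) idM g = g" "compose (carrier M) g idM = g"
  using linear_maps_D(1,4)[OF assms] by (auto simp: idM_def compose_def extensional_def fun_eq_iff)

lemma composite_append:
  assumes "set gs \<subseteq> EndM" "set hs \<subseteq> EndM"
  shows "composite (gs @ hs) = compose (carrier M) (composite gs) (composite hs)"
  using assms(1)
proof (induction gs)
  case Nil
  then show ?case using composite_End[OF assms(2)] by (simp add: compose_idM)
next
  case (Cons g gs)
  have "composite gs \<in> EndM" "composite hs \<in> EndM"
    using Cons.prems assms(2) by (auto intro!: composite_End)
  then show ?case using Cons by (auto simp: compose_def linear_maps_D intro!: restrict_ext)
qed

lemma set_list_update_subset: "\<lbrakk>set hs \<subseteq> S; h \<in> S\<rbrakk> \<Longrightarrow> set (hs[p := h]) \<subseteq> S"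
  using set_update_subset_insert[of hs p h] by auto

lemma additive_composite_slot:
  assumes "set hs \<subseteq> EndM" "p < length hs"
  shows "additive_map E E (\<lambda>h. composite (hs[p := h]))"
  using assms
proof (induction hs arbitrary: p)
  case (Cons g gs)
  show ?case
  proof (cases p)
    case 0
    then show ?thesis using Cons.prems by (auto intro!: additive_compose_right composite_End)
  next
    case (Suc q)
    then show ?thesis
      using Cons additive_map_comp[OF Cons.IH[of q] additive_compose_left[of g]] by auto
  qed
qed simp

lemma composite_slot_scale:
  assumes "set hs \<subseteq> EndM" "p < length hs" "k \<in> carrier K" "h \<in> EndM"
  shows "composite (hs[p := scale k h]) = scale k (composite (hs[p := h]))"
  using assms(1,2)
proof (induction hs arbitrary: p)
  case (Cons g gs)
  show ?case
  proof (cases p)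
    case 0
    have "composite gs \<in> EndM" using Cons.prems by (auto intro!: composite_End)
    then show ?thesis using 0 assms(3,4)
      by (auto simp: compose_def scale_def linear_maps_D intro!: restrict_ext)
  next
    case (Suc q)
    have "composite (gs[q := h]) \<in> EndM"
      using Cons.prems assms(4) by (intro composite_End set_list_update_subset) auto
    moreover have "g \<in> EndM" using Cons.prems by simp
    ultimately show ?thesis using Suc Cons assms(3)
      by (auto simp: compose_def scale_def linear_maps_D intro!: restrict_ext)
  qed
qed simp

lemma commutator_id:
  assumes D: "derivation_along \<delta> D"
  shows "commutator D idM = \<zero>\<^bsub>E\<^esub>"
proof -
  have Da: "additive_map M M D" using D by (auto simp: derivation_along_def)
  show ?thesis
    by (auto simp: idM_def commutator_def pointwise_simps additive_map_closed[OF Da] L.M.minus_eq_zero_iff intro!: restrict_ext)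
qed

lemma composite_slot_commutator_End:
  assumes "derivation_along \<delta> D" "set hs \<subseteq> EndM" "p < length hs"
  shows "composite (hs[p := commutator D (hs ! p)]) \<in> EndM"
proof -
  have "hs ! p \<in> EndM" using assms(2,3) nth_mem by blast
  then show ?thesis
    using assms by (intro composite_End set_list_update_subset commutator_End[OF assms(1)])
qed

text \<open>
  The Leibniz rule for a product of endomorphisms.
\<close>

lemma commutator_composite:
  assumes D: "derivation_along \<delta> D" and "set hs \<subseteq> EndM"
  shows "commutator D (composite hs) =
    (\<Oplus>\<^bsub>E\<^esub>p\<in>{..<length hs}. composite (hs[p := commutator D (hs ! p)]))"
  using assms(2)
proof (induction hs)
  case Nil
  interpret E: abelian_group E by (rule abelian_group_End)
  show ?case using commutator_id[OF D] by (simp add: E.finsum_empty)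
next
  case (Cons g gs)
  interpret E: abelian_group E by (rule abelian_group_End)
  have g: "g \<in> EndM" and gs: "set gs \<subseteq> EndM" using Cons.prems by auto
  let ?f = "\<lambda>p. composite ((g # gs)[p := commutator D ((g # gs) ! p)])"
  have cl: "?f p \<in> carrier E" if "p < Suc (length gs)" for p
  proof -
    have "(g # gs) ! p \<in> EndM" using that Cons.prems by (metis length_Cons nth_mem subsetD)
    then show ?thesis unfolding End_iff
      using Cons.prems by (intro composite_End set_list_update_subset commutator_End[OF D]) auto
  qed
  have set: "{..<length (g # gs)} = insert 0 (Suc ` {..<length gs})"
    by (auto simp: less_Suc_eq_0_disj)
  have fin: "(\<lambda>p. composite (gs[p := commutator D (gs ! p)])) \<in> {..<length gs} \<rightarrow> carrier E"
    unfolding End_iff Pi_iff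
    using gs by (simp add: composite_slot_commutator_End[OF D])
  have "(\<Oplus>\<^bsub>E\<^esub>p\<in>{..<length (g # gs)}. ?f p) = ?f 0 \<oplus>\<^bsub>E\<^esub> (\<Oplus>\<^bsub>E\<^esub>p\<in>Suc ` {..<length gs}. ?f p)"
    unfolding set by (rule E.finsum_insert) (use cl in \<open>auto simp del: composite_simps nth_Cons_Suc nth_Cons_0 list_update.simps\<close>)
  also have "(\<Oplus>\<^bsub>E\<^esub>p\<in>Suc ` {..<length gs}. ?f p) = (\<Oplus>\<^bsub>E\<^esub>p\<in>{..<length gs}. ?f (Suc p))"
    by (rule E.finsum_reindex) (use cl in \<open>auto simp del: composite_simps nth_Cons_Suc nth_Cons_0 list_update.simps\<close>)
  also have "\<dots> = (\<Oplus>\<^bsub>E\<^esub>p\<in>{..<length gs}. compose (carrier M) g (composite (gs[p := commutator D (gs ! p)])))"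
    by simp
  also have "\<dots> = compose (carrier M) g (commutator D (composite gs))"
    unfolding Cons.IH[OF gs]
    by (rule additive_map_finsum[OF E.abelian_group_axioms E.abelian_group_axioms additive_compose_left[OF g] fin, symmetric])
  also have "?f 0 \<oplus>\<^bsub>E\<^esub> \<dots> = commutator D (composite (g # gs))"
    using commutator_compose[OF D g composite_End[OF gs]] by simp
  finally show ?case by simp
qed

end

context projective_module
begin

lemma Tr_closed: "h \<in> EndM \<Longrightarrow> tr h \<in> carrier (cyc K B)"
  using additive_map_closed[OF additive_Tr] by (simp add: End_iff)

text \<open>
  On rank one, \<open>g \<circ> (\<mu> \<otimes> m) = \<mu> \<otimes> g(m)\<close> and \<open>(\<mu> \<otimes> m) \<circ> g = (\<mu> \<circ> g) \<otimes> m\<close>, and both have trace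
  \<open>|\<mu>(g(m))|\<close>.
\<close>

lemma Tr_cyclic:
  assumes g: "g \<in> EndM" and h: "h \<in> EndM"
  shows "tr (compose (carrier M) g h) = tr (compose (carrier M) h g)"
proof (rule End_map_eqI[OF abelian_group_cyc additive_map_comp[OF additive_compose_left[OF g] additive_Tr]
      additive_map_comp[OF additive_compose_right[OF g] additive_Tr] _ h])
  fix \<mu> m assume \<mu>: "\<mu> \<in> carrier Dual" and m: "m \<in> carrier M"
  note gD = linear_maps_D(1-3)[OF g] and \<mu>D = Dual_D(1-3)[OF \<mu>]
  have 1: "compose (carrier M) g (rank_one \<mu> m) = rank_one \<mu> (g m)"
    using m gD \<mu>D by (auto simp: compose_def rank_one_def intro!: restrict_ext)
  have 2: "compose (carrier M) (rank_one \<mu> m) g = rank_one (\<lambda>x\<in>carrier M. \<mu> (g x)) m"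
    using m gD \<mu>D by (auto simp: compose_def rank_one_def intro!: restrict_ext)
  have "(\<lambda>x\<in>carrier M. \<mu> (g x)) \<in> carrier Dual"
    using gD \<mu>D by (intro restrict_Dual) auto
  then show "tr (compose (carrier M) g (rank_one \<mu> m)) = tr (compose (carrier M) (rank_one \<mu> m) g)"
    using m gD \<mu> by (simp add: 1 2 Tr_rank_one)
qed

lemma Tr_scale:
  assumes k: "k \<in> carrier K" and h: "h \<in> EndM"
  shows "tr (scale k h) = k \<odot>\<^bsub>cyc K B\<^esub> tr h"
proof (rule End_map_eqI[OF abelian_group_cyc additive_map_comp[OF additive_scale[OF k] additive_Tr]
      additive_map_comp[OF additive_Tr additive_cyc_smult[OF k]] _ h])
  fix \<mu> m assume \<mu>: "\<mu> \<in> carrier Dual" and m: "m \<in> carrier M"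
  have "scale k (rank_one \<mu> m) = rank_one \<mu> ((k \<odot>\<^bsub>B\<^esub> \<one>\<^bsub>B\<^esub>) \<odot>\<^bsub>M\<^esub> m)"
    using m k Dual_D(1)[OF \<mu>] by (auto simp: scale_def rank_one_def scalar_act intro!: restrict_ext)
  then show "tr (scale k (rank_one \<mu> m)) = k \<odot>\<^bsub>cyc K B\<^esub> tr (rank_one \<mu> m)"
    using \<mu> m k by (simp add: Tr_rank_one L.smult_closed Dual_D cc_smult scalar_central)
qed

text \<open>
  On rank one, \<open>[D, \<mu> \<otimes> m] = \<nu> \<otimes> m + \<mu> \<otimes> D(m)\<close>, where \<open>\<nu> = \<delta> \<circ> \<mu> - \<mu> \<circ> D\<close> is again \<open>B\<close>-linear. The trace of
  this is \<open>|\<delta>(\<mu>(m)) - \<mu>(D(m))| + |\<mu>(D(m))| = |\<delta>(\<mu>(m))|\<close>.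
\<close>

lemma Tr_commutator:
  assumes D: "derivation_along \<delta> D" and h: "h \<in> EndM"
  shows "tr (commutator D h) = act \<delta> (tr h)"
proof -
  have \<delta>: "\<delta> \<in> carrier (Der_lie K B)" and Da: "additive_map M M D"
    and Dm: "\<And>b m. \<lbrakk>b \<in> carrier B; m \<in> carrier M\<rbrakk> \<Longrightarrow> D (b \<odot>\<^bsub>M\<^esub> m) = \<delta> b \<odot>\<^bsub>M\<^esub> m \<oplus>\<^bsub>M\<^esub> b \<odot>\<^bsub>M\<^esub> D m"
    using D by (auto simp: derivation_along_def)
  note Dc = additive_map_closed[OF Da] and \<delta>c = Der_closed[OF \<delta>]
  show ?thesis
  proof (rule End_map_eqI[OF abelian_group_cyc additive_map_comp[OF additive_commutator[OF D] additive_Tr]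
      additive_map_comp[OF additive_Tr additive_act_cyc[OF \<delta>]] _ h])
    fix \<mu> m assume \<mu>: "\<mu> \<in> carrier Dual" and m: "m \<in> carrier M"
    note \<mu>D = Dual_D(1-3)[OF \<mu>]
    let ?\<nu> = "\<lambda>x\<in>carrier M. \<delta> (\<mu> x) \<ominus>\<^bsub>B\<^esub> \<mu> (D x)"
    have \<nu>: "?\<nu> \<in> carrier Dual"
      by (rule restrict_Dual)
        (auto simp: \<mu>D Dc \<delta>c Dm additive_map_add[OF Da] Der_add[OF \<delta>] Der_mult[OF \<delta>] M.minus_add_interchange
          L.smult_closed M.add_cancel_common M.minus_eq_zero_iff
          additive_map_minus[OF B.is_abelian_group B.is_abelian_group additive_lmult])
    have "commutator D (rank_one \<mu> m) = rank_one ?\<nu> m \<oplus>\<^bsub>E\<^esub> rank_one \<mu> (D m)"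
      unfolding commutator_def rank_one_def pointwise_simps
    proof (rule restrict_ext)
      fix x assume x: "x \<in> carrier M"
      have "(\<delta> (\<mu> x) \<ominus>\<^bsub>B\<^esub> \<mu> (D x)) \<odot>\<^bsub>M\<^esub> m = \<delta> (\<mu> x) \<odot>\<^bsub>M\<^esub> m \<ominus>\<^bsub>M\<^esub> \<mu> (D x) \<odot>\<^bsub>M\<^esub> m"
        using x m by (simp add: additive_map_minus[OF B.is_abelian_group L.M.abelian_group_axioms additive_act_left[OF m]]
           \<mu>D Dc \<delta>c)
      then show "D ((\<lambda>x\<in>carrier M. \<mu> x \<odot>\<^bsub>M\<^esub> m) x) \<ominus>\<^bsub>M\<^esub> (\<lambda>x\<in>carrier M. \<mu> x \<odot>\<^bsub>M\<^esub> m) (D x) =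
         (\<lambda>x\<in>carrier M. ?\<nu> x \<odot>\<^bsub>M\<^esub> m) x \<oplus>\<^bsub>M\<^esub> (\<lambda>x\<in>carrier M. \<mu> x \<odot>\<^bsub>M\<^esub> D m) x"
        using x m by (simp add: \<mu>D Dc \<delta>c Dm L.smult_closed) (simp add: a_minus_def \<mu>D Dc \<delta>c L.smult_closed L.M.a_ac)
    qed
    then have "tr (commutator D (rank_one \<mu> m)) = cc (?\<nu> m) \<oplus>\<^bsub>cyc K B\<^esub> cc (\<mu> (D m))"
      using \<nu> \<mu> m Dc by (simp add: additive_map_add[OF additive_Tr] End_iff rank_one_End Tr_rank_one)
    also have "\<dots> = cc (\<delta> (\<mu> m))"
      using m by (simp add: cc_add[symmetric] \<mu>D Dc \<delta>c) (simp add: a_minus_def \<mu>D Dc \<delta>c M.a_assoc M.l_neg)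
    finally show "tr (commutator D (rank_one \<mu> m)) = act \<delta> (tr (rank_one \<mu> m))"
      using \<mu> m by (simp add: Tr_rank_one act_cc[OF \<delta>] \<mu>D)
  qed
qed

lemma Tr_composite_rotate:
  assumes "set (h # hs) \<subseteq> EndM"
  shows "tr (composite (hs @ [h])) = tr (composite (h # hs))"
  using assms composite_append[of hs "[h]"] Tr_cyclic[OF composite_End[of hs], of h]
  by (simp add: compose_idM)

lemma additive_Tr_slot:
  assumes "set hs \<subseteq> EndM" "p < length hs"
  shows "additive_map E (cyc K B) (\<lambda>h. tr (composite (hs[p := h])))"
  by (rule additive_map_comp[OF additive_composite_slot[OF assms] additive_Tr])

lemma act_Tr_composite:
  assumes D: "derivation_along \<delta> D" and hs: "set hs \<subseteq> EndM"
  shows "act \<delta> (tr (composite hs)) =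
    (\<Oplus>\<^bsub>cyc K B\<^esub>p\<in>{..<length hs}. tr (composite (hs[p := commutator D (hs ! p)])))"
proof -
  have "act \<delta> (tr (composite hs)) = tr (commutator D (composite hs))"
    using Tr_commutator[OF D composite_End[OF hs]] by simp
  also have "\<dots> = tr (\<Oplus>\<^bsub>E\<^esub>p\<in>{..<length hs}. composite (hs[p := commutator D (hs ! p)]))"
    by (simp only: commutator_composite[OF D hs])
  also have "\<dots> = (\<Oplus>\<^bsub>cyc K B\<^esub>p\<in>{..<length hs}. tr (composite (hs[p := commutator D (hs ! p)])))"
    by (rule additive_map_finsum[OF abelian_group_End abelian_group_cyc additive_Tr])
      (use hs in \<open>simp add: End_iff composite_slot_commutator_End[OF D]\<close>)
  finally show ?thesis .
qed

end

section \<open>Alternating sums over permutations\<close>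

lemma nths_remove1: "nths xs (- {j}) = take j xs @ drop (Suc j) xs"
proof -
  have *: "nths xs (- {j}) = nths (take j xs) (- {j}) @ nths (drop j xs) {i. i + j \<in> - {j}}"
  proof (cases "j \<le> length xs")
    case True
    then show ?thesis
      using nths_append[of "take j xs" "drop j xs" "- {j}"] by (simp add: min_absorb2)
  qed simp
  have 1: "nths (take j xs) (- {j}) = take j xs"
    by (rule nths_all) auto
  have "nths (drop j xs) {i. i + j \<in> - {j}} = nths (drop j xs) {i. i \<ge> 1}"
    by (rule arg_cong[where f = "nths _"]) auto
  also have "\<dots> = drop (Suc j) xs"
    by (subst drop_eq_nths[symmetric]) simp
  finally have 2: "nths (drop j xs) {i. i + j \<in> - {j}} = drop (Suc j) xs" .
  show ?thesis unfolding * 1 2 ..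
qed

lemma length_nths_remove1: "j < length xs \<Longrightarrow> length (nths xs (- {j})) = length xs - 1"
  by (simp add: nths_remove1)

lemma nth_nths_remove1:
  "\<lbrakk>i < length xs; j < length xs - 1\<rbrakk>
    \<Longrightarrow> nths xs (- {i}) ! j = xs ! (if j < i then j else Suc j)"
  by (auto simp: nths_remove1 nth_append min_def)

lemma nths_remove1_remove1:
  assumes "i < length xs" "j < length xs - 1"
  shows "nths (nths xs (- {i})) (- {j}) = nths xs (- {i, if j < i then j else Suc j})"
proof -
  define f where "f j = (if j < i then j else Suc j)" for j :: nat
  have *: "nths (nths xs (- {i})) (- {j}) = nths xs {k \<in> - {i}. card {k' \<in> - {i}. k' < k} \<in> - {j}}"
    by (simp add: nths_nths)
  have "{k' \<in> - {i}. k' < k} = {..<k} - {i}" for k :: nat by auto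
  then have c: "card {k' \<in> - {i}. k' < k} = (if i < k then k - 1 else k)" for k :: nat
    by (simp add: card_Diff_singleton_if)
  have "{k \<in> - {i}. card {k' \<in> - {i}. k' < k} \<in> - {j}} = - {i, f j}"
    unfolding c f_def by auto
  then show ?thesis using * by (simp add: f_def)
qed

lemma finite_permutations_lessThan: "finite {s. s permutes {..<k::nat}}"
  by (simp add: finite_permutations)

lemma permutation_lessThan: "s permutes {..<k::nat} \<Longrightarrow> permutation s"
  using permutation_permutes by blast

lemma permutes_lessThan_iff: "s permutes {..<k::nat} \<Longrightarrow> s i < k \<longleftrightarrow> i < k"
  using permutes_in_image[of s "{..<k}" i] by simp

text \<open>The cycle that moves entry \<open>j\<close> of a list to the front passes \<open>j\<close> entries.\<close>

lemma move_to_front: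
  assumes "j < k"
  shows "\<exists>m. m permutes {..<k} \<and> sign m = (-1) ^ j \<and> m 0 = j \<and>
    (\<forall>ys. length ys = k \<longrightarrow> permute_list m ys = ys ! j # nths ys (- {j}))"
  using assms
proof (induction j)
  case 0
  have "permute_list id ys = ys ! 0 # nths ys (- {0})" if "length ys = k" for ys :: "'a list"
    using that 0 by (cases ys) (auto simp: nths_remove1)
  then show ?case by (intro exI[of _ id] conjI allI impI permutes_id) auto
next
  case (Suc j)
  then obtain m where m: "m permutes {..<k}" "sign m = (-1) ^ j" "m 0 = j"
      "\<And>ys :: 'a list. length ys = k \<Longrightarrow> permute_list m ys = ys ! j # nths ys (- {j})"
    by auto
  let ?t = "transpose j (Suc j)"
  have t: "?t permutes {..<k}" using Suc.prems by (intro permutes_swap_id) auto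
  have "permute_list (?t \<circ> m) ys = ys ! Suc j # nths ys (- {Suc j})"
    if ys: "length ys = k" for ys :: "'a list"
  proof -
    have sw: "permute_list ?t ys = ys[j := ys ! Suc j, Suc j := ys ! j]"
      using ys t Suc.prems
      by (intro nth_equalityI) (auto simp: permute_list_nth nth_list_update transpose_def)
    have "permute_list (?t \<circ> m) ys = permute_list m (permute_list ?t ys)"
      using m(1) ys by (simp add: permute_list_compose)
    also have "\<dots> = permute_list ?t ys ! j # nths (permute_list ?t ys) (- {j})"
      using m(4) ys by simp
    also have "permute_list ?t ys ! j = ys ! Suc j"
      using ys Suc.prems t by (simp add: permute_list_nth)
    also have "nths (permute_list ?t ys) (- {j}) = nths ys (- {Suc j})"
      using ys Suc.prems unfolding sw nths_remove1
      by (simp add: take_Suc_conv_app_nth drop_update_swap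
           Cons_nth_drop_Suc[symmetric] nth_list_update)
    finally show ?thesis .
  qed
  moreover have "sign (?t \<circ> m) = (-1) ^ Suc j"
    using m t by (subst sign_compose) (auto simp: permutation_lessThan sign_swap_id)
  moreover have "(?t \<circ> m) 0 = Suc j" by (simp add: m)
  ultimately show ?case
    using permutes_compose[OF m(1) t] by blast
qed

text \<open>
  Sorting the permutations by the entry \<open>j\<close> that they put into position \<open>p\<close>, and moving that entry to the
  front of the list first. The position \<open>p\<close> then contributes no sign.
\<close>

lemma alternating_sum_expand_entry:
  fixes R :: "'a list \<Rightarrow> int"
  assumes k: "length ys = k" and p: "p < k"
  shows "(\<Sum>s | s permutes {..<k}. sign s * R (permute_list s ys)) =
    (\<Sum>j<k. (-1) ^ j * (\<Sum>s | s permutes {..<k} \<and> s p = 0.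
       sign s * R (permute_list s (ys ! j # nths ys (- {j})))))"
proof -
  have "(\<Sum>s | s permutes {..<k}. sign s * R (permute_list s ys)) =
     (\<Sum>j<k. \<Sum>s | s \<in> {s. s permutes {..<k}} \<and> s p = j. sign s * R (permute_list s ys))"
    by (rule sum.group[symmetric])
      (use p in \<open>auto simp: finite_permutations_lessThan permutes_lessThan_iff\<close>)
  also have "\<dots> = (\<Sum>j<k. (-1) ^ j * (\<Sum>s | s permutes {..<k} \<and> s p = 0.
       sign s * R (permute_list s (ys ! j # nths ys (- {j})))))"
  proof (rule sum.cong[OF refl])
    fix j assume "j \<in> {..<k}"
    then obtain m where m: "m permutes {..<k}" "sign m = (-1) ^ j" "m 0 = j"
      "\<And>ys :: 'a list. length ys = k \<Longrightarrow> permute_list m ys = ys ! j # nths ys (- {j})"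
      using move_to_front[of j k] by blast
    have "(\<Sum>s | s \<in> {s. s permutes {..<k}} \<and> s p = j. sign s * R (permute_list s ys)) =
       (\<Sum>s | s permutes {..<k} \<and> s p = 0.
          (-1) ^ j * (sign s * R (permute_list s (ys ! j # nths ys (- {j})))))"
    proof (rule sum.reindex_bij_witness[of _ "\<lambda>s. m \<circ> s" "\<lambda>s. inv_into UNIV m \<circ> s"])
      fix s assume s: "s \<in> {s. s \<in> {s. s permutes {..<k}} \<and> s p = j}"
      show "m \<circ> (inv_into UNIV m \<circ> s) = s" using m(1) by (simp add: o_assoc permutes_inv_o)
      show "inv_into UNIV m \<circ> s \<in> {s. s permutes {..<k} \<and> s p = 0}"
        using s m(1) permutes_inverses(2)[OF m(1), of 0] m(3) by (auto simp: permutes_compose permutes_inv)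
      have "sign s = sign (m \<circ> (inv_into UNIV m \<circ> s))" by (simp add: \<open>m \<circ> (inv_into UNIV m \<circ> s) = s\<close>)
      also have "\<dots> = (-1) ^ j * sign (inv_into UNIV m \<circ> s)"
        using m s by (subst sign_compose) (auto simp: permutation_lessThan intro!: permutation_lessThan[OF permutes_compose] permutes_inv)
      finally have sg: "sign s = (-1) ^ j * sign (inv_into UNIV m \<circ> s)" .
      have "permute_list s ys = permute_list (m \<circ> (inv_into UNIV m \<circ> s)) ys"
        by (simp add: \<open>m \<circ> (inv_into UNIV m \<circ> s) = s\<close>)
      also have "\<dots> = permute_list (inv_into UNIV m \<circ> s) (permute_list m ys)"
        using m s k by (subst permute_list_compose) (auto simp: permutes_compose permutes_inv)
      finally show "(-1) ^ j * (sign (inv_into UNIV m \<circ> s) * R (permute_list (inv_into UNIV m \<circ> s) (ys ! j # nths ys (- {j})))) =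
         sign s * R (permute_list s ys)"
        using sg m(4)[OF k] by simp
    next
      fix s assume s: "s \<in> {s. s permutes {..<k} \<and> s p = 0}"
      show "inv_into UNIV m \<circ> (m \<circ> s) = s" using m(1) by (simp add: o_assoc permutes_inv_o)
      show "m \<circ> s \<in> {s. s \<in> {s. s permutes {..<k}} \<and> s p = j}"
        using s m by (auto simp: permutes_compose)
    qed
    then show "(\<Sum>s | s \<in> {s. s permutes {..<k}} \<and> s p = j. sign s * R (permute_list s ys)) =
      (-1) ^ j * (\<Sum>s | s permutes {..<k} \<and> s p = 0.
       sign s * R (permute_list s (ys ! j # nths ys (- {j}))))"
      by (simp add: sum_distrib_left)
  qed
  finally show ?thesis .
qed

text \<open>
  Removing first \<open>i\<close> and then the \<open>j\<close>-th of the remaining entries removes an ordered pair of entries. If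
  the second entry of the pair precedes the first one, the sign is \<open>(-1)\<^sup>i\<^sup>+\<^sup>j\<close> in terms of the original
  positions, otherwise the shift by one reverses it.
\<close>

lemma alternating_pairs_cancel:
  fixes V :: "nat \<Rightarrow> nat \<Rightarrow> int"
  shows "(\<Sum>i<Suc k. (-1) ^ i * (\<Sum>j<k. (-1) ^ j * V i (if j < i then j else Suc j)))
    + (\<Sum>(i, j) | i < j \<and> j < Suc k. (-1) ^ (i + j) * (V i j - V j i)) = 0"
proof -
  let ?P = "{(i, j). i < j \<and> j < Suc k}"
  have fin: "finite ?P" by (rule finite_subset[of _ "{..<Suc k} \<times> {..<Suc k}"]) auto
  have "(\<Sum>i<Suc k. (-1) ^ i * (\<Sum>j<k. (-1) ^ j * V i (if j < i then j else Suc j)))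
     = (\<Sum>(i, j)\<in>{..<Suc k} \<times> {..<k}. (-1) ^ (i + j) * V i (if j < i then j else Suc j))"
    by (simp add: sum_distrib_left sum.cartesian_product power_add mult.assoc)
  also have "{..<Suc k} \<times> {..<k} =
      {(i, j). j < i \<and> i < Suc k} \<union> {(i, j). i \<le> j \<and> j < k}" by auto
  also have "(\<Sum>(i, j)\<in>\<dots>. (-1) ^ (i + j) * V i (if j < i then j else Suc j)) =
      (\<Sum>(i, j) | j < i \<and> i < Suc k. (-1) ^ (i + j) * V i (if j < i then j else Suc j)) +
      (\<Sum>(i, j) | i \<le> j \<and> j < k. (-1) ^ (i + j) * V i (if j < i then j else Suc j))"
    by (rule sum.union_disjoint)
      (auto intro: finite_subset[of _ "{..<Suc k} \<times> {..<Suc k}"])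
  also have "(\<Sum>(i, j) | j < i \<and> i < Suc k. (-1) ^ (i + j) * V i (if j < i then j else Suc j)) =
      (\<Sum>(i, j)\<in>?P. (-1) ^ (i + j) * V j i)"
    by (rule sum.reindex_bij_witness[of _ "\<lambda>(i, j). (j, i)" "\<lambda>(i, j). (j, i)"]) (auto simp: add.commute)
  also have "(\<Sum>(i, j) | i \<le> j \<and> j < k. (-1) ^ (i + j) * V i (if j < i then j else Suc j)) =
      (\<Sum>(i, j)\<in>?P. - ((-1) ^ (i + j) * V i j))"
    by (rule sum.reindex_bij_witness[of _ "\<lambda>(i, j). (i, j - 1)" "\<lambda>(i, j). (i, Suc j)"]) auto
  finally show ?thesis
    using fin by (simp add: sum.distrib[symmetric] case_prod_unfold right_diff_distrib)
qed

lemma permute_list_head: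
  assumes "s permutes {..<Suc (length ys)}" "s p = 0"
  shows "permute_list s (z # ys) = (permute_list s (y # ys))[p := z]" "p < Suc (length ys)"
    "permute_list s (z # ys) ! p = z"
proof -
  show p: "p < Suc (length ys)" using assms permutes_in_image[OF assms(1), of p] by auto
  have *: "s i = 0 \<longleftrightarrow> i = p" for i using assms by (metis permutes_inj injD)
  show "permute_list s (z # ys) = (permute_list s (y # ys))[p := z]"
  proof (rule nth_equalityI)
    fix i assume i: "i < length (permute_list s (z # ys))"
    have "permute_list s (c # ys) ! i = (c # ys) ! s i" for c
      using i assms by (intro permute_list_nth) auto
    then show "permute_list s (z # ys) ! i = (permute_list s (y # ys))[p := z] ! i"
      using i *[of i] by (cases "i = p") (auto simp: nth_list_update nth_Cons split: nat.split)
  qed simp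
  show "permute_list s (z # ys) ! p = z" using assms p by (simp add: permute_list_nth)
qed

text \<open>
  The combinatorial core of the cocycle condition. The value \<open>q p a b ys\<close> stands for the trace of a
  product in which the \<open>p\<close>-th factor is \<open>[S\<^sub>a, c(b)]\<close> and the other factors are given by \<open>ys\<close>; therefore
  it may not depend on the \<open>p\<close>-th entry of \<open>ys\<close>. The first sum comes from the action of each argument
  on the others, the second from the brackets. In the second sum the bracket starts at the head
  of the list and a permutation \<open>s\<close> puts it into position \<open>s\<^sup>-\<^sup>1(0)\<close>. After expansion by
  that position, both sums run over the same ordered pairs.
\<close>

lemma alternating_leibniz_cancel:
  fixes q :: "nat \<Rightarrow> 'a \<Rightarrow> 'a \<Rightarrow> 'a list \<Rightarrow> int"
  assumes n: "length xs = Suc k"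
    and q: "\<And>p a b ys z. q p a b (ys[p := z]) = q p a b ys"
  shows "(\<Sum>i<Suc k. (-1) ^ i * (\<Sum>s | s permutes {..<k}. sign s *
        (\<Sum>p<k. q p (xs ! i) (permute_list s (nths xs (- {i})) ! p) (permute_list s (nths xs (- {i}))))))
    + (\<Sum>(i, j) | i < j \<and> j < Suc k. (-1) ^ (i + j) * (\<Sum>s | s permutes {..<k}. sign s *
        (q (inv_into UNIV s 0) (xs ! i) (xs ! j) (permute_list s (b i j # nths xs (- {i, j})))
         - q (inv_into UNIV s 0) (xs ! j) (xs ! i) (permute_list s (b i j # nths xs (- {i, j})))))) = 0"
    (is "?L + ?R = 0")
proof -
  define V where "V i j = (\<Sum>p<k. \<Sum>s | s permutes {..<k} \<and> s p = 0.
     sign s * q p (xs ! i) (xs ! j) (permute_list s (xs ! j # nths xs (- {i, j}))))" for i j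
  have len2: "length (nths xs (- {i, j})) = k - 1" if "i < j" "j < Suc k" for i j
    using nths_remove1_remove1[of j xs i] that n
    by (auto simp: insert_commute length_nths_remove1 dest: sym)
  have L: "?L = (\<Sum>i<Suc k. (-1) ^ i * (\<Sum>j<k. (-1) ^ j * V i (if j < i then j else Suc j)))"
  proof (intro sum.cong refl arg_cong2[of _ _ _ _ "(*)"])
    fix i assume i: "i \<in> {..<Suc k}"
    let ?ys = "nths xs (- {i})"
    have ys: "length ?ys = k" using i n by (simp add: length_nths_remove1)
    have "(\<Sum>s | s permutes {..<k}. sign s * (\<Sum>p<k. q p (xs ! i) (permute_list s ?ys ! p) (permute_list s ?ys)))
      = (\<Sum>p<k. \<Sum>s | s permutes {..<k}. sign s * q p (xs ! i) (permute_list s ?ys ! p) (permute_list s ?ys))"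
      by (subst sum.swap) (simp add: sum_distrib_left)
    also have "\<dots> = (\<Sum>p<k. \<Sum>j<k. (-1) ^ j * (\<Sum>s | s permutes {..<k} \<and> s p = 0. sign s *
       q p (xs ! i) (permute_list s (?ys ! j # nths ?ys (- {j})) ! p) (permute_list s (?ys ! j # nths ?ys (- {j})))))"
      by (intro sum.cong refl
         alternating_sum_expand_entry[OF ys, where R = "\<lambda>l. q _ (xs ! i) (l ! _) l"]) auto
    also have "\<dots> = (\<Sum>p<k. \<Sum>j<k. (-1) ^ j * (\<Sum>s | s permutes {..<k} \<and> s p = 0. sign s *
       q p (xs ! i) (xs ! (if j < i then j else Suc j))
        (permute_list s (xs ! (if j < i then j else Suc j) # nths xs (- {i, if j < i then j else Suc j})))))"
    proof (intro sum.cong refl arg_cong2[of _ _ _ _ "(*)"])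
      fix p j s assume pj: "p \<in> {..<k}" "j \<in> {..<k}" "s \<in> {s. s permutes {..<k} \<and> s p = 0}"
      then have j: "?ys ! j = xs ! (if j < i then j else Suc j)"
         "nths ?ys (- {j}) = nths xs (- {i, if j < i then j else Suc j})"
        using i n by (intro nth_nths_remove1 nths_remove1_remove1; simp)+
      have "length (nths ?ys (- {j})) = k - 1" using pj ys by (simp add: length_nths_remove1)
      then have "permute_list s (?ys ! j # nths ?ys (- {j})) ! p = ?ys ! j"
        using pj by (intro permute_list_head(3)) auto
      then show "q p (xs ! i) (permute_list s (?ys ! j # nths ?ys (- {j})) ! p) (permute_list s (?ys ! j # nths ?ys (- {j}))) =
         q p (xs ! i) (xs ! (if j < i then j else Suc j))
        (permute_list s (xs ! (if j < i then j else Suc j) # nths xs (- {i, if j < i then j else Suc j})))"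
        by (simp only: j)
    qed
    also have "\<dots> = (\<Sum>j<k. (-1) ^ j * V i (if j < i then j else Suc j))"
      unfolding V_def by (subst sum.swap) (simp only: sum_distrib_left)
    finally show "(\<Sum>s | s permutes {..<k}. sign s * (\<Sum>p<k. q p (xs ! i) (permute_list s ?ys ! p) (permute_list s ?ys)))
       = (\<Sum>j<k. (-1) ^ j * V i (if j < i then j else Suc j))" .
  qed
  have grp: "(\<Sum>s | s permutes {..<k}. sign s * q (inv_into UNIV s 0) (xs ! i) (xs ! j) (permute_list s (c # nths xs (- {i, j})))) = V i j"
    if ij: "i < j \<and> j < Suc k \<or> j < i \<and> i < Suc k" for i j c
  proof -
    have k0: "0 < k" using ij by auto
    have len: "length (nths xs (- {i, j})) = k - 1" using ij len2[of i j] len2[of j i] by (auto simp: insert_commute)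
    have "(\<Sum>s | s permutes {..<k}. sign s * q (inv_into UNIV s 0) (xs ! i) (xs ! j) (permute_list s (c # nths xs (- {i, j}))))
      = (\<Sum>p<k. \<Sum>s | s \<in> {s. s permutes {..<k}} \<and> inv_into UNIV s 0 = p.
          sign s * q (inv_into UNIV s 0) (xs ! i) (xs ! j) (permute_list s (c # nths xs (- {i, j}))))"
      using k0 by (intro sum.group[symmetric])
        (auto simp: finite_permutations_lessThan permutes_lessThan_iff[OF permutes_inv])
    also have "\<dots> = V i j"
      unfolding V_def
    proof (intro sum.cong refl)
      fix p show "{s. s \<in> {s. s permutes {..<k}} \<and> inv_into UNIV s 0 = p} = {s. s permutes {..<k} \<and> s p = 0}"
        by (auto simp: permutes_inverses) (metis permutes_inverses(2))
      fix s assume s: "s \<in> {s. s permutes {..<k} \<and> s p = 0}"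
      then have "inv_into UNIV s 0 = p" by (metis (mono_tags) mem_Collect_eq permutes_inverses(2))
      moreover have "permute_list s (c # nths xs (- {i, j})) = (permute_list s (xs ! j # nths xs (- {i, j})))[p := c]"
        by (rule permute_list_head(1)) (use s len k0 in auto)
      ultimately show "sign s * q (inv_into UNIV s 0) (xs ! i) (xs ! j) (permute_list s (c # nths xs (- {i, j}))) =
         sign s * q p (xs ! i) (xs ! j) (permute_list s (xs ! j # nths xs (- {i, j})))"
        by (simp add: q)
    qed
    finally show ?thesis .
  qed
  have R: "?R = (\<Sum>(i, j) | i < j \<and> j < Suc k. (-1) ^ (i + j) * (V i j - V j i))"
  proof (intro sum.cong refl)
    fix x assume "x \<in> {(i, j). i < j \<and> j < Suc k}"
    then obtain i j where x: "x = (i, j)" "i < j" "j < Suc k" by auto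
    show "(case x of (i, j) \<Rightarrow> (-1) ^ (i + j) * (\<Sum>s | s permutes {..<k}. sign s *
        (q (inv_into UNIV s 0) (xs ! i) (xs ! j) (permute_list s (b i j # nths xs (- {i, j})))
         - q (inv_into UNIV s 0) (xs ! j) (xs ! i) (permute_list s (b i j # nths xs (- {i, j})))))) =
      (case x of (i, j) \<Rightarrow> (-1) ^ (i + j) * (V i j - V j i))"
      using grp[of i j "b i j"] grp[of j i "b i j"] x
      by (simp add: right_diff_distrib sum_subtractf insert_commute)
  qed
  show ?thesis unfolding L R by (rule alternating_pairs_cancel)
qed

text \<open>
  The alternation of a list as an element of the free abelian group on lists. Every \<open>comp_alt\<close> is a
  value of \<open>frag_eval\<close> at it.
\<close>

definition alternation :: "'a list \<Rightarrow> 'a list \<Rightarrow>\<^sub>0 int" where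
  "alternation xs = (\<Sum>s | s permutes {..<length xs}. frag_cmul (sign s) (frag_of (permute_list s xs)))"

lemma keys_alternation:
  "Poly_Mapping.keys (alternation xs) \<subseteq> {ys. length ys = length xs \<and> set ys = set xs}"
  unfolding alternation_def
  by (rule order_trans[OF keys_sum]) auto

lemma alternation_permute:
  assumes t: "t permutes {..<length xs}"
  shows "alternation (permute_list t xs) = frag_cmul (sign t) (alternation xs)"
proof -
  have "frag_cmul (sign t) (alternation xs) =
      (\<Sum>s | s permutes {..<length xs}. frag_cmul (sign t * sign s) (frag_of (permute_list s xs)))"
    by (simp add: alternation_def frag_cmul_sum)
  also have "\<dots> = (\<Sum>s | s permutes {..<length xs}. frag_cmul (sign s) (frag_of (permute_list s (permute_list t xs))))"
  proof (rule sum.reindex_bij_witness[of _ "\<lambda>s. t \<circ> s" "\<lambda>s. inv_into UNIV t \<circ> s"])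
    fix s assume s: "s \<in> {s. s permutes {..<length xs}}"
    show "t \<circ> (inv_into UNIV t \<circ> s) = s" using t by (simp add: o_assoc permutes_inv_o)
    show "inv_into UNIV t \<circ> (t \<circ> s) = s" using t by (simp add: o_assoc permutes_inv_o)
    show "inv_into UNIV t \<circ> s \<in> {s. s permutes {..<length xs}}" "t \<circ> s \<in> {s. s permutes {..<length xs}}"
      using s t by (auto simp: permutes_compose permutes_inv)
    have "sign (inv_into UNIV t \<circ> s) = sign t * sign s"
      using s t by (subst sign_compose) (auto simp: permutation_lessThan sign_inverse permutation_lessThan[OF permutes_inv])
    moreover have "permute_list (inv_into UNIV t \<circ> s) (permute_list t xs) = permute_list s xs"
      using s t by (subst permute_list_compose[symmetric])
         (auto simp: permutes_compose permutes_inv o_assoc permutes_inv_o)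
    ultimately show "frag_cmul (sign (inv_into UNIV t \<circ> s)) (frag_of (permute_list (inv_into UNIV t \<circ> s) (permute_list t xs)))
      = frag_cmul (sign t * sign s) (frag_of (permute_list s xs))" by simp
  qed
  finally show ?thesis by (simp add: alternation_def)
qed

text \<open>
  Swapping two equal entries shows that the alternation equals its negative, and free abelian groups
  have no torsion. This gives the alternating property for values in any abelian group.
\<close>

lemma alternation_repeat:
  assumes "i < length xs" "j < length xs" "i \<noteq> j" "xs ! i = xs ! j"
  shows "alternation xs = 0"
proof -
  have t: "transpose i j permutes {..<length xs}" using assms by (intro permutes_swap_id) auto
  have "permute_list (transpose i j) xs = xs"
    using assms t by (intro nth_equalityI) (auto simp: permute_list_nth transpose_def)
  then have "alternation xs = - alternation xs"
    using alternation_permute[OF t] assms by (simp add: sign_swap_id)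
  then have "frag_cmul 2 (alternation xs) = 0"
    using frag_cmul_distrib[of 1 1 "alternation xs"] by (metis add.right_inverse frag_cmul_one one_add_one)
  then show ?thesis by simp
qed

section \<open>Alternation of multilinear maps\<close>

lemma alternation_permute_right:
  assumes t: "t permutes {..<length xs}"
  shows "(\<Sum>s | s permutes {..<length xs}. frag_cmul (sign s) (frag_of (permute_list t (permute_list s xs)))) =
    frag_cmul (sign t) (alternation xs)"
proof -
  have "frag_cmul (sign t) (alternation xs) =
      (\<Sum>s | s permutes {..<length xs}. frag_cmul (sign t * sign s) (frag_of (permute_list s xs)))"
    by (simp add: alternation_def frag_cmul_sum)
  also have "\<dots> = (\<Sum>s | s permutes {..<length xs}. frag_cmul (sign s) (frag_of (permute_list t (permute_list s xs))))"
  proof (rule sum.reindex_bij_witness[of _ "\<lambda>s. s \<circ> t" "\<lambda>s. s \<circ> inv_into UNIV t"])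
    fix s assume s: "s \<in> {s. s permutes {..<length xs}}"
    show "s \<circ> inv_into UNIV t \<circ> t = s" using t by (simp add: o_assoc[symmetric] permutes_inv_o)
    show "s \<circ> t \<circ> inv_into UNIV t = s" using t by (simp add: o_assoc[symmetric] permutes_inv_o)
    show "s \<circ> inv_into UNIV t \<in> {s. s permutes {..<length xs}}" "s \<circ> t \<in> {s. s permutes {..<length xs}}"
      using s t by (auto simp: permutes_compose permutes_inv)
    have "sign (s \<circ> inv_into UNIV t) = sign t * sign s"
      using s t by (subst sign_compose) (auto simp: permutation_lessThan sign_inverse permutation_lessThan[OF permutes_inv])
    moreover have "permute_list t (permute_list (s \<circ> inv_into UNIV t) xs) = permute_list s xs"
      using s t by (subst permute_list_compose[symmetric])
         (auto simp: o_assoc[symmetric] permutes_inv_o)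
    ultimately show "frag_cmul (sign (s \<circ> inv_into UNIV t)) (frag_of (permute_list t (permute_list (s \<circ> inv_into UNIV t) xs)))
      = frag_cmul (sign t * sign s) (frag_of (permute_list s xs))" by simp
  qed
  finally show ?thesis by simp
qed

lemma permute_list_update:
  assumes "s permutes {..<length xs}" "i < length xs"
  shows "permute_list s (xs[i := y]) = (permute_list s xs)[inv_into UNIV s i := y]"
proof (rule nth_equalityI)
  fix j assume "j < length (permute_list s (xs[i := y]))"
  then have j: "j < length xs" by simp
  have "s j = i \<longleftrightarrow> j = inv_into UNIV s i" using assms(1) by (metis permutes_inverses)
  moreover have "inv_into UNIV s i < length xs"
    using assms permutes_lessThan_iff[OF permutes_inv] by blast
  ultimately show "permute_list s (xs[i := y]) ! j = (permute_list s xs)[inv_into UNIV s i := y] ! j"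
    using assms j by (auto simp: permute_list_nth nth_list_update permutes_lessThan_iff)
qed simp

context abelian_group
begin

lemma frag_eval_lincomb:
  assumes "g \<in> X \<rightarrow> carrier G" "\<And>a. a \<in> A \<Longrightarrow> Poly_Mapping.keys (p a) \<subseteq> X"
  shows "Poly_Mapping.keys (\<Sum>a\<in>A. frag_cmul (w a) (p a)) \<subseteq> X" (is ?K)
    and "frag_eval G g (\<Sum>a\<in>A. frag_cmul (w a) (p a)) = (\<Oplus>a\<in>A. [w a] \<cdot> frag_eval G g (p a))" (is ?E)
proof -
  have k: "Poly_Mapping.keys (frag_cmul (w a) (p a)) \<subseteq> X" if "a \<in> A" for a
    using assms(2)[OF that] keys_cmul by fast
  then show ?K using keys_sum[of "\<lambda>a. frag_cmul (w a) (p a)" A] by blast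
  have "frag_eval G g (\<Sum>a\<in>A. frag_cmul (w a) (p a)) = (\<Oplus>a\<in>A. frag_eval G g (frag_cmul (w a) (p a)))"
    by (rule frag_eval_sum[OF assms(1) k])
  also have "\<dots> = (\<Oplus>a\<in>A. [w a] \<cdot> frag_eval G g (p a))"
  proof (rule finsum_cong'[OF refl])
    show "(\<lambda>a. [w a] \<cdot> frag_eval G g (p a)) \<in> A \<rightarrow> carrier G"
      using frag_eval_closed[OF assms] by auto
    show "frag_eval G g (frag_cmul (w a) (p a)) = [w a] \<cdot> frag_eval G g (p a)" if "a \<in> A" for a
      by (rule frag_eval_cmul[OF assms(1) assms(2)[OF that]])
  qed
  finally show ?E .
qed

lemma double_lincomb:
  assumes f: "f \<in> A \<rightarrow> carrier G"
  shows "(\<Oplus>u\<in>A. [(w u :: int)] \<cdot> f u) \<oplus> (\<Oplus>u\<in>A. [w u] \<cdot> f u) = (\<Oplus>u\<in>A. [w u] \<cdot> (f u \<oplus> f u))"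
proof -
  have "(\<lambda>u. [w u] \<cdot> f u) \<in> A \<rightarrow> carrier G" using f by auto
  then have "(\<Oplus>u\<in>A. [w u] \<cdot> f u) \<oplus> (\<Oplus>u\<in>A. [w u] \<cdot> f u) = (\<Oplus>u\<in>A. [w u] \<cdot> f u \<oplus> [w u] \<cdot> f u)"
    by (simp add: finsum_addf)
  also have "\<dots> = (\<Oplus>u\<in>A. [w u] \<cdot> (f u \<oplus> f u))"
    by (rule finsum_cong'[OF refl]) (use f in \<open>simp_all add: Pi_iff add.int_pow_distrib\<close>)
  finally show ?thesis .
qed

lemma additive_int_multiple: "additive_map G G (\<lambda>v. [(n::int)] \<cdot> v)"
  by (rule additive_mapI) (auto simp: add.int_pow_distrib)

lemma additive_double: "additive_map G G (\<lambda>v. v \<oplus> v)"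
  by (rule additive_mapI) (auto simp: a_ac)

context
  fixes F :: "'d list \<Rightarrow> 'a" and xs :: "'d list"
  assumes F: "\<And>ys. \<lbrakk>length ys = length xs; set ys = set xs\<rbrakk> \<Longrightarrow> F ys \<in> carrier G"
begin

lemma F_alternation: "F \<in> {ys. length ys = length xs \<and> set ys = set xs} \<rightarrow> carrier G"
  using F by auto

lemma comp_alt_eq_frag_eval: "comp_alt G F xs = frag_eval G F (alternation xs)"
proof -
  have "frag_eval G F (alternation xs) =
      (\<Oplus>s\<in>{s. s permutes {..<length xs}}. [sign s] \<cdot> frag_eval G F (frag_of (permute_list s xs)))"
    unfolding alternation_def by (rule frag_eval_lincomb(2)[OF F_alternation]) auto
  also have "\<dots> = comp_alt G F xs"
    unfolding comp_alt_def
    by (rule finsum_cong'[OF refl]) (use F in \<open>auto simp: frag_eval_of\<close>)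
  finally show ?thesis by simp
qed

lemma comp_alt_closed: "comp_alt G F xs \<in> carrier G"
  unfolding comp_alt_eq_frag_eval by (rule frag_eval_closed[OF F_alternation keys_alternation])

lemma comp_alt_repeat:
  "\<lbrakk>i < length xs; j < length xs; i \<noteq> j; xs ! i = xs ! j\<rbrakk> \<Longrightarrow> comp_alt G F xs = \<zero>"
  unfolding comp_alt_eq_frag_eval by (simp add: alternation_repeat)

lemma additive_comp_alt:
  assumes H: "abelian_group H" and h: "additive_map G H h"
  shows "h (comp_alt G F xs) = comp_alt H (\<lambda>ys. h (F ys)) xs"
proof -
  interpret H: abelian_group H by (rule H)
  have "h (comp_alt G F xs) = (\<Oplus>\<^bsub>H\<^esub>s\<in>{s. s permutes {..<length xs}}. h ([sign s] \<cdot> F (permute_list s xs)))"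
    unfolding comp_alt_def
    by (rule additive_map_finsum[OF abelian_group_axioms H h]) (use F in auto)
  also have "\<dots> = comp_alt H (\<lambda>ys. h (F ys)) xs"
    unfolding comp_alt_def
    by (rule H.finsum_cong'[OF refl])
      (use F additive_map_closed[OF h] in \<open>auto simp: additive_map_add_pow[OF abelian_group_axioms H h]\<close>)
  finally show ?thesis .
qed

text \<open>
  Moving the last of \<open>k\<close> entries to the front is a permutation of sign \<open>(-1)\<^sup>k\<^sup>-\<^sup>1\<close>.
\<close>

lemma comp_alt_cyclic_even:
  assumes ev: "even (length xs)" "xs \<noteq> []"
    and cyc: "\<And>y ys. \<lbrakk>length (ys @ [y]) = length xs; set (ys @ [y]) = set xs\<rbrakk> \<Longrightarrow> F (y # ys) = F (ys @ [y])"
  shows "comp_alt G F xs \<oplus> comp_alt G F xs = \<zero>"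
proof -
  let ?k = "length xs"
  obtain m where m: "m permutes {..<?k}" "sign m = (-1) ^ (?k - 1)"
      "\<And>ys :: 'd list. length ys = ?k \<Longrightarrow> permute_list m ys = ys ! (?k - 1) # nths ys (- {?k - 1})"
    using move_to_front[of "?k - 1" ?k] ev by auto
  have sm: "sign m = -1" using m(2) ev by (cases ?k) auto
  have inv: "F (permute_list m ys) = F ys" if ys: "length ys = ?k" "set ys = set xs" for ys
  proof -
    have ne: "ys \<noteq> []" using ys ev by auto
    then have "permute_list m ys = last ys # butlast ys"
      using m(3)[OF ys(1)] ys(1) by (simp add: last_conv_nth nths_remove1 butlast_conv_take)
    moreover have "F (last ys # butlast ys) = F (butlast ys @ [last ys])"
      using ne ys by (intro cyc) (simp_all add: append_butlast_last_id del: set_append length_append)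
    ultimately show ?thesis using ne by simp
  qed
  have mem: "length (permute_list s xs) = ?k" "set (permute_list s xs) = set xs" if "s permutes {..<?k}" for s
    using that by auto
  have "comp_alt G F xs =
      (\<Oplus>s\<in>{s. s permutes {..<?k}}. [sign s] \<cdot> frag_eval G F (frag_of (permute_list m (permute_list s xs))))"
    unfolding comp_alt_def
  proof (rule finsum_cong'[OF refl])
    fix s assume "s \<in> {s. s permutes {..<?k}}"
    then have s: "s permutes {..<?k}" by simp
    have "F (permute_list m (permute_list s xs)) \<in> carrier G" using inv[OF mem[OF s]] F[OF mem[OF s]] by simp
    then show "[sign s] \<cdot> F (permute_list s xs) = [sign s] \<cdot> frag_eval G F (frag_of (permute_list m (permute_list s xs)))"
      using inv[OF mem[OF s]] by (simp add: frag_eval_of)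
  next
    show "(\<lambda>s. [sign s] \<cdot> frag_eval G F (frag_of (permute_list m (permute_list s xs)))) \<in> {s. s permutes {..<?k}} \<rightarrow> carrier G"
      using m(1) by (auto intro!: frag_eval_closed[OF F_alternation])
  qed
  also have "\<dots> = frag_eval G F (\<Sum>s | s permutes {..<?k}. frag_cmul (sign s) (frag_of (permute_list m (permute_list s xs))))"
    by (rule frag_eval_lincomb(2)[OF F_alternation, symmetric]) (use m(1) in auto)
  also have "\<dots> = frag_eval G F (frag_cmul (sign m) (alternation xs))"
    by (simp only: alternation_permute_right[OF m(1)])
  also have "\<dots> = \<ominus> comp_alt G F xs"
    unfolding comp_alt_eq_frag_eval sm
    using frag_eval_minus[OF F_alternation keys_alternation] by simp
  finally have "comp_alt G F xs = \<ominus> comp_alt G F xs" .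
  then show ?thesis using comp_alt_closed by (metis r_neg)
qed

end

end

lemma linear_comp_alt:
  assumes D: "module K D" and V: "abelian_group V"
    and act: "\<And>k. k \<in> carrier K \<Longrightarrow> additive_map V V (\<lambda>v. k \<odot>\<^bsub>V\<^esub> v)"
    and F: "\<And>ys p. \<lbrakk>length ys = n; set ys \<subseteq> carrier D; p < n\<rbrakk> \<Longrightarrow> linear_map K D V (\<lambda>y. F (ys[p := y]))"
    and xs: "length xs = n" "set xs \<subseteq> carrier D" and i: "i < n"
  shows "linear_map K D V (\<lambda>y. comp_alt V F (xs[i := y]))"
proof -
  interpret D: module K D by (rule D)
  interpret V: abelian_group V by (rule V)
  let ?S = "{s. s permutes {..<n}}"
  let ?f = "\<lambda>s y. F ((permute_list s xs)[inv_into UNIV s i := y])"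
  have eq: "comp_alt V F (xs[i := y]) = (\<Oplus>\<^bsub>V\<^esub>s\<in>?S. [sign s] \<cdot>\<^bsub>V\<^esub> F (permute_list s (xs[i := y])))" for y
    using xs by (simp add: comp_alt_def)
  have pl: "F (permute_list s (xs[i := y])) = ?f s y" if "s \<in> ?S" for s y
    using that xs i by (simp add: permute_list_update)
  have lin: "linear_map K D V (?f s)" if "s \<in> ?S" for s
    using that xs i permutes_lessThan_iff[OF permutes_inv, of s n i] by (intro F) auto
  have add: "additive_map D V (\<lambda>y. F (permute_list s (xs[i := y])))" if "s \<in> ?S" for s
    using lin[OF that] unfolding pl[OF that] by (auto simp: linear_map_def additive_map_def)
  have sum: "additive_map D V (\<lambda>y. comp_alt V F (xs[i := y]))"
    unfolding eq
    by (rule V.additive_map_finsum_comb[OF D.M.abelian_group_axioms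
         additive_map_comp[OF add V.additive_int_multiple]])
  have "comp_alt V F (xs[i := k \<odot>\<^bsub>D\<^esub> y]) = k \<odot>\<^bsub>V\<^esub> comp_alt V F (xs[i := y])"
    if k: "k \<in> carrier K" and y: "y \<in> carrier D" for k y
  proof -
    have cl: "F (permute_list s (xs[i := y])) \<in> carrier V" if "s \<in> ?S" for s
      using additive_map_closed[OF add[OF that] y] .
    have hom: "F (permute_list s (xs[i := k \<odot>\<^bsub>D\<^esub> y])) = k \<odot>\<^bsub>V\<^esub> F (permute_list s (xs[i := y]))" if "s \<in> ?S" for s
      using lin[OF that] k y unfolding pl[OF that] by (auto simp: linear_map_def)
    have "k \<odot>\<^bsub>V\<^esub> comp_alt V F (xs[i := y]) = (\<Oplus>\<^bsub>V\<^esub>s\<in>?S. k \<odot>\<^bsub>V\<^esub> ([sign s] \<cdot>\<^bsub>V\<^esub> F (permute_list s (xs[i := y]))))"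
      unfolding eq by (rule additive_map_finsum[OF V V act[OF k]]) (use cl in auto)
    also have "\<dots> = comp_alt V F (xs[i := k \<odot>\<^bsub>D\<^esub> y])"
      unfolding eq
      by (rule V.finsum_cong'[OF refl])
        (use cl hom additive_map_closed[OF act[OF k]] in \<open>auto simp: additive_map_add_pow[OF V V act[OF k]]\<close>)
    finally show ?thesis by simp
  qed
  with sum show ?thesis by (auto simp: linear_map_def additive_map_def)
qed

text \<open>
  The same cancellation with values in a free abelian group, coefficient by coefficient.
\<close>

lemma alternating_leibniz_cancel_frag:
  fixes q :: "nat \<Rightarrow> 'a \<Rightarrow> 'a \<Rightarrow> 'a list \<Rightarrow> 'i \<Rightarrow>\<^sub>0 int"
  assumes n: "length xs = Suc k"
    and q: "\<And>p a b ys z. q p a b (ys[p := z]) = q p a b ys"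
  shows "(\<Sum>i<Suc k. frag_cmul ((-1) ^ i) (\<Sum>s | s permutes {..<k}. frag_cmul (sign s)
        (\<Sum>p<k. q p (xs ! i) (permute_list s (nths xs (- {i})) ! p) (permute_list s (nths xs (- {i}))))))
    + (\<Sum>(i, j) | i < j \<and> j < Suc k. frag_cmul ((-1) ^ (i + j)) (\<Sum>s | s permutes {..<k}. frag_cmul (sign s)
        (q (inv_into UNIV s 0) (xs ! i) (xs ! j) (permute_list s (b i j # nths xs (- {i, j})))
         - q (inv_into UNIV s 0) (xs ! j) (xs ! i) (permute_list s (b i j # nths xs (- {i, j})))))) = 0" (is "?Z = 0")
proof (rule poly_mapping_eqI)
  fix x
  show "Poly_Mapping.lookup ?Z x = Poly_Mapping.lookup 0 x"
    using alternating_leibniz_cancel[OF n, of "\<lambda>p a b ys. Poly_Mapping.lookup (q p a b ys) x" b] q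
    by (simp add: lookup_add lookup_sum lookup_minus case_prod_unfold del: sum.lessThan_Suc)
qed

section \<open>The Maurer--Cartan equation\<close>

lemma a_minus_cong:
  assumes "carrier H = carrier G" "\<zero>\<^bsub>H\<^esub> = \<zero>\<^bsub>G\<^esub>" "add H = add G"
  shows "x \<ominus>\<^bsub>H\<^esub> y = x \<ominus>\<^bsub>G\<^esub> y"
  using assms by (simp add: a_minus_def a_inv_def m_inv_def)

locale connection_action = projective_module K B M + module_connection K B M nabla
  for K (structure) and B (structure) and M and nabla +
  fixes D :: "('a, 'l, 'w) lie_scheme" and \<phi> and \<rho>
  assumes action: "derivation_action K B M D \<phi> \<rho>"
begin

sublocale D: lie_algebra K D
  using action by (simp add: derivation_action_def)

lemma phi_Der: "f \<in> carrier D \<Longrightarrow> \<phi> f \<in> carrier (Der_lie K B)"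
  using action by (auto simp: derivation_action_def lie_hom_def linear_map_def)

lemma phi_add: "\<lbrakk>f \<in> carrier D; g \<in> carrier D; b \<in> carrier B\<rbrakk> \<Longrightarrow> \<phi> (f \<oplus>\<^bsub>D\<^esub> g) b = \<phi> f b \<oplus>\<^bsub>B\<^esub> \<phi> g b"
  using action
  by (simp add: derivation_action_def lie_hom_def linear_map_def Der_lie_def commutator_lie_def Let_def pointwise_simps)

lemma phi_smult: "\<lbrakk>k \<in> carrier K; f \<in> carrier D; b \<in> carrier B\<rbrakk> \<Longrightarrow> \<phi> (k \<odot>\<^bsub>D\<^esub> f) b = k \<odot>\<^bsub>B\<^esub> \<phi> f b"
  using action
  by (simp add: derivation_action_def lie_hom_def linear_map_def Der_lie_def commutator_lie_def Let_def pointwise_def)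

lemma phi_bracket:
  "\<lbrakk>f \<in> carrier D; g \<in> carrier D; b \<in> carrier B\<rbrakk>
    \<Longrightarrow> \<phi> (bracket D f g) b = \<phi> f (\<phi> g b) \<ominus>\<^bsub>B\<^esub> \<phi> g (\<phi> f b)"
  using action by (simp add: derivation_action_def lie_hom_def Der_lie_def commutator_lie_def Let_def)

lemma rho_End: "f \<in> carrier D \<Longrightarrow> \<rho> f \<in> linear_maps K (restrict_scalars B M) (restrict_scalars B M)"
  using action
  by (auto simp: derivation_action_def lie_hom_def linear_map_def End_lie_def commutator_lie_def Let_def)

lemma additive_rho: "f \<in> carrier D \<Longrightarrow> additive_map M M (\<rho> f)"
  using linear_maps_D(5)[OF rho_End] by (simp add: additive_map_def restrict_scalars_def)

lemma rho_add: "\<lbrakk>f \<in> carrier D; g \<in> carrier D; m \<in> carrier M\<rbrakk> \<Longrightarrow> \<rho> (f \<oplus>\<^bsub>D\<^esub> g) m = \<rho> f m \<oplus>\<^bsub>M\<^esub> \<rho> g m"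
  using action
  by (simp add: derivation_action_def lie_hom_def linear_map_def End_lie_def commutator_lie_def Let_def
      pointwise_def restrict_scalars_def)

lemma rho_smult:
  "\<lbrakk>k \<in> carrier K; f \<in> carrier D; m \<in> carrier M\<rbrakk> \<Longrightarrow> \<rho> (k \<odot>\<^bsub>D\<^esub> f) m = (k \<odot>\<^bsub>B\<^esub> \<one>\<^bsub>B\<^esub>) \<odot>\<^bsub>M\<^esub> \<rho> f m"
  using action
  by (simp add: derivation_action_def lie_hom_def linear_map_def End_lie_def commutator_lie_def Let_def
      pointwise_def restrict_scalars_def)

lemma rho_bracket:
  assumes "f \<in> carrier D" "g \<in> carrier D" "m \<in> carrier M"
  shows "\<rho> (bracket D f g) m = \<rho> f (\<rho> g m) \<ominus>\<^bsub>M\<^esub> \<rho> g (\<rho> f m)"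
proof -
  have "x \<ominus>\<^bsub>restrict_scalars B M\<^esub> y = x \<ominus>\<^bsub>M\<^esub> y" for x y
    by (rule a_minus_cong) (simp_all add: restrict_scalars_def)
  moreover have "carrier (restrict_scalars B M) = carrier M" by (simp add: restrict_scalars_def)
  ultimately show ?thesis
    using action assms
    by (simp add: derivation_action_def lie_hom_def End_lie_def commutator_lie_def Let_def)
qed

lemma rho_derivation: "f \<in> carrier D \<Longrightarrow> derivation_along (\<phi> f) (\<rho> f)"
  using action by (auto simp: derivation_along_def phi_Der additive_rho derivation_action_def)

lemma covariant_derivation: "f \<in> carrier D \<Longrightarrow> derivation_along (\<phi> f) (\<nabla> (\<phi> f))"
  by (auto simp: derivation_along_def phi_Der additive_covariant covariant_smult)

lemma contraction_id_linear:
  assumes f: "f \<in> carrier D" and t: "t \<in> carrier \<Omega>M"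
  shows "g \<in> carrier D \<Longrightarrow> \<kappa> (\<phi> (f \<oplus>\<^bsub>D\<^esub> g)) t = \<kappa> (\<phi> f) t \<oplus>\<^bsub>M\<^esub> \<kappa> (\<phi> g) t"
    and "k \<in> carrier K \<Longrightarrow> \<kappa> (\<phi> (k \<odot>\<^bsub>D\<^esub> f)) t = (k \<odot>\<^bsub>B\<^esub> \<one>\<^bsub>B\<^esub>) \<odot>\<^bsub>M\<^esub> \<kappa> (\<phi> f) t"
proof -
  note ag = L.M.abelian_group_axioms
  note f' = phi_Der[OF f]
  note simps = contraction_id_pure form_gen_closed contraction_gen Der_closed B.l_distr B.r_distr
     L.smult_l_distr scalar_act smult_mult_left smult_mult_right
  show "\<kappa> (\<phi> (f \<oplus>\<^bsub>D\<^esub> g)) t = \<kappa> (\<phi> f) t \<oplus>\<^bsub>M\<^esub> \<kappa> (\<phi> g) t" if g: "g \<in> carrier D"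
  proof (rule T1_map_eqI[OF ag _ _ _ t])
    have fg: "\<phi> (f \<oplus>\<^bsub>D\<^esub> g) \<in> carrier (Der_lie K B)" using f g by (intro phi_Der) simp
    note g' = phi_Der[OF g]
    show "additive_map \<Omega>M M (\<kappa> (\<phi> (f \<oplus>\<^bsub>D\<^esub> g)))" by (rule additive_contraction_id[OF fg])
    show "additive_map \<Omega>M M (\<lambda>t. \<kappa> (\<phi> f) t \<oplus>\<^bsub>M\<^esub> \<kappa> (\<phi> g) t)"
      by (rule L.M.additive_map_comb(1)[OF additive_contraction_id[OF f'] additive_contraction_id[OF g']])
    fix a b c m assume "a \<in> carrier B" "b \<in> carrier B" "c \<in> carrier B" "m \<in> carrier M"
    then show "\<kappa> (\<phi> (f \<oplus>\<^bsub>D\<^esub> g)) (fg a b c \<otimes>\<^sub>1 m) = \<kappa> (\<phi> f) (fg a b c \<otimes>\<^sub>1 m) \<oplus>\<^bsub>M\<^esub> \<kappa> (\<phi> g) (fg a b c \<otimes>\<^sub>1 m)"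
      using f g f' g' fg by (simp add: simps phi_add)
  qed
  show "\<kappa> (\<phi> (k \<odot>\<^bsub>D\<^esub> f)) t = (k \<odot>\<^bsub>B\<^esub> \<one>\<^bsub>B\<^esub>) \<odot>\<^bsub>M\<^esub> \<kappa> (\<phi> f) t" if k: "k \<in> carrier K"
  proof (rule T1_map_eqI[OF ag _ _ _ t])
    have kf: "\<phi> (k \<odot>\<^bsub>D\<^esub> f) \<in> carrier (Der_lie K B)" using f k by (intro phi_Der) simp
    show "additive_map \<Omega>M M (\<kappa> (\<phi> (k \<odot>\<^bsub>D\<^esub> f)))" by (rule additive_contraction_id[OF kf])
    show "additive_map \<Omega>M M (\<lambda>t. (k \<odot>\<^bsub>B\<^esub> \<one>\<^bsub>B\<^esub>) \<odot>\<^bsub>M\<^esub> \<kappa> (\<phi> f) t)"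
      using k by (intro additive_map_comp[OF additive_contraction_id[OF f'] additive_act]) simp
    fix a b c m assume "a \<in> carrier B" "b \<in> carrier B" "c \<in> carrier B" "m \<in> carrier M"
    then show "\<kappa> (\<phi> (k \<odot>\<^bsub>D\<^esub> f)) (fg a b c \<otimes>\<^sub>1 m) = (k \<odot>\<^bsub>B\<^esub> \<one>\<^bsub>B\<^esub>) \<odot>\<^bsub>M\<^esub> \<kappa> (\<phi> f) (fg a b c \<otimes>\<^sub>1 m)"
      using f f' k kf by (simp add: simps phi_smult)
  qed
qed

abbreviation c where "c \<equiv> connection_diff B M \<phi> \<rho> nabla"

lemma c_eq: "c f = (\<lambda>m\<in>carrier M. \<nabla> (\<phi> f) m \<ominus>\<^bsub>M\<^esub> \<rho> f m)"
  by (simp add: connection_diff_def covariant_def)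

lemma c_End:
  assumes f: "f \<in> carrier D"
  shows "c f \<in> EndM"
proof -
  have R: "additive_map M M (\<rho> f)" by (rule additive_rho[OF f])
  have N: "additive_map M M (\<nabla> (\<phi> f))" by (rule additive_covariant[OF phi_Der[OF f]])
  have "\<rho> f (b \<odot>\<^bsub>M\<^esub> m) = \<phi> f b \<odot>\<^bsub>M\<^esub> m \<oplus>\<^bsub>M\<^esub> b \<odot>\<^bsub>M\<^esub> \<rho> f m" if "b \<in> carrier B" "m \<in> carrier M" for b m
    using rho_derivation[OF f] that by (auto simp: derivation_along_def)
  then show ?thesis unfolding c_eq
    by (intro restrict_End)
      (auto simp: additive_map_closed[OF R] additive_map_closed[OF N] additive_map_add[OF R] additive_map_add[OF N]
       covariant_smult[OF phi_Der[OF f]] L.M.minus_add_interchange L.M.add_cancel_common L.smult_closed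
       L.M.minus_eq_zero_iff Der_closed[OF phi_Der[OF f]]
       additive_map_minus[OF L.M.abelian_group_axioms L.M.abelian_group_axioms additive_act])
qed

lemma additive_c: "additive_map D E c"
proof (rule additive_mapI)
  fix f g assume fg: "f \<in> carrier D" "g \<in> carrier D"
  show "c (f \<oplus>\<^bsub>D\<^esub> g) = c f \<oplus>\<^bsub>E\<^esub> c g"
    unfolding pointwise_simps c_eq
  proof (rule restrict_ext)
    fix m assume m: "m \<in> carrier M"
    have "\<nabla> (\<phi> (f \<oplus>\<^bsub>D\<^esub> g)) m = \<nabla> (\<phi> f) m \<oplus>\<^bsub>M\<^esub> \<nabla> (\<phi> g) m"
      using contraction_id_linear(1)[OF fg(1) nabla_closed[OF m] fg(2)] by (simp add: covariant_def)
    then show "\<nabla> (\<phi> (f \<oplus>\<^bsub>D\<^esub> g)) m \<ominus>\<^bsub>M\<^esub> \<rho> (f \<oplus>\<^bsub>D\<^esub> g) m =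
      (\<lambda>m\<in>carrier M. \<nabla> (\<phi> f) m \<ominus>\<^bsub>M\<^esub> \<rho> f m) m \<oplus>\<^bsub>M\<^esub> (\<lambda>m\<in>carrier M. \<nabla> (\<phi> g) m \<ominus>\<^bsub>M\<^esub> \<rho> g m) m"
      using fg m by (simp add: rho_add L.M.minus_add_interchange covariant_closed phi_Der additive_map_closed[OF additive_rho])
  qed
qed (simp add: End_iff c_End)

lemma c_smult:
  assumes k: "k \<in> carrier K" and f: "f \<in> carrier D"
  shows "c (k \<odot>\<^bsub>D\<^esub> f) = scale k (c f)"
  unfolding scale_def c_eq
proof (rule restrict_ext)
  fix m assume m: "m \<in> carrier M"
  let ?k = "k \<odot>\<^bsub>B\<^esub> \<one>\<^bsub>B\<^esub>"
  have k': "?k \<in> carrier B" using k by simp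
  have "\<nabla> (\<phi> (k \<odot>\<^bsub>D\<^esub> f)) m = ?k \<odot>\<^bsub>M\<^esub> \<nabla> (\<phi> f) m"
    using contraction_id_linear(2)[OF f nabla_closed[OF m] k] by (simp add: covariant_def)
  then show "\<nabla> (\<phi> (k \<odot>\<^bsub>D\<^esub> f)) m \<ominus>\<^bsub>M\<^esub> \<rho> (k \<odot>\<^bsub>D\<^esub> f) m = ?k \<odot>\<^bsub>M\<^esub> (\<lambda>m\<in>carrier M. \<nabla> (\<phi> f) m \<ominus>\<^bsub>M\<^esub> \<rho> f m) m"
    using f m k
    by (simp add: rho_smult covariant_closed phi_Der additive_map_closed[OF additive_rho]
      additive_map_minus[OF L.M.abelian_group_axioms L.M.abelian_group_axioms additive_act[OF k']])
qed

text \<open>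
  The commutator of \<open>h\<close> with \<open>S\<^sub>f = \<rho>\<^sub>f + \<nabla>\<^sub>f\<close>, a derivation along \<open>2 \<phi>(f)\<close>.
\<close>

definition double_commutator where
  "double_commutator f h = commutator (\<rho> f) h \<oplus>\<^bsub>E\<^esub> commutator (\<nabla> (\<phi> f)) h"

lemma double_commutator_End: "\<lbrakk>f \<in> carrier D; h \<in> EndM\<rbrakk> \<Longrightarrow> double_commutator f h \<in> EndM"
  unfolding double_commutator_def
  by (intro End_add commutator_End[OF rho_derivation] commutator_End[OF covariant_derivation])

text \<open>
  Since both \<open>\<rho>\<close> and \<open>f \<mapsto> \<nabla>\<^sub>f\<close> are Lie homomorphisms, \<open>c[f,g] = [\<nabla>\<^sub>f, \<nabla>\<^sub>g] - [\<rho>\<^sub>f, \<rho>\<^sub>g]\<close>. On the right hand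
  side the mixed products of \<open>\<rho>\<close> and \<open>\<nabla>\<close> cancel, which is where the symmetric choice
  \<open>\<rho>\<^sub>f + \<nabla>\<^sub>f\<close> is used.
\<close>

lemma maurer_cartan:
  assumes flat: "flat K B M nabla" and f: "f \<in> carrier D" and g: "g \<in> carrier D"
  shows "c (bracket D f g) \<oplus>\<^bsub>E\<^esub> c (bracket D f g) = double_commutator f (c g) \<ominus>\<^bsub>E\<^esub> double_commutator g (c f)"
proof (rule extensionalityI)
  interpret E: abelian_group E by (rule abelian_group_End)
  have fg: "bracket D f g \<in> carrier D" using f g by (rule D.bracket_closed)
  have T: "double_commutator f (c g) \<in> carrier E" "double_commutator g (c f) \<in> carrier E"
    using double_commutator_End[OF f c_End[OF g]] double_commutator_End[OF g c_End[OF f]] by (simp_all add: End_iff)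
  show "double_commutator f (c g) \<ominus>\<^bsub>E\<^esub> double_commutator g (c f) \<in> extensional (carrier M)"
    using E.minus_closed[OF T] by (simp add: End_iff linear_maps_D(4))
  show "c (bracket D f g) \<oplus>\<^bsub>E\<^esub> c (bracket D f g) \<in> extensional (carrier M)"
    using End_add[OF c_End[OF fg] c_End[OF fg]] by (rule linear_maps_D(4))
  fix m assume m: "m \<in> carrier M"
  have ev: "additive_map E M (\<lambda>g. g m)"
    by (rule additive_evaluation) (use m linear_maps_D(1) in auto)
  have cl: "\<rho> h x \<in> carrier M" "\<nabla> (\<phi> h) x \<in> carrier M" if "h \<in> carrier D" "x \<in> carrier M" for h x
    using that by (simp_all add: additive_map_closed[OF additive_rho] covariant_closed phi_Der)
  have cov: "\<nabla> (\<phi> (bracket D f g)) m = \<nabla> (\<phi> f) (\<nabla> (\<phi> g) m) \<ominus>\<^bsub>M\<^esub> \<nabla> (\<phi> g) (\<nabla> (\<phi> f) m)"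
    by (rule flat_covariant[OF flat phi_Der[OF f] phi_Der[OF g] phi_Der[OF fg] phi_bracket[OF f g] m])
  note ag = L.M.abelian_group_axioms
  have tw: "double_commutator f (c g) m =
      ((\<rho> f (\<nabla> (\<phi> g) m) \<ominus>\<^bsub>M\<^esub> \<rho> f (\<rho> g m)) \<ominus>\<^bsub>M\<^esub> (\<nabla> (\<phi> g) (\<rho> f m) \<ominus>\<^bsub>M\<^esub> \<rho> g (\<rho> f m))) \<oplus>\<^bsub>M\<^esub>
      ((\<nabla> (\<phi> f) (\<nabla> (\<phi> g) m) \<ominus>\<^bsub>M\<^esub> \<nabla> (\<phi> f) (\<rho> g m)) \<ominus>\<^bsub>M\<^esub> (\<nabla> (\<phi> g) (\<nabla> (\<phi> f) m) \<ominus>\<^bsub>M\<^esub> \<rho> g (\<nabla> (\<phi> f) m)))"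
    if f: "f \<in> carrier D" and g: "g \<in> carrier D" for f g
    using m f g
    by (simp add: double_commutator_def pointwise_simps commutator_def c_eq cl
      additive_map_minus[OF ag ag additive_rho[OF f]] additive_map_minus[OF ag ag additive_covariant[OF phi_Der[OF f]]])
  show "(c (bracket D f g) \<oplus>\<^bsub>E\<^esub> c (bracket D f g)) m = (double_commutator f (c g) \<ominus>\<^bsub>E\<^esub> double_commutator g (c f)) m"
    unfolding additive_map_minus[OF E.abelian_group_axioms ag ev T] tw[OF f g] tw[OF g f]
    using m f g fg
    by (subst L.M.maurer_cartan_cancel) (simp_all add: pointwise_simps c_eq cov rho_bracket cl)
qed

section \<open>Divergence cochains\<close>

abbreviation dv where "dv \<equiv> Div K B M \<phi> \<rho> nabla"
abbreviation V where "V \<equiv> cyc K B"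

lemma Div_eq: "dv fs = tr (composite (map c fs))"
  by (simp add: Div_def composite_def idM_def)

lemma map_c_End: "set fs \<subseteq> carrier D \<Longrightarrow> set (map c fs) \<subseteq> EndM"
  using c_End by auto

lemma Div_closed: "set fs \<subseteq> carrier D \<Longrightarrow> dv fs \<in> carrier V"
  unfolding Div_eq by (intro Tr_closed composite_End map_c_End)

lemma linear_Div_slot:
  assumes fs: "set fs \<subseteq> carrier D" and p: "p < length fs"
  shows "linear_map K D V (\<lambda>y. dv (fs[p := y]))"
proof -
  note E = map_c_End[OF fs]
  have p': "p < length (map c fs)" using p by simp
  have "additive_map D V (\<lambda>y. tr (composite ((map c fs)[p := c y])))"
    by (rule additive_map_comp[OF additive_c additive_Tr_slot[OF E p']])
  moreover have "tr (composite ((map c fs)[p := c (k \<odot>\<^bsub>D\<^esub> y)])) = k \<odot>\<^bsub>V\<^esub> tr (composite ((map c fs)[p := c y]))"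
    if "k \<in> carrier K" "y \<in> carrier D" for k y
    using that by (simp add: c_smult composite_slot_scale[OF E p'] c_End
        Tr_scale composite_End[OF set_list_update_subset[OF E]])
  ultimately show ?thesis
    by (auto simp: linear_map_def additive_map_def Div_eq map_update)
qed

lemma Div_rotate: "set (f # fs) \<subseteq> carrier D \<Longrightarrow> dv (f # fs) = dv (fs @ [f])"
  using Tr_composite_rotate[of "c f" "map c fs"] map_c_End[of "f # fs"] by (simp add: Div_eq)

text \<open>
  The trace of \<open>c(f\<^sub>0) \<circ> \<dots> \<circ> c(f\<^sub>k\<^sub>-\<^sub>1)\<close> with the factor in position \<open>p\<close> replaced by \<open>[S\<^sub>a, c(b)]\<close>. The
  arguments are paired, so that \<open>slot\<close> can serve as the map on generators of a free abelian group.
\<close>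

definition slot where
  "slot = (\<lambda>(p, a, b, fs). tr (composite ((map c fs)[p := double_commutator a (c b)])))"

lemma slot_closed:
  "\<lbrakk>a \<in> carrier D; b \<in> carrier D; set fs \<subseteq> carrier D\<rbrakk> \<Longrightarrow> slot (p, a, b, fs) \<in> carrier V"
  unfolding slot_def prod.case
  by (intro Tr_closed composite_End set_list_update_subset map_c_End double_commutator_End c_End)

lemma slot_update: "slot (p, a, b, fs[p := z]) = slot (p, a, b, fs)"
  by (simp add: slot_def map_update)

text \<open>
  Apply the Leibniz rule with \<open>D = \<rho>\<^sub>f\<close> and with \<open>D = \<nabla>\<^sub>f\<close>, and add the results.
\<close>

lemma double_act_Div:
  assumes f: "f \<in> carrier D" and fs: "set fs \<subseteq> carrier D"
  shows "act (\<phi> f) (dv fs) \<oplus>\<^bsub>V\<^esub> act (\<phi> f) (dv fs) = (\<Oplus>\<^bsub>V\<^esub>p\<in>{..<length fs}. slot (p, f, fs ! p, fs))"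
proof -
  interpret V: abelian_group V by (rule abelian_group_cyc)
  note E = map_c_End[OF fs]
  let ?s = "\<lambda>X p. tr (composite ((map c fs)[p := commutator X (map c fs ! p)]))"
  have cl: "?s X \<in> {..<length fs} \<rightarrow> carrier V" if "derivation_along (\<phi> f) X" for X
    using E by (auto intro!: Tr_closed composite_slot_commutator_End[OF that])
  have "act (\<phi> f) (dv fs) \<oplus>\<^bsub>V\<^esub> act (\<phi> f) (dv fs) =
      (\<Oplus>\<^bsub>V\<^esub>p\<in>{..<length fs}. ?s (\<rho> f) p) \<oplus>\<^bsub>V\<^esub> (\<Oplus>\<^bsub>V\<^esub>p\<in>{..<length fs}. ?s (\<nabla> (\<phi> f)) p)"
    using act_Tr_composite[OF rho_derivation[OF f] E] act_Tr_composite[OF covariant_derivation[OF f] E]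
    by (simp add: Div_eq)
  also have "\<dots> = (\<Oplus>\<^bsub>V\<^esub>p\<in>{..<length fs}. ?s (\<rho> f) p \<oplus>\<^bsub>V\<^esub> ?s (\<nabla> (\<phi> f)) p)"
    by (rule V.finsum_addf[OF cl[OF rho_derivation[OF f]] cl[OF covariant_derivation[OF f]], symmetric])
  also have "\<dots> = (\<Oplus>\<^bsub>V\<^esub>p\<in>{..<length fs}. slot (p, f, fs ! p, fs))"
  proof (rule V.finsum_cong'[OF refl])
    show "(\<lambda>p. slot (p, f, fs ! p, fs)) \<in> {..<length fs} \<rightarrow> carrier V"
      using f fs by (auto intro!: slot_closed)
    fix p assume "p \<in> {..<length fs}"
    then have p: "p < length (map c fs)" and cp: "map c fs ! p = c (fs ! p)" "c (fs ! p) \<in> EndM"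
      using fs c_End by (auto dest: nth_mem)
    show "?s (\<rho> f) p \<oplus>\<^bsub>V\<^esub> ?s (\<nabla> (\<phi> f)) p = slot (p, f, fs ! p, fs)"
      unfolding slot_def double_commutator_def prod.case cp(1)
      by (rule additive_map_add[OF additive_Tr_slot[OF E p], symmetric])
        (use cp f in \<open>simp_all add: End_iff commutator_End[OF rho_derivation] commutator_End[OF covariant_derivation]\<close>)
  qed
  finally show ?thesis .
qed

lemma double_Div_bracket:
  assumes flat: "flat K B M nabla" and a: "a \<in> carrier D" and b: "b \<in> carrier D"
    and fs: "set fs \<subseteq> carrier D" and p: "p < length fs" "fs ! p = bracket D a b"
  shows "dv fs \<oplus>\<^bsub>V\<^esub> dv fs = slot (p, a, b, fs) \<ominus>\<^bsub>V\<^esub> slot (p, b, a, fs)"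
proof -
  note E = map_c_End[OF fs]
  have p': "p < length (map c fs)" using p by simp
  note add = additive_Tr_slot[OF E p']
  have upd: "(map c fs)[p := c (bracket D a b)] = map c fs"
    using p by (metis list_update_id nth_map)
  have cb: "c (bracket D a b) \<in> carrier E" using a b by (simp add: End_iff c_End D.bracket_closed)
  have "dv fs \<oplus>\<^bsub>V\<^esub> dv fs = tr (composite ((map c fs)[p := c (bracket D a b) \<oplus>\<^bsub>E\<^esub> c (bracket D a b)]))"
    using additive_map_add[OF add cb cb] by (simp add: upd Div_eq)
  also have "\<dots> = slot (p, a, b, fs) \<ominus>\<^bsub>V\<^esub> slot (p, b, a, fs)"
    unfolding maurer_cartan[OF flat a b] slot_def prod.case
    by (rule additive_map_minus[OF abelian_group_End abelian_group_cyc add])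
      (use a b in \<open>simp_all add: End_iff double_commutator_End c_End\<close>)
  finally show ?thesis .
qed

end

context connection_action
begin

lemma set_nths_D: "set xs \<subseteq> carrier D \<Longrightarrow> set (nths xs I) \<subseteq> carrier D"
  using set_nths_subset by fastforce

text \<open>
  Both sums of the doubled differential are values of one additive map \<open>frag_eval V slot\<close> at formal
  sums, and the formal sums add up to zero.
\<close>

lemma double_ce_differential:
  assumes flat: "flat K B M nabla" and xs: "length xs = Suc k" "set xs \<subseteq> carrier D"
  shows "ce_differential D V (cyc_action K B \<phi>) (comp_alt V dv) xs \<oplus>\<^bsub>V\<^esub>
    ce_differential D V (cyc_action K B \<phi>) (comp_alt V dv) xs = \<zero>\<^bsub>V\<^esub>"
proof -
  interpret V: abelian_group V by (rule abelian_group_cyc)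
  let ?\<psi> = "comp_alt V dv" and ?S = "{s. s permutes {..<k}}"
  let ?X = "{(p :: nat, a, b, ys). a \<in> carrier D \<and> b \<in> carrier D \<and> set ys \<subseteq> carrier D}"
  \<comment> \<open>The entry in position \<open>p\<close> does not matter for \<open>slot\<close>; zero is put there so that
    formal generators with equal values are equal.\<close>
  define q where "q p a b ys = frag_of (p, a, b, ys[p := \<zero>\<^bsub>D\<^esub>])" for p :: nat and a b :: 'l and ys
  have slotX: "slot \<in> ?X \<rightarrow> carrier V" by (auto intro!: slot_closed)
  have qX: "Poly_Mapping.keys (q p a b ys) \<subseteq> ?X"
    if "a \<in> carrier D" "b \<in> carrier D" "set ys \<subseteq> carrier D" for p a b ys
    using that set_list_update_subset[OF that(3) D.M.zero_closed, of p] by (simp add: q_def)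
  have qeval: "frag_eval V slot (q p a b ys) = slot (p, a, b, ys)"
    if "a \<in> carrier D" "b \<in> carrier D" "set ys \<subseteq> carrier D" for p a b ys
    using slot_closed[OF that, of p] unfolding q_def by (subst V.frag_eval_of) (simp_all add: slot_update)
  have x: "xs ! i \<in> carrier D" if "i < Suc k" for i using xs that by (metis nth_mem subsetD)

  \<comment> \<open>\<open>L i s\<close> represents the doubled action of the \<open>i\<close>-th argument on the divergence of the others,
    permuted by \<open>s\<close>.\<close>
  define L where "L i s = (\<Sum>p<k. q p (xs ! i) (permute_list s (nths xs (- {i})) ! p) (permute_list s (nths xs (- {i}))))"
    for i s
  have ys: "length (permute_list s (nths xs (- {i}))) = k" "set (permute_list s (nths xs (- {i}))) \<subseteq> carrier D"
    if "i < Suc k" "s \<in> ?S" for i s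
    using that xs set_nths_D[OF xs(2)] by (auto simp: length_nths_remove1)
  have yp: "permute_list s (nths xs (- {i})) ! p \<in> carrier D" if "i < Suc k" "s \<in> ?S" "p < k" for i s p
    using ys[OF that(1,2)] that(3) by (metis nth_mem subsetD)
  have LX: "Poly_Mapping.keys (L i s) \<subseteq> ?X" if "i < Suc k" "s \<in> ?S" for i s
    unfolding L_def
    by (rule order_trans[OF keys_sum]) (use qX[OF x[OF that(1)] yp[OF that] ys(2)[OF that]] in blast)
  have Leval: "frag_eval V slot (L i s) = act (\<phi> (xs ! i)) (dv (permute_list s (nths xs (- {i})))) \<oplus>\<^bsub>V\<^esub>
      act (\<phi> (xs ! i)) (dv (permute_list s (nths xs (- {i}))))"
    if "i < Suc k" "s \<in> ?S" for i s
  proof -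
    have "frag_eval V slot (L i s) = (\<Oplus>\<^bsub>V\<^esub>p\<in>{..<k}. frag_eval V slot (q p (xs ! i)
       (permute_list s (nths xs (- {i})) ! p) (permute_list s (nths xs (- {i})))))"
      unfolding L_def
      by (rule V.frag_eval_sum[OF slotX]) (use qX[OF x[OF that(1)] yp[OF that] ys(2)[OF that]] in simp)
    also have "\<dots> = (\<Oplus>\<^bsub>V\<^esub>p\<in>{..<k}. slot (p, xs ! i,
       permute_list s (nths xs (- {i})) ! p, permute_list s (nths xs (- {i}))))"
      by (rule V.finsum_cong'[OF refl])
        (use x[OF that(1)] yp[OF that] ys(2)[OF that] in \<open>auto simp: qeval intro!: slot_closed\<close>)
    finally show ?thesis
      using double_act_Div[OF x[OF that(1)] ys(2)[OF that]] ys(1)[OF that] by simp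
  qed
  have LLX: "Poly_Mapping.keys (\<Sum>s\<in>?S. frag_cmul (sign s) (L i s)) \<subseteq> ?X" if "i < Suc k" for i
    by (rule V.frag_eval_lincomb(1)[OF slotX LX[OF that]])
  have act_\<psi>: "act (\<phi> (xs ! i)) (?\<psi> (nths xs (- {i}))) \<in> carrier V"
    and LL: "frag_eval V slot (\<Sum>s\<in>?S. frag_cmul (sign s) (L i s)) =
      act (\<phi> (xs ! i)) (?\<psi> (nths xs (- {i}))) \<oplus>\<^bsub>V\<^esub> act (\<phi> (xs ! i)) (?\<psi> (nths xs (- {i})))"
    if "i < Suc k" for i
  proof -
    have len: "length (nths xs (- {i})) = k" using that xs by (simp add: length_nths_remove1)
    have dvc: "dv ys \<in> carrier V" if "set ys = set (nths xs (- {i}))" for ys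
      using set_nths_D[OF xs(2)] that by (intro Div_closed) auto
    note A = additive_act_cyc[OF phi_Der[OF x[OF that]]]
    show "act (\<phi> (xs ! i)) (?\<psi> (nths xs (- {i}))) \<in> carrier V"
      by (rule additive_map_closed[OF A V.comp_alt_closed]) (rule dvc)
    have "frag_eval V slot (\<Sum>s\<in>?S. frag_cmul (sign s) (L i s)) = (\<Oplus>\<^bsub>V\<^esub>s\<in>?S. [sign s] \<cdot>\<^bsub>V\<^esub> frag_eval V slot (L i s))"
      by (rule V.frag_eval_lincomb(2)[OF slotX LX[OF that]])
    also have "\<dots> = comp_alt V (\<lambda>ys. act (\<phi> (xs ! i)) (dv ys) \<oplus>\<^bsub>V\<^esub> act (\<phi> (xs ! i)) (dv ys)) (nths xs (- {i}))"
      unfolding comp_alt_def len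
      by (rule V.finsum_cong'[OF refl])
        (use additive_map_closed[OF A Div_closed[OF ys(2)[OF that]]] in \<open>auto simp: Leval[OF that]\<close>)
    also have "\<dots> = act (\<phi> (xs ! i)) (?\<psi> (nths xs (- {i}))) \<oplus>\<^bsub>V\<^esub> act (\<phi> (xs ! i)) (?\<psi> (nths xs (- {i})))"
      by (rule V.additive_comp_alt[OF _ V.abelian_group_axioms additive_map_comp[OF A V.additive_double], symmetric])
        (rule dvc)
    finally show "frag_eval V slot (\<Sum>s\<in>?S. frag_cmul (sign s) (L i s)) =
      act (\<phi> (xs ! i)) (?\<psi> (nths xs (- {i}))) \<oplus>\<^bsub>V\<^esub> act (\<phi> (xs ! i)) (?\<psi> (nths xs (- {i})))" .
  qed

  \<comment> \<open>\<open>R i j s\<close> represents the doubled divergence of the bracket of the \<open>i\<close>-th and \<open>j\<close>-th arguments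
    and the remaining ones, permuted by \<open>s\<close>.\<close>
  let ?P = "{(i, j). i < j \<and> j < Suc k}"
  define z where "z i j = bracket D (xs ! i) (xs ! j) # nths xs (- {i, j})" for i j
  define R where "R i j s = q (inv_into UNIV s 0) (xs ! i) (xs ! j) (permute_list s (z i j))
         - q (inv_into UNIV s 0) (xs ! j) (xs ! i) (permute_list s (z i j))" for i j s
  have lz: "length (z i j) = k" "set (z i j) \<subseteq> carrier D" if "i < j" "j < Suc k" for i j
  proof -
    show "length (z i j) = k"
      using nths_remove1_remove1[of j xs i] that xs
      by (auto simp: z_def insert_commute length_nths_remove1 dest: sym)
    show "set (z i j) \<subseteq> carrier D"
      using that set_nths_D[OF xs(2)] x[of i] x[of j] by (auto simp: z_def D.bracket_closed)
  qed
  have pz: "length (permute_list s (z i j)) = k" "set (permute_list s (z i j)) \<subseteq> carrier D"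
    if "i < j" "j < Suc k" "s \<in> ?S" for i j s
    using lz[OF that(1,2)] that(3) by auto
  have RX: "Poly_Mapping.keys (R i j s) \<subseteq> ?X" if "i < j" "j < Suc k" "s \<in> ?S" for i j s
  proof -
    have "xs ! i \<in> carrier D" "xs ! j \<in> carrier D" using x that by auto
    then show ?thesis
      unfolding R_def
      by (intro order_trans[OF keys_diff] Un_least qX pz(2)[OF that])
  qed
  have Reval: "frag_eval V slot (R i j s) = dv (permute_list s (z i j)) \<oplus>\<^bsub>V\<^esub> dv (permute_list s (z i j))"
    if ij: "i < j" "j < Suc k" and s: "s \<in> ?S" for i j s
  proof -
    have xx: "xs ! i \<in> carrier D" "xs ! j \<in> carrier D" using x ij by auto
    let ?p = "inv_into UNIV s 0"
    have s': "s permutes {..<Suc (length (nths xs (- {i, j})))}" using lz[OF ij] s by (simp add: z_def)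
    have sp: "s ?p = 0" using s by (metis mem_Collect_eq permutes_inverses(1))
    have p: "?p < length (permute_list s (z i j))" "permute_list s (z i j) ! ?p = bracket D (xs ! i) (xs ! j)"
      using permute_list_head(2,3)[OF s' sp] by (simp_all add: z_def)
    have "frag_eval V slot (R i j s) = slot (?p, xs ! i, xs ! j, permute_list s (z i j)) \<ominus>\<^bsub>V\<^esub>
       slot (?p, xs ! j, xs ! i, permute_list s (z i j))"
      unfolding R_def
      by (subst V.frag_eval_diff[OF slotX]) (use qX qeval xx pz(2)[OF ij s] in simp_all)
    then show ?thesis
      using double_Div_bracket[OF flat xx pz(2)[OF ij s] p] by simp
  qed
  have \<psi>z: "?\<psi> (z i j) \<in> carrier V"
    and RR: "frag_eval V slot (\<Sum>s\<in>?S. frag_cmul (sign s) (R i j s)) = ?\<psi> (z i j) \<oplus>\<^bsub>V\<^esub> ?\<psi> (z i j)"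
    and RRX: "Poly_Mapping.keys (\<Sum>s\<in>?S. frag_cmul (sign s) (R i j s)) \<subseteq> ?X"
    if ij: "i < j" "j < Suc k" for i j
  proof -
    have dvc: "dv ys \<in> carrier V" if "set ys = set (z i j)" for ys
      using lz[OF ij] that by (intro Div_closed) auto
    show "?\<psi> (z i j) \<in> carrier V" by (rule V.comp_alt_closed) (rule dvc)
    show "Poly_Mapping.keys (\<Sum>s\<in>?S. frag_cmul (sign s) (R i j s)) \<subseteq> ?X"
      by (rule V.frag_eval_lincomb(1)[OF slotX RX[OF ij]])
    have "frag_eval V slot (\<Sum>s\<in>?S. frag_cmul (sign s) (R i j s)) = (\<Oplus>\<^bsub>V\<^esub>s\<in>?S. [sign s] \<cdot>\<^bsub>V\<^esub> frag_eval V slot (R i j s))"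
      by (rule V.frag_eval_lincomb(2)[OF slotX RX[OF ij]])
    also have "\<dots> = comp_alt V (\<lambda>ys. dv ys \<oplus>\<^bsub>V\<^esub> dv ys) (z i j)"
      unfolding comp_alt_def lz(1)[OF ij]
      by (rule V.finsum_cong'[OF refl])
        (use Div_closed[OF pz(2)[OF ij]] in \<open>auto simp: Reval[OF ij]\<close>)
    also have "\<dots> = ?\<psi> (z i j) \<oplus>\<^bsub>V\<^esub> ?\<psi> (z i j)"
      by (rule V.additive_comp_alt[OF _ V.abelian_group_axioms V.additive_double, symmetric]) (rule dvc)
    finally show "frag_eval V slot (\<Sum>s\<in>?S. frag_cmul (sign s) (R i j s)) = ?\<psi> (z i j) \<oplus>\<^bsub>V\<^esub> ?\<psi> (z i j)" .
  qed

  let ?w1 = "\<lambda>i. (-1 :: int) ^ i" and ?w2 = "\<lambda>(i, j). (-1 :: int) ^ (i + j)"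
  let ?f1 = "\<lambda>i. act (\<phi> (xs ! i)) (?\<psi> (nths xs (- {i})))" and ?f2 = "\<lambda>(i, j). ?\<psi> (z i j)"
  let ?F1 = "\<Sum>i<Suc k. frag_cmul (?w1 i) (\<Sum>s\<in>?S. frag_cmul (sign s) (L i s))"
  let ?F2 = "\<Sum>u\<in>?P. frag_cmul (?w2 u) (case u of (i, j) \<Rightarrow> \<Sum>s\<in>?S. frag_cmul (sign s) (R i j s))"
  have zero: "?F1 + ?F2 = 0"
    using alternating_leibniz_cancel_frag[OF xs(1), of q "\<lambda>i j. bracket D (xs ! i) (xs ! j)"]
    by (simp add: L_def R_def z_def q_def case_prod_unfold del: sum.lessThan_Suc)
  let ?T1 = "\<Oplus>\<^bsub>V\<^esub>i\<in>{..<Suc k}. [?w1 i] \<cdot>\<^bsub>V\<^esub> ?f1 i" and ?T2 = "\<Oplus>\<^bsub>V\<^esub>u\<in>?P. [?w2 u] \<cdot>\<^bsub>V\<^esub> ?f2 u"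
  have f1: "?f1 \<in> {..<Suc k} \<rightarrow> carrier V" and f2: "?f2 \<in> ?P \<rightarrow> carrier V"
    using act_\<psi> \<psi>z by auto
  have c1: "?T1 \<in> carrier V" by (rule V.finsum_closed) (use f1 in blast)
  have c2: "?T2 \<in> carrier V" by (rule V.finsum_closed) (use f2 in blast)
  have X1: "Poly_Mapping.keys (\<Sum>s\<in>?S. frag_cmul (sign s) (L i s)) \<subseteq> ?X" if "i \<in> {..<Suc k}" for i
    using that LLX[of i] by simp
  have X2: "Poly_Mapping.keys (case u of (i, j) \<Rightarrow> \<Sum>s\<in>?S. frag_cmul (sign s) (R i j s)) \<subseteq> ?X" if "u \<in> ?P" for u
    using that RRX[of "fst u" "snd u"] by (simp add: case_prod_unfold)
  have E1: "frag_eval V slot ?F1 = (\<Oplus>\<^bsub>V\<^esub>i\<in>{..<Suc k}. [?w1 i] \<cdot>\<^bsub>V\<^esub> frag_eval V slot (\<Sum>s\<in>?S. frag_cmul (sign s) (L i s)))"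
    by (rule V.frag_eval_lincomb(2)[OF slotX]) (rule X1)
  have E2: "frag_eval V slot ?F2 = (\<Oplus>\<^bsub>V\<^esub>u\<in>?P. [?w2 u] \<cdot>\<^bsub>V\<^esub>
      frag_eval V slot (case u of (i, j) \<Rightarrow> \<Sum>s\<in>?S. frag_cmul (sign s) (R i j s)))"
    by (rule V.frag_eval_lincomb(2)[OF slotX]) (rule X2)
  have k1: "Poly_Mapping.keys ?F1 \<subseteq> ?X"
    by (rule V.frag_eval_lincomb(1)[OF slotX]) (rule X1)
  have k2: "Poly_Mapping.keys ?F2 \<subseteq> ?X"
    by (rule V.frag_eval_lincomb(1)[OF slotX]) (rule X2)
  have D1: "?T1 \<oplus>\<^bsub>V\<^esub> ?T1 = frag_eval V slot ?F1"
    unfolding V.double_lincomb[OF f1] E1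
  proof (rule V.finsum_cong'[OF refl])
    fix i assume i: "i \<in> {..<Suc k}"
    show "[?w1 i] \<cdot>\<^bsub>V\<^esub> (?f1 i \<oplus>\<^bsub>V\<^esub> ?f1 i) = [?w1 i] \<cdot>\<^bsub>V\<^esub> frag_eval V slot (\<Sum>s\<in>?S. frag_cmul (sign s) (L i s))"
      using LL[of i] i by simp
  qed (use V.frag_eval_closed[OF slotX X1] in \<open>intro Pi_I V.add.int_pow_closed\<close>)
  have D2: "?T2 \<oplus>\<^bsub>V\<^esub> ?T2 = frag_eval V slot ?F2"
    unfolding V.double_lincomb[OF f2] E2
  proof (rule V.finsum_cong'[OF refl])
    show "(\<lambda>u. [?w2 u] \<cdot>\<^bsub>V\<^esub> frag_eval V slot (case u of (i, j) \<Rightarrow> \<Sum>s\<in>?S. frag_cmul (sign s) (R i j s))) \<in> ?P \<rightarrow> carrier V"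
      using V.frag_eval_closed[OF slotX X2] by (intro Pi_I V.add.int_pow_closed)
    fix u assume "u \<in> ?P"
    then show "[?w2 u] \<cdot>\<^bsub>V\<^esub> (?f2 u \<oplus>\<^bsub>V\<^esub> ?f2 u) =
       [?w2 u] \<cdot>\<^bsub>V\<^esub> frag_eval V slot (case u of (i, j) \<Rightarrow> \<Sum>s\<in>?S. frag_cmul (sign s) (R i j s))"
      using RR[of "fst u" "snd u"] by (simp add: case_prod_unfold)
  qed
  have "ce_differential D V (cyc_action K B \<phi>) ?\<psi> xs = ?T1 \<oplus>\<^bsub>V\<^esub> ?T2"
    unfolding ce_differential_def xs(1) cyc_action_def z_def by (simp add: case_prod_unfold)
  then have "ce_differential D V (cyc_action K B \<phi>) ?\<psi> xs \<oplus>\<^bsub>V\<^esub> ce_differential D V (cyc_action K B \<phi>) ?\<psi> xs =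
      (?T1 \<oplus>\<^bsub>V\<^esub> ?T1) \<oplus>\<^bsub>V\<^esub> (?T2 \<oplus>\<^bsub>V\<^esub> ?T2)"
    using c1 c2 by (simp add: V.a_ac)
  also have "\<dots> = frag_eval V slot (?F1 + ?F2)"
    unfolding D1 D2
    by (rule V.frag_eval_add[OF slotX k1 k2, symmetric])
  finally show ?thesis unfolding zero by simp
qed

lemma ce_differential_closed:
  assumes xs: "length xs = Suc k" "set xs \<subseteq> carrier D"
  shows "ce_differential D V (cyc_action K B \<phi>) (comp_alt V dv) xs \<in> carrier V"
proof -
  interpret V: abelian_group V by (rule abelian_group_cyc)
  have x: "xs ! i \<in> carrier D" if "i < Suc k" for i using xs that by (metis nth_mem subsetD)
  have \<psi>: "comp_alt V dv ys \<in> carrier V" if "set ys \<subseteq> carrier D" for ys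
    by (rule V.comp_alt_closed) (use that Div_closed in auto)
  have z: "set (bracket D (xs ! i) (xs ! j) # nths xs (- {i, j})) \<subseteq> carrier D" if "i < j" "j < Suc k" for i j
    using that x[of i] x[of j] set_nths_D[OF xs(2)] by (auto simp: D.bracket_closed)
  show ?thesis
    unfolding ce_differential_def xs(1) cyc_action_def
    by (intro V.a_closed V.finsum_closed)
      (use x z \<psi> set_nths_D[OF xs(2)] additive_map_closed[OF additive_act_cyc[OF phi_Der]] in
       \<open>auto intro!: V.add.int_pow_closed\<close>)
qed

end

theorem theorem4p14:
  fixes K :: "('k, 'x) ring_scheme"
    and B :: "('k, 'b, 'y) module_scheme"
    and M :: "('b, 'm, 'z) module_scheme"
    and D :: "('k, 'd, 'w) lie_scheme"
    and \<phi> :: "'d \<Rightarrow> 'b \<Rightarrow> 'b"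
    and \<rho> :: "'d \<Rightarrow> 'm \<Rightarrow> 'm"
    and nabla :: "'m \<Rightarrow> ('b form1 \<times> 'm \<Rightarrow>\<^sub>0 int) set"
    and k :: nat
  assumes "field K"
    and "\<forall>n::nat. 0 < n \<longrightarrow> [n] \<cdot>\<^bsub>K\<^esub> \<one>\<^bsub>K\<^esub> \<noteq> \<zero>\<^bsub>K\<^esub>"
    and "assoc_algebra K B"
    and "left_module B M"
    and "fin_gen_projective B M"
    and "derivation_action K B M D \<phi> \<rho>"
    and "connection K B M nabla"
    and "1 \<le> k"
    and "flat K B M nabla"
  shows "ce_cocycle K D (cyc K B) (cyc_action K B \<phi>) k
           (comp_alt (cyc K B) (Div K B M \<phi> \<rho> nabla))
       \<and> (even k \<longrightarrow>
           (\<forall>fs. length fs = k \<and> set fs \<subseteq> carrier D \<longrightarrow>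
              comp_alt (cyc K B) (Div K B M \<phi> \<rho> nabla) fs = \<zero>\<^bsub>cyc K B\<^esub>))"
proof -
  interpret connection_action K B M nabla D \<phi> \<rho>
    using assms
    by (intro connection_action.intro projective_module.intro algebra_module.intro module_connection.intro
      projective_module_axioms.intro module_connection_axioms.intro connection_action_axioms.intro)
  interpret field K by fact
  interpret V: abelian_group V by (rule abelian_group_cyc)
  have "[(2::nat)] \<cdot>\<^bsub>K\<^esub> \<one>\<^bsub>K\<^esub> \<noteq> \<zero>\<^bsub>K\<^esub>" using assms(2) by simp
  then have two: "\<one>\<^bsub>K\<^esub> \<oplus>\<^bsub>K\<^esub> \<one>\<^bsub>K\<^esub> \<noteq> \<zero>\<^bsub>K\<^esub>"
    by (simp add: numeral_2_eq_2 add_pow_def nat_pow_def)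
  note halve = cyc_no_2_torsion[OF assms(1) two]
  have \<psi>: "comp_alt V dv fs \<in> carrier V" if "set fs \<subseteq> carrier D" for fs
    by (rule V.comp_alt_closed) (use that Div_closed in auto)
  have "comp_alt V dv \<in> ce_cochains K D V k"
    unfolding ce_cochains_def
  proof (intro CollectI allI impI conjI)
    fix xs assume xs: "length xs = k \<and> set xs \<subseteq> carrier D"
    then show "comp_alt V dv xs \<in> carrier V" using \<psi> by simp
    show "linear_map K D V (\<lambda>y. comp_alt V dv (xs[i := y]))" if "i < k" for i
    proof (rule linear_comp_alt[OF D.module_axioms V.abelian_group_axioms additive_cyc_smult])
      show "linear_map K D V (\<lambda>y. dv (ys[p := y]))"
        if "length ys = k" "set ys \<subseteq> carrier D" "p < k" for ys p
        using that by (intro linear_Div_slot) auto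
    qed (use xs that in auto)
    show "comp_alt V dv xs = \<zero>\<^bsub>V\<^esub>" if "i < k" "j < k" "i \<noteq> j \<and> xs ! i = xs ! j" for i j
    proof (rule V.comp_alt_repeat[of _ _ i j])
      show "dv ys \<in> carrier V" if "set ys = set xs" for ys
        using that xs by (intro Div_closed) simp
    qed (use xs that in auto)
  qed
  moreover have "ce_differential D V (cyc_action K B \<phi>) (comp_alt V dv) xs = \<zero>\<^bsub>V\<^esub>"
    if "length xs = Suc k \<and> set xs \<subseteq> carrier D" for xs
    using halve[OF ce_differential_closed double_ce_differential[OF assms(9)]] that by blast
  moreover have "comp_alt V dv fs = \<zero>\<^bsub>V\<^esub>" if "even k" "length fs = k \<and> set fs \<subseteq> carrier D" for fs
  proof (rule halve)
    show "comp_alt V dv fs \<in> carrier V" using that \<psi> by simp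
    show "comp_alt V dv fs \<oplus>\<^bsub>V\<^esub> comp_alt V dv fs = \<zero>\<^bsub>V\<^esub>"
    proof (rule V.comp_alt_cyclic_even)
      fix y ys assume "length (ys @ [y]) = length fs" "set (ys @ [y]) = set fs"
      then show "dv (y # ys) = dv (ys @ [y])" using that by (intro Div_rotate) auto
    qed (use that assms(8) Div_closed in auto)
  qed
  ultimately show ?thesis by (auto simp: ce_cocycle_def)
qed

end
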